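(* Let $\mathcal{C}$ be the class of Büchi-recognizable languages of infinite pictures. (a) The Borel hierarchy of the class $\mathcal{C}$ is equal to the Borel hierarchy of the (lightface) class $\Sigma^1_1$. (b) $\gamma_2^1=\sup\{\alpha\mid\text{there exists } L\in\mathcal{C}\text{ such that } L\text{ is a Borel set of rank }\alpha\}$. (c) For every non-null ordinal $\alpha<\omega_1^{\mathrm{CK}}$, there exist some $\mathbf{\Sigma}^0_\alpha$-complete and some $\mathbf{\Pi}^0_\alpha$-complete languages of infinite pictures in the class $\mathcal{C}$.
   Context: Pictures and tiling systems. Let $\Sigma$ be a finite alphabet, $\#\notin\Sigma$ a border letter, $\hat{\Sigma}=\Sigma\cup\{\#\}$. An $\omega$-picture over $\Sigma$ is a function $p:\omega\times\omega\to\hat{\Sigma}$ with $p(i,0)=p(0,i)=\#$ for all $i\ge 0$ and $p(i,j)\in\Sigma$ for all $i,j>0$; $\Sigma^{\omega,\omega}$ is the set of $\omega$-pictures over $\Sigma$ and a language of infinite pictures is a subset of some $\Sigma^{\omega,\omega}$. A tiling system is $\mathcal{A}=(Q,\Sigma,\Delta)$ with $Q$ a finite set of states and $\Delta\subseteq(\hat{\Sigma}\times Q)^4$ a finite set of tiles. A run of $\mathcal{A}$ on $p$ is a map $\rho:\omega\times\omega\to Q$ such that for all $(i,j)\in\omega\times\omega$ the tile $$\left(\begin{array}{cc}(p(i,j+1),\rho(i,j+1))&(p(i+1,j+1),\rho(i+1,j+1))\\(p(i,j),\rho(i,j))&(p(i+1,j),\rho(i+1,j))\end{array}\right)$$ belongs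 to $\Delta$. $L\subseteq\Sigma^{\omega,\omega}$ is Büchi-recognizable if there are a tiling system $\mathcal{A}$ and $F\subseteq Q$ such that $L$ is the set of $p$ having a run $\rho$ of $\mathcal{A}$ with $\rho(v)\in F$ for infinitely many $v\in\omega\times\omega$. Alphabets are finite with at least two letters. Topology. $\Sigma^\omega$ carries the Cantor topology, and $\Sigma^{\omega,\omega}$ the topology induced by the product topology of discrete spaces on $\hat{\Sigma}^{\omega\times\omega}$ (it is homeomorphic to $\Sigma^{\omega}$). $\mathbf{\Sigma}^0_\alpha,\mathbf{\Pi}^0_\alpha$ ($\alpha\ge1$ countable) are the usual boldface Borel classes. A set is Borel of rank $\alpha$ if it is in $\mathbf{\Sigma}^0_\alpha\cup\mathbf{\Pi}^0_\alpha$ but not in $\bigcup_{\beta<\alpha}(\mathbf{\Sigma}^0_\beta\cup\mathbf{\Pi}^0_\beta)$. For $\mathbf{\Gamma}=\mathbf{\Sigma}^0_\alpha$ or $\mathbf{\Pi}^0_\alpha$, a subset $S$ of $X=\Sigma^\omega$ or $X=\Sigma^{\omega,\omega}$ is $\mathbf{\Gamma}$-complete if for every finite alphabet $A$ and every $E\subseteq A^\omega$: $E\in\mathbf{\Gamma}$ iff there is a continuous $f:A^\omega\to X$ with $E=f^{-1}(S)$. Effective classes and ordinals. The (lightface) classes $\Sigma^1_1$ and $\Pi^1_1$ are the classes of subsets of $\Sigma^\omega$ ($\Sigma$ a finite alphabet) definable by existential, respectively universal, second order formulas of arithmetic. Equality of the Borel hierarchies of two classes of sets means: for every countable ordinal $\alpha\ge1$,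 one class contains a $\mathbf{\Sigma}^0_\alpha$-complete set (respectively, a $\mathbf{\Pi}^0_\alpha$-complete set, a Borel set of rank $\alpha$) if and only if the other does. $\omega_1^{\mathrm{CK}}$ is the first non-recursive ordinal (Church–Kleene ordinal). $\gamma_2^1$ is the ordinal of Kechris, Marker and Sami, which is the supremum of the Borel ranks of those (lightface) $\Pi^1_1$ sets (equivalently, of those $\Sigma^1_1$ sets) which are Borel. *)

theory Defs
  imports "HOL-Analysis.Analysis" "HOL-Library.Countable_Set_Type"
begin

unbundle cardinal_syntax

section \<open>Countable ordinals\<close>

text \<open>
  The well-order \<open>cardSuc natLeq\<close> has order type \<open>\<omega>\<^sub>1\<close>, so the elements of the following type,
  each identified with the order type of the set of its predecessors, are exactly the
  countable ordinals.
\<close>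

typedef omega1 = "Field (cardSuc natLeq)"
proof -
  have "infinite (Field (cardSuc natLeq))"
    using cardSuc_finite[OF natLeq_Card_order] Field_natLeq by simp
  then show ?thesis by (metis ex_in_conv finite.emptyI)
qed

lemma cardSuc_natLeq_Well_order: "Well_order (cardSuc natLeq)"
  using cardSuc_Card_order[OF natLeq_Card_order] card_order_on_well_order_on by blast

instantiation omega1 :: wellorder
begin

definition less_eq_omega1 :: "omega1 \<Rightarrow> omega1 \<Rightarrow> bool"
  where "\<alpha> \<le> \<beta> \<longleftrightarrow> (Rep_omega1 \<alpha>, Rep_omega1 \<beta>) \<in> cardSuc natLeq"

definition less_omega1 :: "omega1 \<Rightarrow> omega1 \<Rightarrow> bool"
  where "\<alpha> < \<beta> \<longleftrightarrow> \<alpha> \<le> \<beta> \<and> \<alpha> \<noteq> (\<beta> :: omega1)"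

instance
proof -
  interpret wo_rel "cardSuc natLeq"
    by (simp add: wo_rel_def cardSuc_natLeq_Well_order)
  note d = less_eq_omega1_def less_omega1_def
  have refl: "\<alpha> \<le> \<alpha>" for \<alpha> :: omega1
    using REFL Rep_omega1[of \<alpha>] by (auto simp: d refl_on_def)
  have trans: "\<alpha> \<le> \<gamma>" if "\<alpha> \<le> \<beta>" "\<beta> \<le> \<gamma>" for \<alpha> \<beta> \<gamma> :: omega1
    using TRANS that by (auto simp: d dest: transD)
  have antisym: "\<alpha> = \<beta>" if "\<alpha> \<le> \<beta>" "\<beta> \<le> \<alpha>" for \<alpha> \<beta> :: omega1
    using ANTISYM that by (auto simp: d Rep_omega1_inject dest: antisymD)
  have total: "\<alpha> \<le> \<beta> \<or> \<beta> \<le> \<alpha>" for \<alpha> \<beta> :: omega1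
    using TOTALS Rep_omega1[of \<alpha>] Rep_omega1[of \<beta>] by (auto simp: d)
  have wf: "wf {(\<alpha>, \<beta> :: omega1). \<alpha> < \<beta>}"
  proof (rule wf_subset)
    show "wf (inv_image (cardSuc natLeq - Id) Rep_omega1)"
      using WELL by (simp add: well_order_on_def)
    show "{(\<alpha>, \<beta> :: omega1). \<alpha> < \<beta>} \<subseteq> inv_image (cardSuc natLeq - Id) Rep_omega1"
      by (auto simp: d Rep_omega1_inject)
  qed
  show "OFCLASS(omega1, wellorder_class)"
  proof (standard, goal_cases)
    case (1 x y)
    then show ?case using antisym by (auto simp: less_omega1_def)
  next
    case (2 x)
    then show ?case by (rule refl)
  next
    case (3 x y z)
    then show ?case by (rule trans)
  next
    case (4 x y)
    then show ?case by (rule antisym)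
  next
    case (5 x y)
    then show ?case by (rule total)
  next
    case (6 P a)
    then show ?case using wf_induct_rule[OF wf, of P a] by auto
  qed
qed

end

instantiation omega1 :: "{zero, one}"
begin

definition zero_omega1 :: omega1 where "0 = (LEAST \<alpha> :: omega1. True)"
definition one_omega1 :: omega1 where "1 = (LEAST \<alpha> :: omega1. 0 < \<alpha>)"

instance ..

end

instantiation omega1 :: conditionally_complete_linorder
begin

definition inf_omega1 :: "omega1 \<Rightarrow> omega1 \<Rightarrow> omega1" where "inf_omega1 = min"
definition sup_omega1 :: "omega1 \<Rightarrow> omega1 \<Rightarrow> omega1" where "sup_omega1 = max"
definition Inf_omega1 :: "omega1 set \<Rightarrow> omega1" where "Inf A = (LEAST \<alpha> :: omega1. \<alpha> \<in> A)"
definition Sup_omega1 :: "omega1 set \<Rightarrow> omega1"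
  where "Sup A = (LEAST \<beta> :: omega1. \<forall>\<alpha>\<in>A. \<alpha> \<le> \<beta>)"

instance
proof (standard, goal_cases)
  case (7 x X)
  then show ?case by (simp add: Inf_omega1_def Least_le)
next
  case (8 X z)
  then obtain x where "x \<in> X"
    by blast
  then have "Inf X \<in> X"
    unfolding Inf_omega1_def by (rule LeastI)
  then show ?case
    using 8(2) by blast
next
  case (9 x X)
  then obtain \<beta> where "\<forall>\<alpha>\<in>X. \<alpha> \<le> \<beta>"
    unfolding bdd_above_def by blast
  then have "\<forall>\<alpha>\<in>X. \<alpha> \<le> Sup X"
    unfolding Sup_omega1_def by (rule LeastI)
  then show ?case
    using 9(1) by blast
next
  case (10 X z)
  then show ?case by (simp add: Sup_omega1_def Least_le)
qed (auto simp: inf_omega1_def sup_omega1_def)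

end

lemma countable_lessThan_omega1: "countable {..< \<alpha> :: omega1}"
proof -
  let ?r = "cardSuc natLeq"
  have "|underS ?r (Rep_omega1 \<alpha>)| <o ?r"
    using card_of_underS[OF cardSuc_Card_order[OF natLeq_Card_order] Rep_omega1] .
  then have "|underS ?r (Rep_omega1 \<alpha>)| \<le>o natLeq"
    by (simp add: cardSuc_ordLeq_ordLess[OF natLeq_Card_order card_of_Card_order])
  then have "countable (underS ?r (Rep_omega1 \<alpha>))"
    by (simp add: countable_card_le_natLeq)
  moreover have "Rep_omega1 ` {..<\<alpha>} \<subseteq> underS ?r (Rep_omega1 \<alpha>)"
    by (auto simp: underS_def less_omega1_def less_eq_omega1_def Rep_omega1_inject)
  ultimately have "countable (Rep_omega1 ` {..<\<alpha>})"
    by (rule countable_subset[rotated])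
  then show ?thesis
    by (rule countable_image_inj_on) (simp add: inj_on_def Rep_omega1_inject)
qed

lemma uncountable_UNIV_omega1: "uncountable (UNIV :: omega1 set)"
proof
  assume "countable (UNIV :: omega1 set)"
  then have "countable (Field (cardSuc natLeq))"
    by (metis countable_image type_definition.Rep_range type_definition_omega1)
  then have "|Field (cardSuc natLeq)| \<le>o natLeq"
    by (simp add: countable_card_le_natLeq)
  then have "cardSuc natLeq \<le>o natLeq"
    using card_of_Field_ordIso[OF cardSuc_Card_order[OF natLeq_Card_order]]
      ordIso_ordLeq_trans ordIso_symmetric by blast
  then show False
    using cardSuc_greater[OF natLeq_Card_order] not_ordLess_ordLeq by blast
qed

lemma countable_imp_bdd_above_omega1:
  assumes "countable (A :: omega1 set)"
  shows "bdd_above A"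
proof (rule ccontr)
  assume "\<not> bdd_above A"
  then have "(UNIV :: omega1 set) \<subseteq> (\<Union>\<alpha>\<in>A. {..<\<alpha>})"
    unfolding bdd_above_def by (metis (mono_tags, lifting) UN_iff lessThan_iff not_le subsetI)
  moreover have "countable (\<Union>\<alpha>\<in>A. {..<\<alpha>})"
    using assms countable_lessThan_omega1 by auto
  ultimately show False
    using uncountable_UNIV_omega1 countable_subset by blast
qed


section \<open>Borel classes, ranks and completeness\<close>

definition alphabet :: "nat set \<Rightarrow> bool"
  where "alphabet A \<longleftrightarrow> finite A \<and> 2 \<le> card A"

definition words :: "nat set \<Rightarrow> (nat \<Rightarrow> nat) topology"
  where "words A = product_topology (\<lambda>_. discrete_topology A) UNIV"

inductive Sigma0 :: "'a topology \<Rightarrow> omega1 \<Rightarrow> 'a set \<Rightarrow> bool"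
  and Pi0 :: "'a topology \<Rightarrow> omega1 \<Rightarrow> 'a set \<Rightarrow> bool"
  for X :: "'a topology"
where
  Sigma0_open: "openin X U \<Longrightarrow> Sigma0 X 1 U"
| Sigma0_Union: "1 < \<alpha> \<Longrightarrow> (\<And>n :: nat. \<beta> n < \<alpha> \<and> Pi0 X (\<beta> n) (P n)) \<Longrightarrow> Sigma0 X \<alpha> (\<Union>n. P n)"
| Pi0_compl: "Sigma0 X \<alpha> U \<Longrightarrow> Pi0 X \<alpha> (topspace X - U)"

definition borel_rank :: "'a topology \<Rightarrow> 'a set \<Rightarrow> omega1 \<Rightarrow> bool"
  where "borel_rank X S \<alpha> \<longleftrightarrow>
    (Sigma0 X \<alpha> S \<or> Pi0 X \<alpha> S) \<and> (\<forall>\<beta><\<alpha>. \<not> Sigma0 X \<beta> S \<and> \<not> Pi0 X \<beta> S)"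

definition complete_for ::
    "((nat \<Rightarrow> nat) topology \<Rightarrow> (nat \<Rightarrow> nat) set \<Rightarrow> bool) \<Rightarrow> 'a topology \<Rightarrow> 'a set \<Rightarrow> bool"
  where "complete_for \<Gamma> X S \<longleftrightarrow>
    S \<subseteq> topspace X \<and>
    (\<forall>A E. alphabet A \<and> E \<subseteq> topspace (words A) \<longrightarrow>
      (\<Gamma> (words A) E \<longleftrightarrow>
        (\<exists>f. continuous_map (words A) X f \<and> E = {\<sigma> \<in> topspace (words A). f \<sigma> \<in> S})))"

definition Sigma0_complete :: "'a topology \<Rightarrow> omega1 \<Rightarrow> 'a set \<Rightarrow> bool"
  where "Sigma0_complete X \<alpha> S \<longleftrightarrow> complete_for (\<lambda>Y. Sigma0 Y \<alpha>) X S"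

definition Pi0_complete :: "'a topology \<Rightarrow> omega1 \<Rightarrow> 'a set \<Rightarrow> bool"
  where "Pi0_complete X \<alpha> S \<longleftrightarrow> complete_for (\<lambda>Y. Pi0 Y \<alpha>) X S"

text \<open>A class of sets is a set of pairs of a space and one of its subsets.\<close>

type_synonym 'a set_class = "('a topology \<times> 'a set) set"

definition borel_ranks :: "'a set_class \<Rightarrow> omega1 set"
  where "borel_ranks K = {\<alpha>. \<exists>(X, S)\<in>K. borel_rank X S \<alpha>}"

definition equal_borel_hierarchies :: "'a set_class \<Rightarrow> 'b set_class \<Rightarrow> bool"
  where "equal_borel_hierarchies K K' \<longleftrightarrow>
    (\<forall>\<alpha>\<ge>1.
      ((\<exists>(X, S)\<in>K. Sigma0_complete X \<alpha> S) \<longleftrightarrow> (\<exists>(X, S)\<in>K'. Sigma0_complete X \<alpha> S)) \<and>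
      ((\<exists>(X, S)\<in>K. Pi0_complete X \<alpha> S) \<longleftrightarrow> (\<exists>(X, S)\<in>K'. Pi0_complete X \<alpha> S)) \<and>
      ((\<exists>(X, S)\<in>K. borel_rank X S \<alpha>) \<longleftrightarrow> (\<exists>(X, S)\<in>K'. borel_rank X S \<alpha>)))"

lemma borel_rank_unique: "borel_rank X S \<alpha> \<Longrightarrow> borel_rank X S \<beta> \<Longrightarrow> \<alpha> = \<beta>"
  unfolding borel_rank_def by (metis linorder_less_linear)

lemma bdd_above_borel_ranks:
  assumes "countable K"
  shows "bdd_above (borel_ranks K)"
proof (rule countable_imp_bdd_above_omega1)
  have "borel_ranks K \<subseteq> (\<lambda>(X, S). THE \<alpha>. borel_rank X S \<alpha>) ` K"
  proof
    fix \<alpha> assume "\<alpha> \<in> borel_ranks K"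
    then obtain X S where XS: "(X, S) \<in> K" "borel_rank X S \<alpha>"
      by (auto simp: borel_ranks_def)
    then have "(THE \<alpha>. borel_rank X S \<alpha>) = \<alpha>"
      using borel_rank_unique by (metis the_equality)
    then have "\<alpha> = (\<lambda>(X, S). THE \<alpha>. borel_rank X S \<alpha>) (X, S)"
      by simp
    then show "\<alpha> \<in> (\<lambda>(X, S). THE \<alpha>. borel_rank X S \<alpha>) ` K"
      using XS(1) by (rule image_eqI)
  qed
  then show "countable (borel_ranks K)"
    using assms countable_image countable_subset by blast
qed


section \<open>Infinite pictures and tiling systems\<close>

text \<open>The border letter is \<^term>\<open>None\<close>.\<close>

definition hat :: "nat set \<Rightarrow> nat option set"
  where "hat A = insert None (Some ` A)"

definition pictures :: "nat set \<Rightarrow> (nat \<times> nat \<Rightarrow> nat option) set"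
  where "pictures A =
    {p. (\<forall>i. p (i, 0) = None \<and> p (0, i) = None) \<and> (\<forall>i>0. \<forall>j>0. p (i, j) \<in> Some ` A)}"

definition picture_space :: "nat set \<Rightarrow> (nat \<times> nat \<Rightarrow> nat option) topology"
  where "picture_space A =
    subtopology (product_topology (\<lambda>_. discrete_topology (hat A)) UNIV) (pictures A)"

text \<open>A tile lists its entries as top left, top right, bottom left, bottom right.\<close>

type_synonym cell = "nat option \<times> nat"
type_synonym tile = "cell \<times> cell \<times> cell \<times> cell"

record tiling_system =
  states :: "nat set"
  letters :: "nat set"
  tiles :: "tile set"

definition is_tiling_system :: "tiling_system \<Rightarrow> bool"
  where "is_tiling_system T \<longleftrightarrow>
    finite (states T) \<and> alphabet (letters T) \<and>
    tiles T \<subseteq> (let C = hat (letters T) \<times> states T in C \<times> C \<times> C \<times> C)"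

definition is_run ::
    "tiling_system \<Rightarrow> (nat \<times> nat \<Rightarrow> nat option) \<Rightarrow> (nat \<times> nat \<Rightarrow> nat) \<Rightarrow> bool"
  where "is_run T p \<rho> \<longleftrightarrow>
    range \<rho> \<subseteq> states T \<and>
    (\<forall>i j.
      ((p (i, j + 1), \<rho> (i, j + 1)), (p (i + 1, j + 1), \<rho> (i + 1, j + 1)),
       (p (i, j), \<rho> (i, j)), (p (i + 1, j), \<rho> (i + 1, j))) \<in> tiles T)"

definition buchi_language ::
    "tiling_system \<Rightarrow> nat set \<Rightarrow> (nat \<times> nat \<Rightarrow> nat option) set"
  where "buchi_language T F =
    {p \<in> pictures (letters T). \<exists>\<rho>. is_run T p \<rho> \<and> infinite {v. \<rho> v \<in> F}}"

definition buchi_recognizable :: "nat set \<Rightarrow> (nat \<times> nat \<Rightarrow> nat option) set \<Rightarrow> bool"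
  where "buchi_recognizable A L \<longleftrightarrow>
    (\<exists>T F. is_tiling_system T \<and> letters T = A \<and> F \<subseteq> states T \<and> L = buchi_language T F)"

definition buchi_class :: "(nat \<times> nat \<Rightarrow> nat option) set_class"
  where "buchi_class = {(picture_space A, L) | A L. alphabet A \<and> buchi_recognizable A L}"


section \<open>The lightface classes \<open>\<Sigma>\<^sup>1\<^sub>1\<close> and \<open>\<Pi>\<^sup>1\<^sub>1\<close>\<close>

text \<open>
  Formulas of second order arithmetic with number variables, variables for sets of numbers,
  and one function symbol \<open>Letter\<close> for the \<open>\<omega>\<close>-word under consideration.
\<close>

datatype trm =
    Var nat
  | Zero
  | Succ trm
  | Plus trm trm
  | Times trm trm
  | Letter trm

datatype fm =
    Eq trm trm
  | Less trm trm
  | Mem trm nat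
  | Neg fm
  | Conj fm fm
  | Ex1 nat fm
  | Ex2 nat fm
  | All2 nat fm

primrec trm_val :: "(nat \<Rightarrow> nat) \<Rightarrow> (nat \<Rightarrow> nat) \<Rightarrow> trm \<Rightarrow> nat" where
  "trm_val \<sigma> e (Var x) = e x"
| "trm_val \<sigma> e Zero = 0"
| "trm_val \<sigma> e (Succ t) = Suc (trm_val \<sigma> e t)"
| "trm_val \<sigma> e (Plus s t) = trm_val \<sigma> e s + trm_val \<sigma> e t"
| "trm_val \<sigma> e (Times s t) = trm_val \<sigma> e s * trm_val \<sigma> e t"
| "trm_val \<sigma> e (Letter t) = \<sigma> (trm_val \<sigma> e t)"

primrec sat :: "(nat \<Rightarrow> nat) \<Rightarrow> (nat \<Rightarrow> nat) \<Rightarrow> (nat \<Rightarrow> nat set) \<Rightarrow> fm \<Rightarrow> bool" where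
  "sat \<sigma> e V (Eq s t) \<longleftrightarrow> trm_val \<sigma> e s = trm_val \<sigma> e t"
| "sat \<sigma> e V (Less s t) \<longleftrightarrow> trm_val \<sigma> e s < trm_val \<sigma> e t"
| "sat \<sigma> e V (Mem t X) \<longleftrightarrow> trm_val \<sigma> e t \<in> V X"
| "sat \<sigma> e V (Neg \<phi>) \<longleftrightarrow> \<not> sat \<sigma> e V \<phi>"
| "sat \<sigma> e V (Conj \<phi> \<psi>) \<longleftrightarrow> sat \<sigma> e V \<phi> \<and> sat \<sigma> e V \<psi>"
| "sat \<sigma> e V (Ex1 x \<phi>) \<longleftrightarrow> (\<exists>n. sat \<sigma> (e(x := n)) V \<phi>)"
| "sat \<sigma> e V (Ex2 X \<phi>) \<longleftrightarrow> (\<exists>M. sat \<sigma> e (V(X := M)) \<phi>)"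
| "sat \<sigma> e V (All2 X \<phi>) \<longleftrightarrow> (\<forall>M. sat \<sigma> e (V(X := M)) \<phi>)"

primrec trm_vars :: "trm \<Rightarrow> nat set" where
  "trm_vars (Var x) = {x}"
| "trm_vars Zero = {}"
| "trm_vars (Succ t) = trm_vars t"
| "trm_vars (Plus s t) = trm_vars s \<union> trm_vars t"
| "trm_vars (Times s t) = trm_vars s \<union> trm_vars t"
| "trm_vars (Letter t) = trm_vars t"

primrec free_number_vars :: "fm \<Rightarrow> nat set" where
  "free_number_vars (Eq s t) = trm_vars s \<union> trm_vars t"
| "free_number_vars (Less s t) = trm_vars s \<union> trm_vars t"
| "free_number_vars (Mem t X) = trm_vars t"
| "free_number_vars (Neg \<phi>) = free_number_vars \<phi>"
| "free_number_vars (Conj \<phi> \<psi>) = free_number_vars \<phi> \<union> free_number_vars \<psi>"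
| "free_number_vars (Ex1 x \<phi>) = free_number_vars \<phi> - {x}"
| "free_number_vars (Ex2 X \<phi>) = free_number_vars \<phi>"
| "free_number_vars (All2 X \<phi>) = free_number_vars \<phi>"

primrec free_set_vars :: "fm \<Rightarrow> nat set" where
  "free_set_vars (Eq s t) = {}"
| "free_set_vars (Less s t) = {}"
| "free_set_vars (Mem t X) = {X}"
| "free_set_vars (Neg \<phi>) = free_set_vars \<phi>"
| "free_set_vars (Conj \<phi> \<psi>) = free_set_vars \<phi> \<union> free_set_vars \<psi>"
| "free_set_vars (Ex1 x \<phi>) = free_set_vars \<phi>"
| "free_set_vars (Ex2 X \<phi>) = free_set_vars \<phi> - {X}"
| "free_set_vars (All2 X \<phi>) = free_set_vars \<phi> - {X}"

definition sentence :: "fm \<Rightarrow> bool"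
  where "sentence \<phi> \<longleftrightarrow> free_number_vars \<phi> = {} \<and> free_set_vars \<phi> = {}"

primrec arithmetical :: "fm \<Rightarrow> bool" where
  "arithmetical (Eq s t) \<longleftrightarrow> True"
| "arithmetical (Less s t) \<longleftrightarrow> True"
| "arithmetical (Mem t X) \<longleftrightarrow> True"
| "arithmetical (Neg \<phi>) \<longleftrightarrow> arithmetical \<phi>"
| "arithmetical (Conj \<phi> \<psi>) \<longleftrightarrow> arithmetical \<phi> \<and> arithmetical \<psi>"
| "arithmetical (Ex1 x \<phi>) \<longleftrightarrow> arithmetical \<phi>"
| "arithmetical (Ex2 X \<phi>) \<longleftrightarrow> False"
| "arithmetical (All2 X \<phi>) \<longleftrightarrow> False"

inductive existential :: "fm \<Rightarrow> bool" where
  "arithmetical \<phi> \<Longrightarrow> existential \<phi>"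
| "existential \<phi> \<Longrightarrow> existential (Ex2 X \<phi>)"

inductive universal :: "fm \<Rightarrow> bool" where
  "arithmetical \<phi> \<Longrightarrow> universal \<phi>"
| "universal \<phi> \<Longrightarrow> universal (All2 X \<phi>)"

text \<open>For a sentence the assignments used here are irrelevant.\<close>

definition defined_set :: "nat set \<Rightarrow> fm \<Rightarrow> (nat \<Rightarrow> nat) set"
  where "defined_set A \<phi> = {\<sigma> \<in> topspace (words A). sat \<sigma> (\<lambda>_. 0) (\<lambda>_. {}) \<phi>}"

definition Sigma11_class :: "(nat \<Rightarrow> nat) set_class"
  where "Sigma11_class =
    {(words A, defined_set A \<phi>) | A \<phi>. alphabet A \<and> sentence \<phi> \<and> existential \<phi>}"

definition Pi11_class :: "(nat \<Rightarrow> nat) set_class"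
  where "Pi11_class =
    {(words A, defined_set A \<phi>) | A \<phi>. alphabet A \<and> sentence \<phi> \<and> universal \<phi>}"

text \<open>
  The ordinal \<open>\<gamma>\<^sup>1\<^sub>2\<close>. \<open>Sup\<close> is meaningful only for sets that are bounded in \<^typ>\<open>omega1\<close>;
  boundedness is proved below.
\<close>

definition gamma12 :: omega1
  where "gamma12 = Sup (borel_ranks Pi11_class)"

instance trm :: countable by countable_datatype
instance fm :: countable by countable_datatype

lemma countable_alphabets: "countable {A. alphabet A}"
  by (rule countable_subset[OF _ countable_Collect_finite]) (auto simp: alphabet_def)

lemma countable_Pi11_class: "countable Pi11_class"
proof -
  have "Pi11_class \<subseteq> (\<lambda>(A, \<phi>). (words A, defined_set A \<phi>)) ` ({A. alphabet A} \<times> UNIV)"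
    by (auto simp: Pi11_class_def)
  then show ?thesis
    by (rule countable_subset) (intro countable_image countable_SIGMA countable_alphabets; simp)
qed

lemma countable_buchi_class: "countable buchi_class"
proof -
  let ?f = "\<lambda>(A, Q, \<Delta>, F). (picture_space A, buchi_language \<lparr>states = Q, letters = A, tiles = \<Delta>\<rparr> F)"
  have "buchi_class \<subseteq> ?f ` ({A. alphabet A} \<times> {Q. finite Q} \<times> {\<Delta>. finite \<Delta>} \<times> {F. finite F})"
  proof
    fix x assume "x \<in> buchi_class"
    then obtain T F where T: "x = (picture_space (letters T), buchi_language T F)"
      "is_tiling_system T" "F \<subseteq> states T"
      unfolding buchi_class_def buchi_recognizable_def by blast
    have "finite (hat (letters T) \<times> states T)"
      using T(2) by (auto simp: is_tiling_system_def alphabet_def hat_def)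
    then have "finite (tiles T)"
      using T(2) unfolding is_tiling_system_def Let_def
      by (meson finite_SigmaI finite_subset)
    moreover have "finite F"
      using T(2,3) finite_subset unfolding is_tiling_system_def by blast
    moreover have "x = ?f (letters T, states T, tiles T, F)"
      using T(1) by (cases T) simp
    ultimately show "x \<in> ?f ` ({A. alphabet A} \<times> {Q. finite Q} \<times> {\<Delta>. finite \<Delta>} \<times> {F. finite F})"
      using T(2) unfolding is_tiling_system_def by blast
  qed
  then show ?thesis
    by (rule countable_subset)
      (intro countable_image countable_SIGMA countable_alphabets countable_Collect_finite)
qed

lemma bdd_above_borel_ranks_Pi11: "bdd_above (borel_ranks Pi11_class)"
  by (rule bdd_above_borel_ranks[OF countable_Pi11_class])

lemma bdd_above_borel_ranks_buchi: "bdd_above (borel_ranks buchi_class)"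
  by (rule bdd_above_borel_ranks[OF countable_buchi_class])


section \<open>Recursive ordinals\<close>

text \<open>Kleene's partial recursive functions.\<close>

datatype recf =
    Zer
  | Scc
  | Proj nat
  | Comp recf "recf list"
  | PrimRec recf recf
  | Min recf

inductive computes :: "recf \<Rightarrow> nat list \<Rightarrow> nat \<Rightarrow> bool" where
  "computes Zer xs 0"
| "computes Scc [x] (Suc x)"
| "i < length xs \<Longrightarrow> computes (Proj i) xs (xs ! i)"
| "list_all2 (\<lambda>g y. computes g xs y) gs ys \<Longrightarrow> computes f ys z \<Longrightarrow> computes (Comp f gs) xs z"
| "computes f xs z \<Longrightarrow> computes (PrimRec f g) (0 # xs) z"
| "computes (PrimRec f g) (n # xs) y \<Longrightarrow> computes g (n # y # xs) z \<Longrightarrow>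
    computes (PrimRec f g) (Suc n # xs) z"
| "computes f (n # xs) 0 \<Longrightarrow> (\<And>m. m < n \<Longrightarrow> \<exists>y. computes f (m # xs) (Suc y)) \<Longrightarrow>
    computes (Min f) xs n"
monos list_all2_mono

definition recursive_rel :: "nat rel \<Rightarrow> bool"
  where "recursive_rel R \<longleftrightarrow>
    (\<exists>f. \<forall>x y. computes f [x, y] (if (x, y) \<in> R then 1 else 0))"

text \<open>
  An ordinal is recursive if it is the order type of a recursive well-ordering of a set of
  natural numbers (in HOL, \<^const>\<open>Well_order\<close> refers to reflexive orders on their field).
\<close>

definition segment :: "omega1 \<Rightarrow> omega1 rel"
  where "segment \<alpha> = {(\<beta>, \<gamma>). \<beta> \<le> \<gamma> \<and> \<gamma> < \<alpha>}"

definition recursive_ordinal :: "omega1 \<Rightarrow> bool"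
  where "recursive_ordinal \<alpha> \<longleftrightarrow>
    (\<exists>R :: nat rel. recursive_rel R \<and> Well_order R \<and> (R, segment \<alpha>) \<in> ordIso)"

definition omega1_CK :: omega1
  where "omega1_CK = (LEAST \<alpha>. \<not> recursive_ordinal \<alpha>)"

lemma Well_order_segment: "Well_order (segment \<alpha>)"
proof -
  have F: "Field (segment \<alpha>) = {..<\<alpha>}"
    by (auto simp: segment_def Field_def)
  have "wf (segment \<alpha> - Id)"
    by (rule wf_subset[OF wf]) (auto simp: segment_def)
  then show ?thesis
    unfolding F well_order_on_def linear_order_on_def partial_order_on_def preorder_on_def
    by (auto simp: segment_def refl_on_def trans_def antisym_def total_on_def)
qed

lemma segment_ordLess:
  assumes "\<alpha> < \<beta>"
  shows "segment \<alpha> <o segment \<beta>"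
proof -
  have "Field (segment \<beta>) \<noteq> {}"
    using assms by (auto simp: segment_def Field_def)
  moreover have "Restr (segment \<beta>) (underS (segment \<beta>) \<alpha>) = segment \<alpha>"
    using assms by (auto simp: segment_def underS_def)
  ultimately show ?thesis
    using underS_Restr_ordLess[OF Well_order_segment] by metis
qed

lemma segment_ordIso_imp_eq: "(segment \<alpha>, segment \<beta>) \<in> ordIso \<Longrightarrow> \<alpha> = \<beta>"
  by (metis linorder_less_linear not_ordLess_ordIso ordIso_symmetric segment_ordLess)

instance recf :: countable by countable_datatype

inductive_cases computes_ZerE: "computes Zer xs z"
inductive_cases computes_SccE: "computes Scc xs z"
inductive_cases computes_ProjE: "computes (Proj i) xs z"
inductive_cases computes_CompE: "computes (Comp f gs) xs z"
inductive_cases computes_PrimRecE: "computes (PrimRec f g) xs z"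
inductive_cases computes_MinE: "computes (Min f) xs z"

lemma computes_functional: "computes f xs y \<Longrightarrow> computes f xs z \<Longrightarrow> y = z"
proof (induction arbitrary: z rule: computes.induct)
  case (4 xs gs ys f z z')
  obtain ys' where ys': "list_all2 (\<lambda>g y. computes g xs y) gs ys'" "computes f ys' z'"
    using "4.prems" by (rule computes_CompE)
  have "ys = ys'"
  proof (rule nth_equalityI)
    show "length ys = length ys'"
      using ys'(1) "4.IH"(1) by (metis (no_types, lifting) list_all2_lengthD)
    fix i assume "i < length ys"
    then show "ys ! i = ys' ! i"
      using ys'(1) "4.IH"(1) by (fastforce simp: list_all2_conv_all_nth)
  qed
  then show ?case using ys' "4.IH" by blast
next
  case (7 f n xs)
  obtain k where k: "z = k" "computes f (k # xs) 0"
      "\<And>m. m < k \<Longrightarrow> \<exists>y. computes f (m # xs) (Suc y)"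
    using "7.prems" by (rule computes_MinE) blast
  have "\<not> n < k" using "7.IH"(1) k(3) by fastforce
  moreover have "\<not> k < n" using "7.IH"(2) k(2) by fastforce
  ultimately show ?case using k by simp
qed (blast elim: computes_ZerE computes_SccE computes_ProjE computes_PrimRecE)+

lemma ex_not_recursive_ordinal: "\<exists>\<alpha>. \<not> recursive_ordinal \<alpha>"
proof (rule ccontr)
  assume "\<nexists>\<alpha>. \<not> recursive_ordinal \<alpha>"
  then obtain R where R: "\<And>\<alpha>. recursive_rel (R \<alpha>)" "\<And>\<alpha>. (R \<alpha>, segment \<alpha>) \<in> ordIso"
    unfolding recursive_ordinal_def by metis
  then obtain f where f: "\<And>\<alpha> x y. computes (f \<alpha>) [x, y] (if (x, y) \<in> R \<alpha> then 1 else 0)"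
    unfolding recursive_rel_def by metis
  have "R \<alpha> = R \<beta>" if "f \<alpha> = f \<beta>" for \<alpha> \<beta>
  proof -
    have "(if (x, y) \<in> R \<alpha> then 1 else 0 :: nat) = (if (x, y) \<in> R \<beta> then 1 else 0)" for x y
      using computes_functional[OF f[of \<alpha> x y]] f[of \<beta> x y] unfolding that by blast
    then have "(x, y) \<in> R \<alpha> \<longleftrightarrow> (x, y) \<in> R \<beta>" for x y
      by (metis zero_neq_one)
    then show ?thesis by auto
  qed
  then have "inj f"
    using R(2) by (metis injI ordIso_symmetric ordIso_transitive segment_ordIso_imp_eq)
  then have "countable (UNIV :: omega1 set)"
    by (metis countableI_type countable_image_inj_on)
  then show False using uncountable_UNIV_omega1 by blast
qed

end

(*
A nondeterministic program over finitely many registers, which may read a guessed infinite word at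
the positions held by its registers, can be simulated by a tiling system: rows are time, the columns
carry the guessed word, a register is a marker in the column of its value, and a guessed transition
is broadcast along its row. One Buchi condition then suffices to say that a program is repeated
forever, hence that a program halts on every natural number m. So a set of words sigma is the set of
first rows of a recognizable language as soon as it has the form "there is a colouring of the natural
numbers such that for all m the program halts on m".

A set defined by an existential formula has this form: the colouring contains the truth tables of all
subformulas of the arithmetical matrix, and m ranges over the instances of the truth conditions.
Conversely, a run of a tiling system is described by an existential formula. Both translations
preserve Wadge equivalence, and hence ranks and completeness. For a recursive ordinal, the set
obtained by iterating complements and countable unions along a recursive well-ordering is complete,
and it and its complement have the above form because its truth table is determined by local
conditions.
*)

theory Submission
  imports Defs
begin

section \<open>Borel classes under continuous reductions\<close>

text \<open>Halting of nondeterministic programs is closed under conjunction, disjunction,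
  existential and bounded quantification, but no closure under negation is at hand: a negation has
  to be checked by a program of its own. An unbounded universal quantifier is obtained only from the
  endless repetition, and the colouring is guessed before everything else. So the usable pattern is
  a guessed colouring, then all \<open>m\<close>, then a positive condition. Truth tables fit this
  pattern: they replace arbitrary quantifier alternation by conditions of the form "for all m there
  is k", attached to the connectives. Since only Wadge equivalence is asked for, a picture may be
  read through its first row alone when a set of words is turned into a language. For the complete
  sets, both membership and non-membership must be expressed positively. This works because the
  intended table exists and its relevant entries are unique, so the answer may be read off any
  correct table in either sense. The ordinal of (b) is defined through \<Pi>11 sets, while (a)
  speaks of \<Sigma>11 sets; dual formulas and the invariance of the rank under complements close
  this gap.\<close>

lemma Sigma0_Pi0_ge_1:
  "Sigma0 X \<alpha> S \<Longrightarrow> 1 \<le> \<alpha>" "Pi0 X \<alpha> S \<Longrightarrow> 1 \<le> \<alpha>"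
  by (induction rule: Sigma0_Pi0.inducts) auto

lemma Sigma0_Pi0_subset_topspace:
  "Sigma0 X \<alpha> S \<Longrightarrow> S \<subseteq> topspace X" "Pi0 X \<alpha> S \<Longrightarrow> S \<subseteq> topspace X"
  by (induction rule: Sigma0_Pi0.inducts) (auto simp: openin_subset)

lemma Sigma0_Pi0_preimage:
  assumes f: "continuous_map X Y f"
  shows "Sigma0 Y \<alpha> S \<Longrightarrow> Sigma0 X \<alpha> {x \<in> topspace X. f x \<in> S}"
    and "Pi0 Y \<alpha> S \<Longrightarrow> Pi0 X \<alpha> {x \<in> topspace X. f x \<in> S}"
proof (induction rule: Sigma0_Pi0.inducts)
  case (Sigma0_open U)
  then show ?case
    using f by (simp add: Sigma0_Pi0.Sigma0_open openin_continuous_map_preimage)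
next
  case (Sigma0_Union \<alpha> \<beta> P)
  have "{x \<in> topspace X. f x \<in> (\<Union>n. P n)} = (\<Union>n. {x \<in> topspace X. f x \<in> P n})"
    by blast
  moreover have "Sigma0 X \<alpha> (\<Union>n. {x \<in> topspace X. f x \<in> P n})"
    using Sigma0_Union by (intro Sigma0_Pi0.Sigma0_Union[of \<alpha> \<beta>]) auto
  ultimately show ?case by simp
next
  case (Pi0_compl \<alpha> U)
  have "{x \<in> topspace X. f x \<in> topspace Y - U} = topspace X - {x \<in> topspace X. f x \<in> U}"
    using f by (auto simp: continuous_map_def)
  then show ?case
    using Sigma0_Pi0.Pi0_compl[OF Pi0_compl(2)] by simp
qed

lemma Pi0_iff_Sigma0_compl:
  assumes "S \<subseteq> topspace X"
  shows "Pi0 X \<alpha> S \<longleftrightarrow> Sigma0 X \<alpha> (topspace X - S)"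
proof
  assume "Pi0 X \<alpha> S"
  then obtain U where "S = topspace X - U" "Sigma0 X \<alpha> U"
    by (auto elim: Pi0.cases)
  then show "Sigma0 X \<alpha> (topspace X - S)"
    using Sigma0_Pi0_subset_topspace(1)[of X \<alpha> U] by (simp add: double_diff)
next
  assume "Sigma0 X \<alpha> (topspace X - S)"
  then show "Pi0 X \<alpha> S"
    using Pi0_compl[of X \<alpha> "topspace X - S"] assms by (simp add: double_diff)
qed

lemma Sigma0_iff_Pi0_compl:
  assumes "S \<subseteq> topspace X"
  shows "Sigma0 X \<alpha> S \<longleftrightarrow> Pi0 X \<alpha> (topspace X - S)"
  using Pi0_iff_Sigma0_compl[of "topspace X - S" X \<alpha>] assms by (simp add: double_diff)

text \<open>Wadge reducibility. Completeness is defined through it and Borel classes are pulled back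
  along it, so that equivalent sets share rank and completeness.\<close>

definition reduces :: "'a topology \<Rightarrow> 'a set \<Rightarrow> 'b topology \<Rightarrow> 'b set \<Rightarrow> bool"
  where "reduces X S Y T \<longleftrightarrow>
    (\<exists>f. continuous_map X Y f \<and> S = {x \<in> topspace X. f x \<in> T})"

definition wadge_equiv :: "'a topology \<Rightarrow> 'a set \<Rightarrow> 'b topology \<Rightarrow> 'b set \<Rightarrow> bool"
  where "wadge_equiv X S Y T \<longleftrightarrow> S \<subseteq> topspace X \<and> T \<subseteq> topspace Y \<and> reduces X S Y T \<and> reduces Y T X S"

lemma reduces_trans:
  assumes "reduces X S Y T" "reduces Y T Z U"
  shows "reduces X S Z U"
proof -
  obtain f g where f: "continuous_map X Y f" "S = {x \<in> topspace X. f x \<in> T}"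
    and g: "continuous_map Y Z g" "T = {y \<in> topspace Y. g y \<in> U}"
    using assms by (auto simp: reduces_def)
  have "S = {x \<in> topspace X. (g \<circ> f) x \<in> U}"
    using f g by (auto simp: continuous_map_def)
  then show ?thesis
    unfolding reduces_def using continuous_map_compose[OF f(1) g(1)] by blast
qed

lemma reduces_compl:
  assumes "reduces X S Y T"
  shows "reduces X (topspace X - S) Y (topspace Y - T)"
proof -
  obtain f where f: "continuous_map X Y f" "S = {x \<in> topspace X. f x \<in> T}"
    using assms by (auto simp: reduces_def)
  then have "topspace X - S = {x \<in> topspace X. f x \<in> topspace Y - T}"
    by (auto simp: continuous_map_def)
  with f show ?thesis
    by (auto simp: reduces_def)
qed

lemma reduces_Sigma0: "reduces X S Y T \<Longrightarrow> Sigma0 Y \<alpha> T \<Longrightarrow> Sigma0 X \<alpha> S"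
  and reduces_Pi0: "reduces X S Y T \<Longrightarrow> Pi0 Y \<alpha> T \<Longrightarrow> Pi0 X \<alpha> S"
  using Sigma0_Pi0_preimage by (fastforce simp: reduces_def)+

lemma complete_for_alt:
  "complete_for \<Gamma> X S \<longleftrightarrow> S \<subseteq> topspace X \<and>
    (\<forall>A E. alphabet A \<and> E \<subseteq> topspace (words A) \<longrightarrow> (\<Gamma> (words A) E \<longleftrightarrow> reduces (words A) E X S))"
  unfolding complete_for_def reduces_def ..

lemma wadge_equiv_complete_for:
  "wadge_equiv X S Y T \<Longrightarrow> complete_for \<Gamma> X S \<Longrightarrow> complete_for \<Gamma> Y T"
  unfolding complete_for_alt wadge_equiv_def using reduces_trans by meson

lemma wadge_equiv_borel_rank:
  "wadge_equiv X S Y T \<Longrightarrow> borel_rank X S \<alpha> \<Longrightarrow> borel_rank Y T \<alpha>"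
  unfolding borel_rank_def wadge_equiv_def using reduces_Sigma0 reduces_Pi0 by meson

text \<open>A map reduces a set exactly when it reduces the complements, and complementation
  exchanges the two classes. Part (c) therefore needs a completeness proof on the \<Sigma> side
  only.\<close>

lemma Pi0_complete_compl:
  assumes "Sigma0_complete X \<alpha> S"
  shows "Pi0_complete X \<alpha> (topspace X - S)"
  unfolding Pi0_complete_def complete_for_alt
proof (intro conjI allI impI)
  fix A E assume AE: "alphabet A \<and> E \<subseteq> topspace (words A)"
  have S: "S \<subseteq> topspace X"
    using assms by (simp add: Sigma0_complete_def complete_for_def)
  have "Pi0 (words A) \<alpha> E \<longleftrightarrow> Sigma0 (words A) \<alpha> (topspace (words A) - E)"
    using AE by (simp add: Pi0_iff_Sigma0_compl)
  also have "\<dots> \<longleftrightarrow> reduces (words A) (topspace (words A) - E) X S"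
    using assms AE unfolding Sigma0_complete_def complete_for_alt by blast
  also have "\<dots> \<longleftrightarrow> reduces (words A) E X (topspace X - S)"
    using reduces_compl[of "words A" "topspace (words A) - E" X S]
      reduces_compl[of "words A" E X "topspace X - S"] AE S
    by (auto simp: double_diff)
  finally show "Pi0 (words A) \<alpha> E \<longleftrightarrow> reduces (words A) E X (topspace X - S)" .
qed blast

text \<open>The three properties compared are invariant under Wadge equivalence, so it suffices to
  match the members of both classes up to that equivalence.\<close>

lemma equal_borel_hierarchiesI:
  assumes K: "\<And>X S. (X, S) \<in> K \<Longrightarrow> \<exists>(Y, T)\<in>K'. wadge_equiv X S Y T"
    and K': "\<And>Y T. (Y, T) \<in> K' \<Longrightarrow> \<exists>(X, S)\<in>K. wadge_equiv Y T X S"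
  shows "equal_borel_hierarchies K K'"
proof -
  \<comment> \<open>\<open>P\<close> and \<open>Q\<close> stand for one property, at the two
    different types of points.\<close>
  have transfer: "(\<exists>(X, S)\<in>K. P X S) \<longleftrightarrow> (\<exists>(X, S)\<in>K'. Q X S)"
    if PQ: "\<And>X S Y T. wadge_equiv X S Y T \<Longrightarrow> P X S \<Longrightarrow> Q Y T"
      and QP: "\<And>X S Y T. wadge_equiv Y T X S \<Longrightarrow> Q Y T \<Longrightarrow> P X S" for P Q
  proof
    assume "\<exists>(X, S)\<in>K. P X S"
    then obtain X S where "(X, S) \<in> K" "P X S" by blast
    moreover from this(1) obtain Y T where "(Y, T) \<in> K'" "wadge_equiv X S Y T"
      using K by blast
    ultimately show "\<exists>(X, S)\<in>K'. Q X S"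
      using PQ by blast
  next
    assume "\<exists>(X, S)\<in>K'. Q X S"
    then obtain Y T where "(Y, T) \<in> K'" "Q Y T" by blast
    moreover from this(1) obtain X S where "(X, S) \<in> K" "wadge_equiv Y T X S"
      using K' by blast
    ultimately show "\<exists>(X, S)\<in>K. P X S"
      using QP by blast
  qed
  show ?thesis
    unfolding equal_borel_hierarchies_def Sigma0_complete_def Pi0_complete_def
  proof (intro allI impI conjI)
    fix \<alpha> :: omega1
    show "(\<exists>(X, S)\<in>K. complete_for (\<lambda>Y. Sigma0 Y \<alpha>) X S) \<longleftrightarrow>
        (\<exists>(X, S)\<in>K'. complete_for (\<lambda>Y. Sigma0 Y \<alpha>) X S)"
      by (rule transfer[OF wadge_equiv_complete_for wadge_equiv_complete_for])
    show "(\<exists>(X, S)\<in>K. complete_for (\<lambda>Y. Pi0 Y \<alpha>) X S) \<longleftrightarrow>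
        (\<exists>(X, S)\<in>K'. complete_for (\<lambda>Y. Pi0 Y \<alpha>) X S)"
      by (rule transfer[OF wadge_equiv_complete_for wadge_equiv_complete_for])
    show "(\<exists>(X, S)\<in>K. borel_rank X S \<alpha>) \<longleftrightarrow> (\<exists>(X, S)\<in>K'. borel_rank X S \<alpha>)"
      by (rule transfer[OF wadge_equiv_borel_rank wadge_equiv_borel_rank])
  qed
qed

lemma borel_rank_ge_1: "borel_rank X S \<alpha> \<Longrightarrow> 1 \<le> \<alpha>"
  using Sigma0_Pi0_ge_1 by (auto simp: borel_rank_def)

lemma borel_ranks_ge_1: "\<alpha> \<in> borel_ranks K \<Longrightarrow> 1 \<le> \<alpha>"
  unfolding borel_ranks_def by (blast dest: borel_rank_ge_1)

text \<open>Equality of hierarchies says nothing about index 0; there both sides are void, since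
  every Borel class has index at least 1.\<close>

lemma equal_borel_hierarchies_borel_ranks:
  assumes "equal_borel_hierarchies K K'"
  shows "borel_ranks K = borel_ranks K'"
proof (rule set_eqI)
  fix \<alpha>
  show "\<alpha> \<in> borel_ranks K \<longleftrightarrow> \<alpha> \<in> borel_ranks K'"
  proof (cases "1 \<le> \<alpha>")
    case True
    then show ?thesis
      using assms by (simp add: equal_borel_hierarchies_def borel_ranks_def)
  next
    case False
    then show ?thesis
      using borel_ranks_ge_1[of \<alpha> K] borel_ranks_ge_1[of \<alpha> K'] by blast
  qed
qed

section \<open>Ranks of analytic and of coanalytic sets\<close>

lemma borel_rank_compl:
  assumes "S \<subseteq> topspace X" "borel_rank X S \<alpha>"
  shows "borel_rank X (topspace X - S) \<alpha>"
  using assms unfolding borel_rank_def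
  by (simp add: Sigma0_iff_Pi0_compl[symmetric] Pi0_iff_Sigma0_compl[symmetric]) blast

text \<open>The quantifier prefix is dualized and the negation ends up in the matrix, where
  \<open>Neg\<close> keeps the formula arithmetical.\<close>

lemma existential_dual:
  assumes "existential \<phi>"
  shows "\<exists>\<psi>. universal \<psi> \<and> free_number_vars \<psi> = free_number_vars \<phi> \<and>
      free_set_vars \<psi> = free_set_vars \<phi> \<and> (\<forall>\<sigma> e V. sat \<sigma> e V \<psi> \<longleftrightarrow> \<not> sat \<sigma> e V \<phi>)"
  using assms
proof induction
  case (1 \<phi>)
  then have "universal (Neg \<phi>)"
    by (simp add: universal.intros(1))
  then show ?case
    by (intro exI[of _ "Neg \<phi>"]) simp
next
  case (2 \<phi> X)
  then obtain \<psi> where "universal \<psi>" "free_number_vars \<psi> = free_number_vars \<phi>"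
      "free_set_vars \<psi> = free_set_vars \<phi>" "\<forall>\<sigma> e V. sat \<sigma> e V \<psi> \<longleftrightarrow> \<not> sat \<sigma> e V \<phi>"
    by blast
  then show ?case
    by (intro exI[of _ "All2 X \<psi>"]) (simp add: universal.intros(2))
qed

lemma universal_dual:
  assumes "universal \<phi>"
  shows "\<exists>\<psi>. existential \<psi> \<and> free_number_vars \<psi> = free_number_vars \<phi> \<and>
      free_set_vars \<psi> = free_set_vars \<phi> \<and> (\<forall>\<sigma> e V. sat \<sigma> e V \<psi> \<longleftrightarrow> \<not> sat \<sigma> e V \<phi>)"
  using assms
proof induction
  case (1 \<phi>)
  then have "existential (Neg \<phi>)"
    by (simp add: existential.intros(1))
  then show ?case
    by (intro exI[of _ "Neg \<phi>"]) simp
next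
  case (2 \<phi> X)
  then obtain \<psi> where "existential \<psi>" "free_number_vars \<psi> = free_number_vars \<phi>"
      "free_set_vars \<psi> = free_set_vars \<phi>" "\<forall>\<sigma> e V. sat \<sigma> e V \<psi> \<longleftrightarrow> \<not> sat \<sigma> e V \<phi>"
    by blast
  then show ?case
    by (intro exI[of _ "Ex2 X \<psi>"]) (simp add: existential.intros(2))
qed

text \<open>The dual formula defines the complement, which has the same rank. Arbitrary
  \<open>P\<close> and \<open>Q\<close> let the lemma serve both inclusions.\<close>

lemma borel_ranks_dual_subset:
  assumes "\<And>\<phi>. P \<phi> \<Longrightarrow> \<exists>\<psi>. Q \<psi> \<and> free_number_vars \<psi> = free_number_vars \<phi> \<and>
    free_set_vars \<psi> = free_set_vars \<phi> \<and> (\<forall>\<sigma> e V. sat \<sigma> e V \<psi> \<longleftrightarrow> \<not> sat \<sigma> e V \<phi>)"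
  shows "borel_ranks {(words A, defined_set A \<phi>) | A \<phi>. alphabet A \<and> sentence \<phi> \<and> P \<phi>} \<subseteq>
    borel_ranks {(words A, defined_set A \<phi>) | A \<phi>. alphabet A \<and> sentence \<phi> \<and> Q \<phi>}"
proof
  fix \<alpha> assume "\<alpha> \<in> borel_ranks {(words A, defined_set A \<phi>) | A \<phi>. alphabet A \<and> sentence \<phi> \<and> P \<phi>}"
  then obtain A \<phi> where \<phi>: "alphabet A" "sentence \<phi>" "P \<phi>"
      "borel_rank (words A) (defined_set A \<phi>) \<alpha>"
    unfolding borel_ranks_def by blast
  obtain \<psi> where \<psi>: "Q \<psi>" "sentence \<psi>" "\<forall>\<sigma> e V. sat \<sigma> e V \<psi> \<longleftrightarrow> \<not> sat \<sigma> e V \<phi>"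
    using assms[OF \<phi>(3)] \<phi>(2) by (auto simp: sentence_def)
  have "defined_set A \<phi> \<subseteq> topspace (words A)" "defined_set A \<psi> = topspace (words A) - defined_set A \<phi>"
    using \<psi>(3) by (auto simp: defined_set_def)
  then have "borel_rank (words A) (defined_set A \<psi>) \<alpha>"
    using borel_rank_compl[OF _ \<phi>(4)] by simp
  then show "\<alpha> \<in> borel_ranks {(words A, defined_set A \<phi>) | A \<phi>. alphabet A \<and> sentence \<phi> \<and> Q \<phi>}"
    unfolding borel_ranks_def using \<phi>(1) \<psi>(1,2) by blast
qed

lemma borel_ranks_Pi11_eq_Sigma11: "borel_ranks Pi11_class = borel_ranks Sigma11_class"
  unfolding Pi11_class_def Sigma11_class_def
  using borel_ranks_dual_subset[of universal existential, OF universal_dual]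
    borel_ranks_dual_subset[of existential universal, OF existential_dual]
  by (rule equalityI)

section \<open>Nondeterministic register programs\<close>

text \<open>
  A program reads a static word \<open>W\<close> at the positions held by its registers. In an update,
  \<^term>\<open>None\<close> resets a register to 0.
\<close>

type_synonym regs = "nat \<Rightarrow> nat"

datatype 'b atom =
    Upd "nat \<Rightarrow> nat option"
  | Inc nat
  | Eqt nat nat
  | Sym nat "'b \<Rightarrow> bool"

fun atom_step :: "(nat \<Rightarrow> 'b) \<Rightarrow> 'b atom \<Rightarrow> regs \<Rightarrow> regs \<Rightarrow> bool" where
  "atom_step W (Upd f) s t \<longleftrightarrow> (\<forall>c. t c = (case f c of None \<Rightarrow> 0 | Some d \<Rightarrow> s d))"
| "atom_step W (Inc c) s t \<longleftrightarrow> t = s(c := Suc (s c))"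
| "atom_step W (Eqt c d) s t \<longleftrightarrow> t = s \<and> s c = s d"
| "atom_step W (Sym c P) s t \<longleftrightarrow> t = s \<and> P (W (s c))"

text \<open>The registers below \<open>K\<close> must form a closed system: an update leaves the
  others alone, and never copies from them into a register below \<open>K\<close>. Only then do the
  markers of the registers below \<open>K\<close> determine their own evolution.\<close>

primrec atom_bound :: "nat \<Rightarrow> 'b atom \<Rightarrow> bool" where
  "atom_bound K (Upd f) \<longleftrightarrow> (\<forall>c\<ge>K. f c = Some c) \<and> (\<forall>c<K. \<forall>d. f c = Some d \<longrightarrow> d < K)"
| "atom_bound K (Inc c) \<longleftrightarrow> c < K"
| "atom_bound K (Eqt c d) \<longleftrightarrow> c < K \<and> d < K"
| "atom_bound K (Sym c P) \<longleftrightarrow> c < K"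

text \<open>Regular programs in the sense of dynamic logic. The tests \<open>Eqt\<close> and
  \<open>Sym\<close> block when they fail, so a wrong guess simply has no continuation.\<close>

datatype 'b prog =
    Atm "'b atom"
  | Seq "'b prog" "'b prog"
  | Alt "'b prog" "'b prog"
  | Star "'b prog"

primrec runs :: "(nat \<Rightarrow> 'b) \<Rightarrow> 'b prog \<Rightarrow> regs \<Rightarrow> regs \<Rightarrow> bool" where
  "runs W (Atm a) = atom_step W a"
| "runs W (Seq p q) = runs W p OO runs W q"
| "runs W (Alt p q) = sup (runs W p) (runs W q)"
| "runs W (Star p) = (runs W p)\<^sup>*\<^sup>*"

primrec bound :: "nat \<Rightarrow> 'b prog \<Rightarrow> bool" where
  "bound K (Atm a) = atom_bound K a"
| "bound K (Seq p q) = (bound K p \<and> bound K q)"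
| "bound K (Alt p q) = (bound K p \<and> bound K q)"
| "bound K (Star p) = bound K p"

text \<open>
  A control state is the list of programs that remain to be run; only finitely many lists are
  reachable from a given one.
\<close>

inductive cstep :: "'b prog list \<Rightarrow> 'b atom \<Rightarrow> 'b prog list \<Rightarrow> bool" where
  cstep_Atm: "cstep (Atm a # k) a k"
| cstep_Seq: "cstep (Seq p q # k) (Eqt 0 0) (p # q # k)"
| cstep_Alt1: "cstep (Alt p q # k) (Eqt 0 0) (p # k)"
| cstep_Alt2: "cstep (Alt p q # k) (Eqt 0 0) (q # k)"
| cstep_Star0: "cstep (Star p # k) (Eqt 0 0) k"
| cstep_Star: "cstep (Star p # k) (Eqt 0 0) (p # Star p # k)"

definition config_step ::
    "(nat \<Rightarrow> 'b) \<Rightarrow> 'b prog list \<times> regs \<Rightarrow> 'b prog list \<times> regs \<Rightarrow> bool"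
  where "config_step W x y \<longleftrightarrow> (\<exists>a. cstep (fst x) a (fst y) \<and> atom_step W a (snd x) (snd y))"

primrec runs_list :: "(nat \<Rightarrow> 'b) \<Rightarrow> 'b prog list \<Rightarrow> regs \<Rightarrow> regs \<Rightarrow> bool" where
  "runs_list W [] = (=)"
| "runs_list W (p # k) = runs W p OO runs_list W k"

lemma config_steps_imp_runs_list:
  assumes "(config_step W)\<^sup>*\<^sup>* x ([], t)"
  shows "runs_list W (fst x) (snd x) t"
  using assms
proof (induction rule: converse_rtranclp_induct)
  case base
  then show ?case by simp
next
  case (step x y)
  then obtain a where "cstep (fst x) a (fst y)" "atom_step W a (snd x) (snd y)"
    by (auto simp: config_step_def)
  then show ?case
    using step.IH by cases (auto intro: converse_rtranclp_into_rtranclp)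
qed

lemma not_cstep_Nil [simp]: "\<not> cstep [] a y"
  by (auto elim: cstep.cases)

text \<open>\<open>Eqt 0 0\<close> is the silent instruction: its test always succeeds and nothing
  changes. It mentions register 0, whence the condition \<open>0 < K\<close> in the bounds
  below.\<close>

lemma config_step_silent:
  "cstep x (Eqt 0 0) y \<Longrightarrow> config_step W (x, s) (y, s)"
  unfolding config_step_def by auto

lemma runs_imp_config_steps:
  "runs W p s t \<Longrightarrow> (config_step W)\<^sup>*\<^sup>* (p # k, s) (k, t)"
proof (induction p arbitrary: k s t)
  case (Atm a)
  then show ?case
    by (intro r_into_rtranclp) (auto simp: config_step_def intro: cstep_Atm)
next
  case (Seq p q)
  then obtain u where u: "runs W p s u" "runs W q u t"
    by auto
  have "config_step W (Seq p q # k, s) (p # q # k, s)"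
    by (intro config_step_silent cstep_Seq)
  also have "(config_step W)\<^sup>*\<^sup>* \<dots> (q # k, u)"
    using Seq.IH(1) u by blast
  also have "(config_step W)\<^sup>*\<^sup>* \<dots> (k, t)"
    using Seq.IH(2) u by blast
  finally show ?case .
next
  case (Alt p q)
  then obtain r where r: "r = p \<or> r = q" "runs W r s t"
    by auto
  then have "config_step W (Alt p q # k, s) (r # k, s)"
    by (auto intro!: config_step_silent cstep.intros)
  also have "(config_step W)\<^sup>*\<^sup>* \<dots> (k, t)"
    using Alt.IH r by blast
  finally show ?case .
next
  case (Star p)
  then have "(runs W p)\<^sup>*\<^sup>* s t"
    by simp
  then show ?case
  proof (induction rule: converse_rtranclp_induct)
    case base
    then show ?case
      by (intro r_into_rtranclp config_step_silent cstep_Star0)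
  next
    case (step s u)
    have "config_step W (Star p # k, s) (p # Star p # k, s)"
      by (intro config_step_silent cstep_Star)
    also have "(config_step W)\<^sup>*\<^sup>* \<dots> (Star p # k, u)"
      using Star.IH step by blast
    also have "(config_step W)\<^sup>*\<^sup>* \<dots> (k, t)"
      by (rule step.IH)
    finally show ?case .
  qed
qed

text \<open>Contains every list that can arise while \<open>p\<close> is worked off in front of
  \<open>k\<close>. The recursion on \<open>p\<close>, in the manner of partial derivatives of
  regular expressions, makes finiteness immediate even for \<open>Star\<close>.\<close>

primrec conts :: "'b prog \<Rightarrow> 'b prog list \<Rightarrow> 'b prog list set" where
  "conts (Atm a) k = {Atm a # k, k}"
| "conts (Seq p q) k = {Seq p q # k} \<union> conts p (q # k) \<union> conts q k"
| "conts (Alt p q) k = {Alt p q # k} \<union> conts p k \<union> conts q k"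
| "conts (Star p) k = {Star p # k, k} \<union> conts p (Star p # k)"

lemma finite_conts: "finite (conts p k)"
  by (induction p arbitrary: k) auto

lemma mem_conts: "p # k \<in> conts p k" "k \<in> conts p k"
proof -
  show "k \<in> conts p k"
    by (induction p arbitrary: k) auto
qed (cases p; simp)

text \<open>The set can be left only from \<open>k\<close> itself, once \<open>p\<close> has been
  worked off. For \<open>k = []\<close> there is no such exit, since the empty list has no
  step.\<close>

lemma conts_closed: "x \<in> conts p k \<Longrightarrow> cstep x a y \<Longrightarrow> y \<in> conts p k \<or> x = k"
proof (induction p arbitrary: k)
  case (Atm b)
  then show ?case by (auto elim: cstep.cases)
next
  case (Seq p q)
  then consider "x = Seq p q # k" | "x \<in> conts p (q # k)" | "x \<in> conts q k"
    by auto
  then show ?case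
  proof cases
    case 1
    then show ?thesis
      using Seq.prems(2) mem_conts by (auto elim: cstep.cases)
  next
    case 2
    then have "y \<in> conts p (q # k) \<or> x = q # k"
      using Seq by blast
    then show ?thesis
      using Seq.IH(2)[of k] Seq.prems(2) mem_conts(1)[of q k] by auto
  qed (use Seq in auto)
next
  case (Alt p q)
  then consider "x = Alt p q # k" | "x \<in> conts p k" | "x \<in> conts q k"
    by auto
  then show ?case
  proof cases
    case 1
    then show ?thesis
      using Alt.prems(2) mem_conts by (auto elim: cstep.cases)
  qed (use Alt in auto)
next
  case (Star p)
  then consider "x = Star p # k" | "x = k" | "x \<in> conts p (Star p # k)"
    by auto
  then show ?case
  proof cases
    case 1
    then have "y = k \<or> y = p # Star p # k"
      using Star.prems(2) by (auto elim: cstep.cases)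
    then show ?thesis
      using mem_conts(1)[of p "Star p # k"] by auto
  next
    case 3
    then have "y \<in> conts p (Star p # k) \<or> x = Star p # k"
      using Star by blast
    moreover have "y = k \<or> y = p # Star p # k" if "x = Star p # k"
      using Star.prems(2) that by (auto elim: cstep.cases)
    ultimately show ?thesis
      using mem_conts(1)[of p "Star p # k"] by auto
  qed auto
qed

lemma conts_bound:
  "x \<in> conts p k \<Longrightarrow> bound K p \<Longrightarrow> \<forall>q\<in>set k. bound K q \<Longrightarrow> \<forall>q\<in>set x. bound K q"
proof (induction p arbitrary: k)
  case (Seq p q)
  from Seq.prems Seq.IH(1)[of "q # k"] Seq.IH(2)[of k] show ?case by auto
next
  case (Alt p q)
  from Alt.prems Alt.IH(1)[of k] Alt.IH(2)[of k] show ?case by auto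
next
  case (Star p)
  from Star.prems Star.IH[of "Star p # k"] show ?case by auto
qed auto

lemma cstep_bound:
  "cstep x a y \<Longrightarrow> \<forall>q\<in>set x. bound K q \<Longrightarrow> 0 < K \<Longrightarrow> atom_bound K a"
  by (induction rule: cstep.induct) auto

lemma cstep_finite: "finite {(a, y). cstep x a y}"
proof (cases "\<exists>p k. x = p # k")
  case True
  then obtain p k where x: "x = p # k" by blast
  have "\<exists>S. finite S \<and> {(a, y). cstep x a y} \<subseteq> S"
  proof (cases p)
    case (Atm a)
    show ?thesis
      by (rule exI[of _ "{(a, k)}"]) (auto simp: x Atm elim: cstep.cases)
  next
    case (Seq q r)
    show ?thesis
      by (rule exI[of _ "{(Eqt 0 0, q # r # k)}"]) (auto simp: x Seq elim: cstep.cases)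
  next
    case (Alt q r)
    show ?thesis
      by (rule exI[of _ "{(Eqt 0 0, q # k), (Eqt 0 0, r # k)}"]) (auto simp: x Alt elim: cstep.cases)
  next
    case (Star q)
    show ?thesis
      by (rule exI[of _ "{(Eqt 0 0, k), (Eqt 0 0, q # Star q # k)}"]) (auto simp: x Star elim: cstep.cases)
  qed
  then show ?thesis
    using finite_subset by blast
next
  case False
  then have "x = []"
    by (cases x) auto
  then show ?thesis by simp
qed

text \<open>A program is repeated forever; the empty continuation marks the end of a round.\<close>

definition loop_edges :: "'b prog \<Rightarrow> ('b prog list \<times> 'b atom \<times> 'b prog list) set"
  where "loop_edges p =
    {([], Eqt 0 0, [p])} \<union> {(x, a, y). x \<in> conts p [] \<and> cstep x a y}"

lemma finite_loop_edges: "finite (loop_edges p)"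
proof -
  have "{(x, a, y). x \<in> conts p [] \<and> cstep x a y} = (SIGMA x : conts p []. {(a, y). cstep x a y})"
    by auto
  then show ?thesis
    by (simp add: loop_edges_def finite_conts cstep_finite)
qed

lemma loop_edges_bound:
  assumes "(x, a, y) \<in> loop_edges p" "bound K p" "0 < K"
  shows "atom_bound K a"
  using assms conts_bound[of x p "[]" K] cstep_bound[of x a y K] by (auto simp: loop_edges_def)

text \<open>The recurrence of the empty control excludes runs that stay inside a \<open>Star\<close>
  forever; it is the property that the Buchi condition will express.\<close>

definition loop_run ::
    "(nat \<Rightarrow> 'b) \<Rightarrow> 'b prog \<Rightarrow> (nat \<Rightarrow> 'b prog list) \<Rightarrow> (nat \<Rightarrow> 'b atom) \<Rightarrow> (nat \<Rightarrow> regs) \<Rightarrow> bool"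
  where "loop_run W p x a s \<longleftrightarrow> x 0 = [] \<and> infinite {j. x j = []} \<and>
    (\<forall>j. (x j, a j, x (Suc j)) \<in> loop_edges p \<and> atom_step W (a j) (s j) (s (Suc j)))"

text \<open>The run is cut at the times when the control is empty; between two consecutive such
  times lies one complete execution of \<open>p\<close>.\<close>

lemma loop_run_imp_chain:
  assumes "loop_run W p x a s"
  obtains u where "u 0 = s 0" "\<And>n::nat. runs W p (u n) (u (Suc n))"
proof -
  have x0: "x 0 = []"
    and edge: "\<And>j::nat. (x j, a j, x (Suc j)) \<in> loop_edges p"
    and step: "\<And>j. atom_step W (a j) (s j) (s (Suc j))"
    and inf: "infinite {j. x j = []}"
    using assms by (simp_all add: loop_run_def)
  let ?t = "enumerate {j. x j = []}"
  have t: "x (?t n) = []" for n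
    using enumerate_in_set[OF inf, of n] by simp
  have between: "x j \<noteq> []" if "?t n < j" "j < ?t (Suc n)" for n j
  proof
    assume "x j = []"
    then have "?t (Suc n) \<le> j"
      unfolding enumerate_Suc''[OF inf] using that by (intro Least_le) simp
    with that show False by simp
  qed
  have path: "(config_step W)\<^sup>*\<^sup>* (x (Suc (?t n)), s (Suc (?t n))) (x (Suc (?t n) + d), s (Suc (?t n) + d))"
    if "Suc (?t n) + d \<le> ?t (Suc n)" for n d
    using that
  proof (induction d)
    case 0
    then show ?case by simp
  next
    case (Suc d)
    let ?j = "Suc (?t n) + d"
    have "x ?j \<noteq> []"
      using between[of n ?j] Suc.prems by simp
    then have "cstep (x ?j) (a ?j) (x (Suc ?j))"
      using edge[of ?j] by (auto simp: loop_edges_def)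
    then have "config_step W (x ?j, s ?j) (x (Suc ?j), s (Suc ?j))"
      using step[of ?j] by (auto simp: config_step_def)
    then show ?case
      using Suc by (auto intro: rtranclp.rtrancl_into_rtrancl)
  qed
  \<comment> \<open>The only edge out of the empty control loads \<open>p\<close> and keeps the
    registers.\<close>
  have first: "x (Suc (?t n)) = [p] \<and> s (Suc (?t n)) = s (?t n)" for n
    using edge[of "?t n"] step[of "?t n"] t[of n] by (auto simp: loop_edges_def elim: cstep.cases)
  have "runs W p (s (?t n)) (s (?t (Suc n)))" for n
  proof -
    have "?t n < ?t (Suc n)"
      by (rule enumerate_step[OF inf])
    then obtain d where d: "?t (Suc n) = Suc (?t n) + d"
      using less_imp_Suc_add by fastforce
    have "(config_step W)\<^sup>*\<^sup>* (x (Suc (?t n)), s (Suc (?t n))) (x (?t (Suc n)), s (?t (Suc n)))"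
      using path[of n d] d by simp
    then have "(config_step W)\<^sup>*\<^sup>* ([p], s (?t n)) ([], s (?t (Suc n)))"
      using first[of n] t[of "Suc n"] by simp
    then show ?thesis
      using config_steps_imp_runs_list by fastforce
  qed
  moreover have "?t 0 = 0"
    unfolding enumerate_0 using x0 by (intro Least_eq_0) simp
  ultimately show ?thesis
    using that[of "\<lambda>n. s (?t n)"] by metis
qed

text \<open>Infinitely many finite executions have to be glued into one sequence. No offsets are
  computed; a countdown to the end of the current round is carried along instead.\<close>

lemma chain_imp_loop_run:
  assumes u: "\<And>n::nat. runs W p (u n) (u (Suc n))"
  obtains x a s where "loop_run W p x a s" "s 0 = u 0"
proof -
  define E where "E x y \<longleftrightarrow> (\<exists>a. (fst x, a, fst y) \<in> loop_edges p \<and> atom_step W a (snd x) (snd y))"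
    for x y :: "'a prog list \<times> regs"
  \<comment> \<open>In \<open>(c, n, d)\<close>, the configuration \<open>c\<close> has
    \<open>d\<close> steps to go until \<open>([], u n)\<close>. At \<open>d = 0\<close> the next
    round is loaded and \<open>n\<close> increases.\<close>
  define inv where "inv c \<longleftrightarrow> (case c of (c, n, d) \<Rightarrow> fst c \<in> conts p [] \<and> (E ^^ d) c ([], u n)
      \<and> (d = 0 \<longrightarrow> c = ([], u n)))" for c
  have steps_pow: "\<exists>d. (E ^^ d) y ([], t)"
    if "(config_step W)\<^sup>*\<^sup>* y ([], t)" "fst y \<in> conts p []" for y t
    using that
  proof (induction rule: converse_rtranclp_induct)
    case base
    then show ?case by (intro exI[of _ 0]) simp
  next
    case (step y z)
    then obtain a where a: "cstep (fst y) a (fst z)" "atom_step W a (snd y) (snd z)"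
      by (auto simp: config_step_def)
    then have "fst y \<noteq> []"
      by (auto elim: cstep.cases)
    then have "fst z \<in> conts p []"
      using conts_closed[OF step.prems a(1)] by auto
    then obtain d where "(E ^^ d) z ([], t)"
      using step.IH by blast
    moreover have "E y z"
      using a step.prems by (auto simp: E_def loop_edges_def)
    ultimately have "(E ^^ Suc d) y ([], t)"
      by (metis relpowp_Suc_I2)
    then show ?case ..
  qed
  have next_step: "\<exists>c'. inv c' \<and> E (fst c) (fst c') \<and>
      (snd (snd c) = 0 \<or> snd (snd c) = Suc (snd (snd c')))" if c: "inv c" for c
  proof -
    obtain y n d where cd: "c = (y, n, d)" by (cases c)
    show ?thesis
    proof (cases d)
      case 0
      have "(config_step W)\<^sup>*\<^sup>* ([p], u n) ([], u (Suc n))"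
        using runs_imp_config_steps[OF u] .
      then obtain d' where d': "(E ^^ d') ([p], u n) ([], u (Suc n))"
        using steps_pow[of "([p], u n)"] mem_conts(1) by fastforce
      moreover have "d' \<noteq> 0"
        using d' by (metis fst_conv not_Cons_self2 relpowp_0_E)
      ultimately have "inv (([p], u n), Suc n, d')"
        using mem_conts(1) by (auto simp: inv_def)
      moreover have "E y ([p], u n)"
        using c 0 by (auto simp: cd inv_def E_def loop_edges_def)
      ultimately show ?thesis
        using 0 by (intro exI[of _ "(([p], u n), Suc n, d')"]) (auto simp: cd)
    next
      case (Suc e)
      then obtain z where z: "E y z" "(E ^^ e) z ([], u n)"
        using c relpowp_Suc_D2[of e E y "([], u n)"] unfolding cd inv_def by auto
      obtain a where a: "(fst y, a, fst z) \<in> loop_edges p"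
        using z(1) by (auto simp: E_def)
      have "fst z \<in> conts p []"
      proof (cases "fst y = []")
        case True
        then show ?thesis
          using a mem_conts(1)[of p "[]"] by (simp add: loop_edges_def)
      next
        case False
        then show ?thesis
          using a conts_closed[of "fst y" p "[]" a "fst z"] by (simp add: loop_edges_def)
      qed
      then have "inv (z, n, e)"
        using z(2) by (auto simp: inv_def)
      then show ?thesis
        using z(1) Suc by (intro exI[of _ "(z, n, e)"]) (auto simp: cd)
    qed
  qed
  have inv0: "inv (([], u 0), 0, 0)"
    using mem_conts(2)[of "[]" p] by (auto simp: inv_def)
  \<comment> \<open>The clause for \<open>j = 0\<close> fixes the start; the last conjunct forces
    the countdown to reach 0 again and again.\<close>
  have "\<exists>c. \<forall>j. (inv (c j) \<and> (j = 0 \<longrightarrow> c j = (([], u 0), 0, 0))) \<and> (E (fst (c j)) (fst (c (Suc j))) \<and>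
      (snd (snd (c j)) = 0 \<or> snd (snd (c j)) = Suc (snd (snd (c (Suc j))))))"
  proof (rule dependent_nat_choice)
    show "\<exists>c. inv c \<and> ((0::nat) = 0 \<longrightarrow> c = (([], u 0), 0, 0))"
      using inv0 by blast
    show "\<exists>c'. (inv c' \<and> (Suc j = 0 \<longrightarrow> c' = (([], u 0), 0, 0))) \<and> (E (fst c) (fst c') \<and>
        (snd (snd c) = 0 \<or> snd (snd c) = Suc (snd (snd c'))))"
      if "inv c \<and> (j = 0 \<longrightarrow> c = (([], u 0), 0, 0))" for c j
      using next_step[of c] that by simp
  qed
  then obtain c where c: "c 0 = (([], u 0), 0, 0)" "\<And>j. inv (c j)"
      "\<And>j. E (fst (c j)) (fst (c (Suc j)))"
      "\<And>j. snd (snd (c j)) = 0 \<or> snd (snd (c j)) = Suc (snd (snd (c (Suc j))))"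
    by blast
  define x where "x j = fst (fst (c j))" for j
  define s where "s j = snd (fst (c j))" for j
  have "\<forall>j. \<exists>a. (x j, a, x (Suc j)) \<in> loop_edges p \<and> atom_step W a (s j) (s (Suc j))"
    using c(3) by (simp add: x_def s_def E_def)
  then obtain a where a: "\<And>j. (x j, a j, x (Suc j)) \<in> loop_edges p \<and> atom_step W (a j) (s j) (s (Suc j))"
    by metis
  have "\<exists>i\<ge>j. x i = []" for j
  proof (induction "snd (snd (c j))" arbitrary: j)
    case 0
    then have "x j = []"
      using c(2)[of j] by (cases "c j") (auto simp: inv_def x_def)
    then show ?case by blast
  next
    case (Suc d)
    then have "d = snd (snd (c (Suc j)))"
      using c(4)[of j] by simp
    then show ?case
      using Suc.hyps(1) Suc_leD by blast
  qed
  then have "infinite {j. x j = []}"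
    by (auto simp: infinite_nat_iff_unbounded_le)
  then have "loop_run W p x a s"
    using a c(1) by (simp add: loop_run_def x_def s_def)
  moreover have "s 0 = u 0"
    using c(1) by (simp add: s_def)
  ultimately show ?thesis
    by (rule that)
qed

section \<open>Tiling systems simulate looping programs\<close>

text \<open>Frees the simulation from numbers as states and from explicit tile sets:
  \<open>Q\<close> is renamed injectively into the numbers, and \<open>D\<close> takes its arguments
  in the order of a tile, top left, top right, bottom left, bottom right.\<close>

lemma local_buchi_recognizable:
  fixes D :: "nat option \<Rightarrow> 'q \<Rightarrow> nat option \<Rightarrow> 'q \<Rightarrow> nat option \<Rightarrow> 'q \<Rightarrow> nat option \<Rightarrow> 'q \<Rightarrow> bool"
  assumes A: "alphabet A" and Q: "finite Q"
  shows "buchi_recognizable A {p \<in> pictures A. \<exists>\<rho>. range \<rho> \<subseteq> Q \<and>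
    (\<forall>i j. D (p (i, Suc j)) (\<rho> (i, Suc j)) (p (Suc i, Suc j)) (\<rho> (Suc i, Suc j))
      (p (i, j)) (\<rho> (i, j)) (p (Suc i, j)) (\<rho> (Suc i, j))) \<and> infinite {v. \<rho> v \<in> F}}"
    (is "buchi_recognizable A ?L")
proof -
  define f where "f = to_nat_on Q"
  have inj: "inj_on f Q"
    unfolding f_def using Q by (intro inj_on_to_nat_on countable_finite)
  define T where "T = \<lparr>states = f ` Q, letters = A,
    tiles = {((k, f q), (l, f r), (m, f s), (n, f t)) | k q l r m s n t.
      {k, l, m, n} \<subseteq> hat A \<and> {q, r, s, t} \<subseteq> Q \<and> D k q l r m s n t}\<rparr>"
  have T: "is_tiling_system T" "letters T = A" "states T = f ` Q"
    using A Q unfolding is_tiling_system_def T_def by (auto simp: Let_def)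
  have "buchi_language T (f ` (F \<inter> Q)) = ?L"
  proof (intro set_eqI iffI)
    fix p assume p: "p \<in> ?L"
    then obtain \<rho> where \<rho>: "range \<rho> \<subseteq> Q" "infinite {v. \<rho> v \<in> F}"
      and D: "\<And>i j. D (p (i, Suc j)) (\<rho> (i, Suc j)) (p (Suc i, Suc j)) (\<rho> (Suc i, Suc j))
      (p (i, j)) (\<rho> (i, j)) (p (Suc i, j)) (\<rho> (Suc i, j))"
      by blast
    have hat: "p (i, j) \<in> hat A" for i j
      using p unfolding pictures_def hat_def by (cases "i = 0 \<or> j = 0") auto
    have "is_run T p (f \<circ> \<rho>)"
      unfolding is_run_def T(3)
    proof (intro conjI allI)
      show "range (f \<circ> \<rho>) \<subseteq> f ` Q"
        using \<rho>(1) by auto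
      fix i j
      have "{\<rho> (i, Suc j), \<rho> (Suc i, Suc j), \<rho> (i, j), \<rho> (Suc i, j)} \<subseteq> Q"
        using \<rho>(1) by auto
      then show "((p (i, j + 1), (f \<circ> \<rho>) (i, j + 1)), (p (i + 1, j + 1), (f \<circ> \<rho>) (i + 1, j + 1)),
       (p (i, j), (f \<circ> \<rho>) (i, j)), (p (i + 1, j), (f \<circ> \<rho>) (i + 1, j))) \<in> tiles T"
        using D[of i j] hat by (simp add: T_def) blast
    qed
    moreover have "{v. \<rho> v \<in> F} \<subseteq> {v. (f \<circ> \<rho>) v \<in> f ` (F \<inter> Q)}"
      using \<rho>(1) by auto
    then have "infinite {v. (f \<circ> \<rho>) v \<in> f ` (F \<inter> Q)}"
      using \<rho>(2) infinite_super by blast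
    ultimately show "p \<in> buchi_language T (f ` (F \<inter> Q))"
      using p T(2) by (auto simp: buchi_language_def)
  next
    fix p assume "p \<in> buchi_language T (f ` (F \<inter> Q))"
    then obtain \<rho> where p: "p \<in> pictures A" and run: "is_run T p \<rho>"
      and inf: "infinite {v. \<rho> v \<in> f ` (F \<inter> Q)}"
      using T(2) by (auto simp: buchi_language_def)
    define \<rho>' where "\<rho>' v = inv_into Q f (\<rho> v)" for v
    have inQ: "\<rho> v \<in> f ` Q" for v
      using run T(3) by (auto simp: is_run_def)
    then have \<rho>'Q: "\<rho>' v \<in> Q" for v
      unfolding \<rho>'_def by (rule inv_into_into)
    have "D (p (i, Suc j)) (\<rho>' (i, Suc j)) (p (Suc i, Suc j)) (\<rho>' (Suc i, Suc j))
      (p (i, j)) (\<rho>' (i, j)) (p (Suc i, j)) (\<rho>' (Suc i, j))" for i j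
    proof -
      have "((p (i, j + 1), \<rho> (i, j + 1)), (p (i + 1, j + 1), \<rho> (i + 1, j + 1)),
       (p (i, j), \<rho> (i, j)), (p (i + 1, j), \<rho> (i + 1, j))) \<in> tiles T"
        using run unfolding is_run_def by blast
      then show ?thesis
        using inj by (auto simp: T_def \<rho>'_def)
    qed
    moreover have "{v. \<rho> v \<in> f ` (F \<inter> Q)} \<subseteq> {v. \<rho>' v \<in> F}"
      using inj by (auto simp: \<rho>'_def)
    then have "infinite {v. \<rho>' v \<in> F}"
      using inf infinite_super by blast
    ultimately show "p \<in> ?L"
      using p \<rho>'Q by blast
  qed
  then show ?thesis
    unfolding buchi_recognizable_def using T by (metis Int_lower2 image_mono)
qed

text \<open>\<open>M\<close> belongs to a cell, \<open>N\<close> to the cell above it and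
  \<open>N'\<close> to the cell above and to the right. \<open>Inc\<close> moves a marker
  diagonally; a leftmost cell has no left neighbour that could exclude a stray marker of
  \<open>c\<close>, which the clause with \<open>left\<close> does instead.\<close>

fun marks_ok ::
    "nat \<Rightarrow> 'b atom \<Rightarrow> bool \<Rightarrow> 'b \<Rightarrow> nat set \<Rightarrow> nat set \<Rightarrow> nat set \<Rightarrow> bool" where
  "marks_ok K (Upd f) left b M N N' \<longleftrightarrow>
    (\<forall>c<K. c \<in> N \<longleftrightarrow> (case f c of None \<Rightarrow> left | Some d \<Rightarrow> d \<in> M))"
| "marks_ok K (Inc c) left b M N N' \<longleftrightarrow>
    (\<forall>d<K. d \<noteq> c \<longrightarrow> (d \<in> N \<longleftrightarrow> d \<in> M)) \<and> (c \<in> N' \<longleftrightarrow> c \<in> M) \<and> (left \<longrightarrow> c \<notin> N)"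
| "marks_ok K (Eqt c d) left b M N N' \<longleftrightarrow> (c \<in> M \<longleftrightarrow> d \<in> M) \<and> N = M"
| "marks_ok K (Sym c P) left b M N N' \<longleftrightarrow> (c \<in> M \<longrightarrow> P b) \<and> N = M"

definition marks :: "nat \<Rightarrow> regs \<Rightarrow> nat \<Rightarrow> nat set"
  where "marks K s i = {c. c < K \<and> s c = i}"

lemma atom_step_imp_marks_ok:
  assumes "atom_bound K a" "atom_step W a s t"
  shows "marks_ok K a (i = 0) (W i) (marks K s i) (marks K t i) (marks K t (Suc i))"
  using assms by (cases a) (auto simp: marks_def split: option.splits)

text \<open>No tile can demand that a register has exactly one marker in a row. This is inherited
  from the row below, since each instruction determines the new markers from the old ones.\<close>

lemma marks_ok_imp_atom_step:
  assumes a: "atom_bound K a"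
    and ok: "\<And>i. marks_ok K a (i = 0) (W i) (marks K s i) (N i) (N (Suc i))"
    and N: "\<And>i. N i \<subseteq> {..<K}"
  shows "\<exists>t. atom_step W a s t \<and> N = marks K t"
proof (cases a)
  case (Upd f)
  define t where "t c = (case f c of None \<Rightarrow> 0 | Some d \<Rightarrow> s d)" for c
  have "c \<in> N i \<longleftrightarrow> c < K \<and> t c = i" for c i
    using ok[of i] N[of i] a unfolding Upd
    by (auto simp: t_def marks_def split: option.splits)
  then have "N = marks K t"
    by (auto simp: marks_def fun_eq_iff)
  then show ?thesis
    by (intro exI[of _ t]) (simp add: Upd t_def)
next
  case (Inc c)
  have "d \<in> N i \<longleftrightarrow> d < K \<and> (s(c := Suc (s c))) d = i" for d i
  proof (cases "d = c")
    case True
    \<comment> \<open>Column \<open>i\<close> receives the marker of \<open>c\<close> from column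
      \<open>i - 1\<close>; for \<open>i = 0\<close> the clause for the leftmost column
      applies.\<close>
    then show ?thesis
      using ok[of "i - 1"] ok[of i] a unfolding Inc by (cases i) (auto simp: marks_def)
  next
    case False
    then show ?thesis
      using ok[of i] N[of i] unfolding Inc by (auto simp: marks_def)
  qed
  then have "N = marks K (s(c := Suc (s c)))"
    by (auto simp: marks_def fun_eq_iff)
  then show ?thesis
    by (intro exI[of _ "s(c := Suc (s c))"]) (simp add: Inc)
next
  case (Eqt c d)
  \<comment> \<open>The test takes effect in column \<open>s c\<close>, where the marker of
    \<open>c\<close> stands.\<close>
  then have "N = marks K s" "s c = s d"
    using ok ok[of "s c"] a by (simp add: Eqt marks_def fun_eq_iff)+
  then show ?thesis
    by (simp add: Eqt)
next
  case (Sym c P)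
  then have "N = marks K s" "P (W (s c))"
    using ok ok[of "s c"] a by (simp add: Sym marks_def fun_eq_iff)+
  then show ?thesis
    by (simp add: Sym)
qed

text \<open>
  A cell holds the symbol of its column, the transition of the machine taken in its row, the set
  of registers whose value is the number of its column, and a flag for the leftmost column.
\<close>

type_synonym 'b loop_cell = "'b \<times> ('b prog list \<times> 'b atom \<times> 'b prog list) \<times> nat set \<times> bool"

text \<open>The left and bottom edges are recognized by the border letters at top left and bottom
  right: \<open>l01\<close> is the border only for \<open>i = 0\<close>, and \<open>l10\<close> only
  for \<open>j = 0\<close>. Because picture column 0 is border, the symbol of grid column
  \<open>i\<close> belongs to the letter in picture column \<open>i + 1\<close>, hence
  \<open>l11\<close> in the bottom row. The last clause also starts the machine there, with all
  markers in column 0.\<close>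

definition loop_tile ::
    "('b \<Rightarrow> nat) \<Rightarrow> nat \<Rightarrow> nat option \<Rightarrow> 'b loop_cell \<Rightarrow> nat option \<Rightarrow> 'b loop_cell \<Rightarrow>
      nat option \<Rightarrow> 'b loop_cell \<Rightarrow> nat option \<Rightarrow> 'b loop_cell \<Rightarrow> bool"
  where "loop_tile lt K l01 q01 l11 q11 l00 q00 l10 q10 \<longleftrightarrow>
    (case (q01, q11, q00, q10) of
      ((b01, e01, M01, z01), (b11, e11, M11, z11), (b00, e00, M00, z00), (b10, e10, M10, z10)) \<Rightarrow>
        b01 = b00 \<and> e10 = e00 \<and> snd (snd e00) = fst e01 \<and> (z00 \<longleftrightarrow> l01 = None) \<and>
        marks_ok K (fst (snd e00)) (l01 = None) b00 M00 M01 M11 \<and>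
        (l10 = None \<longrightarrow> l11 = Some (lt b00) \<and> fst e00 = [] \<and>
          M00 = (if l01 = None then {..<K} else {})))"

theorem loop_buchi_recognizable:
  fixes p :: "'b prog"
  assumes A: "alphabet A" and B: "finite B" and p: "bound K p" "0 < K"
  shows "buchi_recognizable A {pic \<in> pictures A. \<exists>W x a s.
    (\<forall>i. W i \<in> B \<and> pic (Suc i, 1) = Some (lt (W i))) \<and> s 0 = (\<lambda>_. 0) \<and> loop_run W p x a s}"
proof -
  define Q where "Q = B \<times> loop_edges p \<times> Pow {..<K} \<times> (UNIV :: bool set)"
  \<comment> \<open>The transition is constant along a row, so a single row with empty control has
    infinitely many such cells. The flag counts each row once.\<close>
  define F where "F = {q :: 'b loop_cell. fst (fst (snd q)) = [] \<and> snd (snd (snd q))}"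
  have Q: "finite Q"
    using B by (simp add: Q_def finite_loop_edges)
  let ?run = "\<lambda>pic \<rho>. range \<rho> \<subseteq> Q \<and>
    (\<forall>i j. loop_tile lt K (pic (i, Suc j)) (\<rho> (i, Suc j)) (pic (Suc i, Suc j)) (\<rho> (Suc i, Suc j))
      (pic (i, j)) (\<rho> (i, j)) (pic (Suc i, j)) (\<rho> (Suc i, j))) \<and> infinite {v. \<rho> v \<in> F}"
  have "(\<exists>\<rho>. ?run pic \<rho>) \<longleftrightarrow> (\<exists>W x a s.
      (\<forall>i. W i \<in> B \<and> pic (Suc i, 1) = Some (lt (W i))) \<and> s 0 = (\<lambda>_. 0) \<and> loop_run W p x a s)"
    (is "?L \<longleftrightarrow> ?R") if pic: "pic \<in> pictures A" for pic
  proof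
    have border: "pic (0, i) = None" "pic (i, 0) = None" for i
      using pic by (simp_all add: pictures_def)
    have "pic (Suc i, Suc j) \<in> Some ` A" for i j
      using pic by (simp add: pictures_def)
    then have inner: "pic (Suc i, Suc j) \<noteq> None" for i j
      by (metis imageE option.distinct(1))
    have left: "pic (i, Suc j) = None \<longleftrightarrow> i = 0" for i j
      using inner border by (cases i) simp_all
    have bottom: "pic (Suc i, j) = None \<longleftrightarrow> j = 0" for i j
      using inner border by (cases j) simp_all
    {
      assume ?L
      then obtain \<rho> where \<rho>Q: "range \<rho> \<subseteq> Q" and inf: "infinite {v. \<rho> v \<in> F}"
        and tile: "\<And>i j. loop_tile lt K (pic (i, Suc j)) (\<rho> (i, Suc j)) (pic (Suc i, Suc j))
          (\<rho> (Suc i, Suc j)) (pic (i, j)) (\<rho> (i, j)) (pic (Suc i, j)) (\<rho> (Suc i, j))"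
        by blast
      define b e M z where "b i j = fst (\<rho> (i, j))" and "e i j = fst (snd (\<rho> (i, j)))"
        and "M i j = fst (snd (snd (\<rho> (i, j))))" and "z i j = snd (snd (snd (\<rho> (i, j))))" for i j
      have \<rho>: "\<rho> (i, j) = (b i j, e i j, M i j, z i j)" for i j
        by (simp add: b_def e_def M_def z_def)
      have t: "b i (Suc j) = b i j" "e (Suc i) j = e i j" "snd (snd (e i j)) = fst (e i (Suc j))"
          "z i j \<longleftrightarrow> i = 0"
          "marks_ok K (fst (snd (e i j))) (i = 0) (b i j) (M i j) (M i (Suc j)) (M (Suc i) (Suc j))"
          "j = 0 \<Longrightarrow> pic (Suc i, Suc j) = Some (lt (b i j)) \<and> fst (e i j) = [] \<and>
            M i j = (if i = 0 then {..<K} else {})" for i j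
        using tile[of i j] by (auto simp: \<rho> loop_tile_def left bottom)
      have "\<rho> (i, j) \<in> Q" for i j
        using \<rho>Q by auto
      then have in_Q: "b i j \<in> B" "e i j \<in> loop_edges p" "M i j \<subseteq> {..<K}" for i j
        unfolding \<rho> Q_def by auto
      define W where "W i = b i 0" for i
      have b: "b i j = W i" for i j
        by (induction j) (simp_all add: W_def t)
      have e: "e i j = e 0 j" for i j
        by (induction i) (simp_all add: t)
      define x a where "x j = fst (e 0 j)" and "a j = fst (snd (e 0 j))" for j
      have edge: "(x j, a j, x (Suc j)) \<in> loop_edges p" for j
        unfolding x_def a_def t(3)[symmetric] using in_Q(2)[of 0 j] by simp
      \<comment> \<open>The registers are recovered row by row: the tile condition yields successor
        registers once the current markers are known to come from registers.\<close>
      have "\<exists>s. \<forall>j. ((\<lambda>i. M i j) = marks K (s j) \<and> (j = 0 \<longrightarrow> s j = (\<lambda>_. 0))) \<and>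
          atom_step W (a j) (s j) (s (Suc j))"
      proof (rule dependent_nat_choice)
        show "\<exists>s. (\<lambda>i. M i 0) = marks K s \<and> ((0::nat) = 0 \<longrightarrow> s = (\<lambda>_. 0))"
          using t(6)[of 0] by (intro exI[of _ "\<lambda>_. 0"]) (auto simp: marks_def fun_eq_iff)
        show "\<exists>t. ((\<lambda>i. M i (Suc j)) = marks K t \<and> (Suc j = 0 \<longrightarrow> t = (\<lambda>_. 0))) \<and>
            atom_step W (a j) s t"
          if "(\<lambda>i. M i j) = marks K s \<and> (j = 0 \<longrightarrow> s = (\<lambda>_. 0))" for s j
        proof -
          have "M i j = marks K s i" for i
            using that fun_cong[of "\<lambda>i. M i j" "marks K s" i] by simp
          then have "marks_ok K (a j) (i = 0) (W i) (marks K s i) (M i (Suc j)) (M (Suc i) (Suc j))"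
            for i
            using t(5)[of i j] by (simp add: b e[of i] a_def)
          then show ?thesis
            using marks_ok_imp_atom_step[of K "a j" W s "\<lambda>i. M i (Suc j)"] in_Q(3)
              loop_edges_bound[OF edge p] by auto
        qed
      qed
      then obtain s where "\<forall>j. ((\<lambda>i. M i j) = marks K (s j) \<and> (j = 0 \<longrightarrow> s j = (\<lambda>_. 0))) \<and>
          atom_step W (a j) (s j) (s (Suc j))" ..
      then have s: "s 0 = (\<lambda>_. 0)" "\<And>j. atom_step W (a j) (s j) (s (Suc j))"
        by simp_all
      have "\<rho> (i, j) \<in> F \<longleftrightarrow> x j = [] \<and> i = 0" for i j
        unfolding F_def \<rho> x_def using t(4)[of i j] e[of i j] by auto
      then have "{v. \<rho> v \<in> F} = Pair 0 ` {j. x j = []}"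
        by auto
      then have "infinite {j. x j = []}"
        using inf by auto
      moreover have "x 0 = []"
        using t(6)[of 0 0] by (simp add: x_def)
      ultimately have "loop_run W p x a s"
        using edge s by (simp add: loop_run_def)
      moreover have "W i \<in> B \<and> pic (Suc i, 1) = Some (lt (W i))" for i
        using in_Q(1)[of i 0] t(6)[of 0 i] by (simp add: W_def)
      ultimately show ?R
        using s(1) by blast
    next
      assume ?R
      then obtain W x a s where W: "\<And>i. W i \<in> B" "\<And>i. pic (Suc i, 1) = Some (lt (W i))"
        and s: "s 0 = (\<lambda>_. 0)" and run: "loop_run W p x a s"
        by blast
      define \<rho> where
        "\<rho> = (\<lambda>(i, j). (W i, (x j, a j, x (Suc j)), marks K (s j) i, i = (0::nat)))"
      have edge: "(x j, a j, x (Suc j)) \<in> loop_edges p"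
        and step: "atom_step W (a j) (s j) (s (Suc j))" for j
        using run by (auto simp: loop_run_def)
      have "range \<rho> \<subseteq> Q"
        using W(1) edge by (auto simp: \<rho>_def Q_def marks_def)
      moreover have "loop_tile lt K (pic (i, Suc j)) (\<rho> (i, Suc j)) (pic (Suc i, Suc j))
          (\<rho> (Suc i, Suc j)) (pic (i, j)) (\<rho> (i, j)) (pic (Suc i, j)) (\<rho> (Suc i, j))" for i j
      proof -
        have "j = 0 \<Longrightarrow> pic (Suc i, Suc j) = Some (lt (W i)) \<and> x j = [] \<and>
            marks K (s j) i = (if i = 0 then {..<K} else {})"
          using W(2)[of i] run s by (auto simp: loop_run_def marks_def)
        then show ?thesis
          using atom_step_imp_marks_ok[OF loop_edges_bound[OF edge p] step, of j i]
          by (simp add: \<rho>_def loop_tile_def left bottom)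
      qed
      moreover have "{v. \<rho> v \<in> F} = Pair 0 ` {j. x j = []}"
        unfolding F_def \<rho>_def by auto
      then have "infinite {v. \<rho> v \<in> F}"
        using run by (auto simp: loop_run_def finite_image_iff inj_on_def)
      ultimately show ?L
        by blast
    }
  qed
  then have "{pic \<in> pictures A. \<exists>\<rho>. ?run pic \<rho>} = {pic \<in> pictures A. \<exists>W x a s.
      (\<forall>i. W i \<in> B \<and> pic (Suc i, 1) = Some (lt (W i))) \<and> s 0 = (\<lambda>_. 0) \<and> loop_run W p x a s}"
    by blast
  then show ?thesis
    using local_buchi_recognizable[OF A Q, of "loop_tile lt K" F] by simp
qed

section \<open>Independence of a program from the registers beyond its bound\<close>

lemma atom_bound_mono: "atom_bound K a \<Longrightarrow> K \<le> L \<Longrightarrow> atom_bound L a"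
proof (cases a)
  case (Upd f)
  assume a: "atom_bound K a" "K \<le> L"
  have "d < L" if "c < L" "f c = Some d" for c d
    using a that unfolding Upd by (cases "c < K") (auto intro: order.strict_trans2)
  then show ?thesis
    using a by (simp add: Upd)
qed auto

lemma bound_mono: "bound K p \<Longrightarrow> K \<le> L \<Longrightarrow> bound L p"
  by (induction p) (auto intro: atom_bound_mono)

lemma atom_step_frame: "atom_bound K a \<Longrightarrow> atom_step W a s t \<Longrightarrow> K \<le> c \<Longrightarrow> t c = s c"
  by (cases a) auto

text \<open>Registers from the bound on can store data across a run; conjunctions and loops rely on
  this.\<close>

lemma runs_frame: "bound K p \<Longrightarrow> runs W p s t \<Longrightarrow> K \<le> c \<Longrightarrow> t c = s c"
proof (induction p arbitrary: s t)
  case (Atm a)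
  then show ?case by (auto intro: atom_step_frame)
next
  case (Seq p q)
  then obtain u where "runs W p s u" "runs W q u t"
    by auto
  then show ?case
    using Seq.IH(1)[of s u] Seq.IH(2)[of u t] Seq.prems(1,3) by simp
next
  case (Alt p q)
  then show ?case by auto
next
  case (Star p)
  then have "(runs W p)\<^sup>*\<^sup>* s t"
    by simp
  then show ?case
  proof (induction rule: rtranclp_induct)
    case (step u v)
    then show ?case
      using Star.IH[of u v] Star.prems by simp
  qed simp
qed

lemma runs_cong_regs:
  assumes "bound K p" "runs W p s t" "\<And>c. c < K \<Longrightarrow> s' c = s c"
  shows "\<exists>t'. runs W p s' t' \<and> (\<forall>c<K. t' c = t c)"
  using assms
proof (induction p arbitrary: s s' t)
  case (Atm a)
  show ?case
  proof (cases a)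
    case (Upd f)
    define t' where "t' c = (case f c of None \<Rightarrow> 0 | Some d \<Rightarrow> s' d)" for c
    have "t' c = t c" if "c < K" for c
      using Atm Upd that by (auto simp: t'_def split: option.splits)
    then show ?thesis
      by (intro exI[of _ t']) (simp add: Upd t'_def)
  qed (use Atm in auto)
next
  case (Seq p q)
  then obtain u where u: "runs W p s u" "runs W q u t"
    by auto
  obtain u' where u': "runs W p s' u'" "\<forall>c<K. u' c = u c"
    using Seq.IH(1)[OF _ u(1), of s'] Seq.prems(1,3) by auto
  moreover obtain t' where "runs W q u' t'" "\<forall>c<K. t' c = t c"
    using Seq.IH(2)[OF _ u(2), of u'] Seq.prems(1) u'(2) by auto
  ultimately show ?case by auto
next
  case (Alt p q)
  then consider "runs W p s t" | "runs W q s t"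
    by auto
  then show ?case
  proof cases
    case 1
    then show ?thesis
      using Alt.IH(1)[OF _ 1, of s'] Alt.prems(1,3) by auto
  next
    case 2
    then show ?thesis
      using Alt.IH(2)[OF _ 2, of s'] Alt.prems(1,3) by auto
  qed
next
  case (Star p)
  then have "(runs W p)\<^sup>*\<^sup>* s t"
    by simp
  then have "\<exists>t'. (runs W p)\<^sup>*\<^sup>* s' t' \<and> (\<forall>c<K. t' c = t c)"
  proof (induction rule: rtranclp_induct)
    case base
    then show ?case
      using Star.prems(3) by (intro exI[of _ s']) simp
  next
    case (step u v)
    then obtain u' where u': "(runs W p)\<^sup>*\<^sup>* s' u'" "\<forall>c<K. u' c = u c"
      by blast
    moreover obtain v' where "runs W p u' v'" "\<forall>c<K. v' c = v c"
      using Star.IH[OF _ step(2), of u'] Star.prems(1) u'(2) by auto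
    ultimately show ?case
      by (intro exI[of _ v']) (simp add: rtranclp.rtrancl_into_rtrancl[of _ s' u'])
  qed
  then show ?case by simp
qed

definition halts :: "(nat \<Rightarrow> 'b) \<Rightarrow> 'b prog \<Rightarrow> regs \<Rightarrow> bool"
  where "halts W p s \<longleftrightarrow> (\<exists>t. runs W p s t)"

lemma halts_cong_regs:
  assumes "bound K p" "\<And>c. c < K \<Longrightarrow> s c = s' c"
  shows "halts W p s \<longleftrightarrow> halts W p s'"
proof -
  have "halts W p v" if "halts W p u" "\<And>c. c < K \<Longrightarrow> v c = u c" for u v
  proof -
    obtain t where "runs W p u t"
      using \<open>halts W p u\<close> by (auto simp: halts_def)
    from runs_cong_regs[OF assms(1) this, of v] that(2) show ?thesis
      by (auto simp: halts_def)
  qed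
  from this[of s s'] this[of s' s] show ?thesis
    using assms(2) by auto
qed

section \<open>Basic programs and their effect\<close>

abbreviation "upd f \<equiv> Atm (Upd f)"

definition apply_upd :: "(nat \<Rightarrow> nat option) \<Rightarrow> regs \<Rightarrow> regs"
  where "apply_upd f s c = (case f c of None \<Rightarrow> 0 | Some d \<Rightarrow> s d)"

lemma runs_upd: "runs W (upd f) s t \<longleftrightarrow> t = apply_upd f s"
  by (auto simp: apply_upd_def fun_eq_iff)

text \<open>Iterated incrementation is the guess of a number, the source of existential
  quantification.\<close>

lemma runs_Star_Inc: "runs W (Star (Atm (Inc c))) s t \<longleftrightarrow> (\<exists>m. t = s(c := s c + m))"
proof
  assume "runs W (Star (Atm (Inc c))) s t"
  then have "(runs W (Atm (Inc c)))\<^sup>*\<^sup>* s t"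
    by simp
  then show "\<exists>m. t = s(c := s c + m)"
  proof (induction rule: rtranclp_induct)
    case base
    show ?case by (intro exI[of _ 0]) simp
  next
    case (step u v)
    then obtain m where "u = s(c := s c + m)" by blast
    then show ?case
      using step(2) by (intro exI[of _ "Suc m"]) simp
  qed
next
  define r where "r = runs W (Atm (Inc c))"
  have step: "r (s(c := s c + m)) (s(c := s c + Suc m))" for m
    by (simp add: r_def)
  have "r\<^sup>*\<^sup>* s (s(c := s c + m))" for m
  proof (induction m)
    case (Suc m)
    show ?case
      by (rule rtranclp.rtrancl_into_rtrancl[OF Suc, OF step])
  qed simp
  then have "runs W (Star (Atm (Inc c))) s (s(c := s c + m))" for m
    by (simp only: runs.simps(4) r_def)
  then show "runs W (Star (Atm (Inc c))) s t" if "\<exists>m. t = s(c := s c + m)"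
    using that by blast
qed

lemma runs_Seq_upd: "runs W (Seq (upd f) p) s t \<longleftrightarrow> runs W p (apply_upd f s) t"
  unfolding runs.simps(2) relcompp_apply runs_upd by blast

lemma halts_upd: "halts W (Seq (upd f) p) s \<longleftrightarrow> halts W p (apply_upd f s)"
  by (simp only: halts_def runs_Seq_upd)

lemma runs_Seq_Inc: "runs W (Seq (Atm (Inc c)) p) s t \<longleftrightarrow> runs W p (s(c := Suc (s c))) t"
  by (simp add: relcompp_apply)

lemma runs_Seq_guess: "runs W (Seq (Star (Atm (Inc c))) p) s t \<longleftrightarrow> (\<exists>m. runs W p (s(c := s c + m)) t)"
  unfolding runs.simps(2) relcompp_apply runs_Star_Inc by blast

lemma halts_Seq: "halts W (Seq p q) s \<longleftrightarrow> (\<exists>t. runs W p s t \<and> halts W q t)"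
  unfolding halts_def runs.simps(2) relcompp_apply by blast

lemma halts_Seq_guess: "halts W (Seq (Star (Atm (Inc c))) p) s \<longleftrightarrow> (\<exists>m. halts W p (s(c := s c + m)))"
  unfolding halts_def runs_Seq_guess by blast

section \<open>Checkable predicates\<close>

text \<open>A one-sided notion: truth means that some run halts, and nothing is said about falsity.
  Hence \<open>chk B P\<close> does not provide \<open>chk\<close> of the negation, and negated
  versions are proved separately wherever they are needed.\<close>

definition decides :: "'b set \<Rightarrow> ((nat \<Rightarrow> 'b) \<Rightarrow> regs \<Rightarrow> bool) \<Rightarrow> 'b prog \<Rightarrow> nat \<Rightarrow> bool"
  where "decides B P p K \<longleftrightarrow> bound K p \<and> (\<forall>W s. range W \<subseteq> B \<longrightarrow> (P W s \<longleftrightarrow> halts W p s))"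

definition chk :: "'b set \<Rightarrow> ((nat \<Rightarrow> 'b) \<Rightarrow> regs \<Rightarrow> bool) \<Rightarrow> bool"
  where "chk B P \<longleftrightarrow> (\<exists>p K. decides B P p K)"

lemma chkI:
  assumes "bound K p" "\<And>W s. range W \<subseteq> B \<Longrightarrow> P W s \<longleftrightarrow> halts W p s"
  shows "chk B P"
  unfolding chk_def decides_def using assms by blast

lemma chkE:
  assumes "chk B P"
  obtains p K where "decides B P p K" "L \<le> K"
proof -
  obtain p K where "decides B P p K"
    using assms by (auto simp: chk_def)
  then have "decides B P p (max K L)"
    using bound_mono[of K p "max K L"] by (simp add: decides_def)
  then show ?thesis
    by (rule that) simp
qed

lemma decides_bound: "decides B P p K \<Longrightarrow> bound K p"
  by (simp add: decides_def)

lemma decides_iff: "decides B P p K \<Longrightarrow> range W \<subseteq> B \<Longrightarrow> P W s \<longleftrightarrow> halts W p s"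
  by (simp add: decides_def)

lemma decides_cong:
  assumes "decides B P p K" "range W \<subseteq> B" "\<And>c. c < K \<Longrightarrow> s c = s' c"
  shows "P W s \<longleftrightarrow> P W s'"
  using halts_cong_regs[OF decides_bound[OF assms(1)] assms(3)] decides_iff[OF assms(1,2)] by simp

lemma chk_cong:
  assumes "chk B P" "\<And>W s. range W \<subseteq> B \<Longrightarrow> Q W s \<longleftrightarrow> P W s"
  shows "chk B Q"
proof -
  obtain p K where dec: "decides B P p K"
    using assms(1) by (auto simp: chk_def)
  show ?thesis
    by (rule chkI[OF decides_bound[OF dec]]) (simp add: assms(2) decides_iff[OF dec])
qed

lemma chk_eq_regs: "chk B (\<lambda>W s. s i = s j)"
  by (rule chkI[of "Suc (max i j)" "Atm (Eqt i j)"]) (auto simp: halts_def)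

lemma chk_sym_reg: "chk B (\<lambda>W s. P (W (s i)))"
  by (rule chkI[of "Suc i" "Atm (Sym i P)"]) (auto simp: halts_def)

lemma chk_const: "chk B (\<lambda>W s. b)"
  by (rule chk_sym_reg[where P = "\<lambda>_. b"])

lemma chk_disj:
  assumes "chk B P" "chk B Q"
  shows "chk B (\<lambda>W s. P W s \<or> Q W s)"
proof -
  obtain p K where p_dec: "decides B P p K"
    using chkE[OF assms(1)] by blast
  note p = decides_bound[OF p_dec] decides_iff[OF p_dec] decides_cong[OF p_dec]
  obtain q L where q_dec: "decides B Q q L" and q_le: "K \<le> L"
    using chkE[OF assms(2)] by blast
  note q = decides_bound[OF q_dec] decides_iff[OF q_dec] decides_cong[OF q_dec]
  have "bound L p"
    using bound_mono p(1) q_le by blast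
  show ?thesis
  proof (rule chkI[of L "Alt p q"])
    show "bound L (Alt p q)"
      using \<open>bound L p\<close> q(1) by simp
    show "P W s \<or> Q W s \<longleftrightarrow> halts W (Alt p q) s" if "range W \<subseteq> B" for W s
      using p(2)[OF that] q(2)[OF that] by (auto simp: halts_def)
  qed
qed

text \<open>A renaming such as the shift moves infinitely many registers, but an instruction may
  touch only finitely many. Since \<open>p\<close> reads the registers below \<open>K\<close> only,
  \<open>f\<close> is cut off there; \<open>M\<close> bounds the registers from which it
  copies.\<close>

lemma chk_rename_option:
  fixes B :: "'b set"
  assumes "chk B P"
  shows "chk B (\<lambda>W s. P W (apply_upd f s))"
proof -
  obtain p K where p_dec: "decides B P p K"
    using chkE[OF assms] by blast
  note p = decides_bound[OF p_dec] decides_iff[OF p_dec] decides_cong[OF p_dec]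
  define g where "g c = (if c < K then f c else Some c)" for c
  have "finite (\<Union>c<K. set_option (f c))"
    by simp
  then obtain M where M: "\<And>d. d \<in> (\<Union>c<K. set_option (f c)) \<Longrightarrow> d < M"
    by (meson finite_nat_set_iff_bounded)
  show ?thesis
  proof (rule chkI[of "max K M" "Seq (upd g) p"])
    have "d < max K M" if "c < max K M" "g c = Some d" for c d
      using that M[of d] by (cases "c < K") (force simp: g_def)+
    then show "bound (max K M) (Seq (upd g) p)"
      using bound_mono[OF p(1), of "max K M"] by (simp add: g_def)
    fix W :: "nat \<Rightarrow> 'b" and s assume W: "range W \<subseteq> B"
    have "apply_upd g s c = apply_upd f s c" if "c < K" for c
      using that by (simp add: apply_upd_def g_def)
    then have "P W (apply_upd g s) \<longleftrightarrow> P W (apply_upd f s)"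
      by (rule p(3)[OF W])
    then show "P W (apply_upd f s) \<longleftrightarrow> halts W (Seq (upd g) p) s"
      unfolding halts_upd p(2)[OF W, symmetric] by simp
  qed
qed

lemma chk_rename: "chk B P \<Longrightarrow> chk B (\<lambda>W s. P W (\<lambda>i. s (f i)))"
  using chk_rename_option[of B P "\<lambda>i. Some (f i)"] by (simp add: apply_upd_def[abs_def])

text \<open>\<open>p\<close> may destroy the input, so a copy is kept in the registers from
  \<open>K\<close> to \<open>2 * K - 1\<close>, out of reach of \<open>p\<close>, and restored for
  \<open>q\<close>.\<close>

lemma chk_conj:
  fixes B :: "'b set"
  assumes "chk B P" "chk B Q"
  shows "chk B (\<lambda>W s. P W s \<and> Q W s)"
proof -
  obtain p K' where p_dec: "decides B P p K'"
    using chkE[OF assms(1)] by blast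
  note p' = decides_bound[OF p_dec] decides_iff[OF p_dec] decides_cong[OF p_dec]
  obtain q K where q_dec: "decides B Q q K" and q_le: "K' \<le> K"
    using chkE[OF assms(2)] by blast
  note q = decides_bound[OF q_dec] decides_iff[OF q_dec] decides_cong[OF q_dec]
  have p: "bound K p"
    using bound_mono p'(1) q_le by blast
  define save restore where "save c = (if c < K then Some c else if c < 2 * K then Some (c - K) else Some c)"
    and "restore c = (if c < K then Some (c + K) else Some c)" for c
  show ?thesis
  proof (rule chkI[of "2 * K" "Seq (upd save) (Seq p (Seq (upd restore) q))"])
    show "bound (2 * K) (Seq (upd save) (Seq p (Seq (upd restore) q)))"
      using bound_mono[OF p, of "2 * K"] bound_mono[OF q(1), of "2 * K"]
      by (auto simp: save_def restore_def split: if_splits)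
    fix W :: "nat \<Rightarrow> 'b" and s assume W: "range W \<subseteq> B"
    have 1: "halts W p (apply_upd save s) \<longleftrightarrow> halts W p s"
      by (rule halts_cong_regs[OF p]) (simp add: apply_upd_def save_def)
    have 2: "halts W q (apply_upd restore t) \<longleftrightarrow> halts W q s" if "runs W p (apply_upd save s) t" for t
    proof (rule halts_cong_regs[OF q(1)])
      fix c assume c: "c < K"
      have "t (c + K) = apply_upd save s (c + K)"
        using runs_frame[OF p that] by simp
      then show "apply_upd restore t c = s c"
        using c by (simp add: apply_upd_def restore_def save_def)
    qed
    have "halts W (Seq (upd save) (Seq p (Seq (upd restore) q))) s \<longleftrightarrow>
        (\<exists>t. runs W p (apply_upd save s) t \<and> halts W (Seq (upd restore) q) t)"
      unfolding halts_upd halts_Seq[of W p] ..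
    also have "\<dots> \<longleftrightarrow> (\<exists>t. runs W p (apply_upd save s) t) \<and> halts W q s"
      unfolding halts_upd using 2 by blast
    also have "\<dots> \<longleftrightarrow> halts W p s \<and> halts W q s"
      using 1 unfolding halts_def[of W p] by simp
    finally show "P W s \<and> Q W s \<longleftrightarrow> halts W (Seq (upd save) (Seq p (Seq (upd restore) q))) s"
      using p'(2)[OF W] q(2)[OF W] by simp
  qed
qed

text \<open>Quantification in the style of de Bruijn: the bound variable occupies register 0 and the
  parameters move up by one.\<close>

lemma chk_ex:
  fixes B :: "'b set"
  assumes "chk B (\<lambda>W s. P W (s 0) (\<lambda>i. s (Suc i)))"
  shows "chk B (\<lambda>W s. \<exists>n. P W n s)"
proof -
  obtain p K where dec: "decides B (\<lambda>W s. P W (s 0) (\<lambda>i. s (Suc i))) p K" and K: "1 \<le> K"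
    using chkE[OF assms] by blast
  note p = K decides_bound[OF dec] decides_iff[OF dec]
  define f where "f c = (case c of 0 \<Rightarrow> None | Suc d \<Rightarrow> if c < K then Some d else Some c)" for c
  show ?thesis
  proof (rule chkI[of K "Seq (upd f) (Seq (Star (Atm (Inc 0))) p)"])
    show "bound K (Seq (upd f) (Seq (Star (Atm (Inc 0))) p))"
      using p by (auto simp: f_def split: nat.splits if_splits)
    fix W :: "nat \<Rightarrow> 'b" and s assume W: "range W \<subseteq> B"
    have f0: "apply_upd f s 0 = 0"
      by (simp add: apply_upd_def f_def)
    have *: "halts W p ((apply_upd f s)(0 := n)) \<longleftrightarrow> P W n s" for n
    proof -
      have "halts W p ((apply_upd f s)(0 := n)) \<longleftrightarrow> halts W p (case_nat n s)"
        by (rule halts_cong_regs[OF p(2)]) (auto simp: apply_upd_def f_def split: nat.splits)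
      then show ?thesis
        using p(3)[OF W, of "case_nat n s"] by simp
    qed
    have "halts W (Seq (upd f) (Seq (Star (Atm (Inc 0))) p)) s \<longleftrightarrow>
        (\<exists>n. halts W p ((apply_upd f s)(0 := n)))"
      unfolding halts_upd halts_Seq_guess f0 by simp
    then show "(\<exists>n. P W n s) \<longleftrightarrow> halts W (Seq (upd f) (Seq (Star (Atm (Inc 0))) p)) s"
      by (simp only: *)
  qed
qed

text \<open>
  The register \<open>K\<close> counts the links of the chain, \<open>K + 1\<close> holds its current element and the
  registers from \<open>K + 2\<close> on save the input, so that each link can be checked from scratch.
\<close>

lemma chk_chain_regs:
  fixes B :: "'b set"
  assumes "chk B (\<lambda>W s. R W (s 0) (s 1) (s 2) (\<lambda>i. s (i + 3)))"
  shows "chk B (\<lambda>W s. \<exists>y. y 0 = s 1 \<and> y (s 0) = s 2 \<and>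
    (\<forall>n<s 0. R W n (y n) (y (Suc n)) (\<lambda>i. s (i + 3))))"
proof -
  obtain p K where dec: "decides B (\<lambda>W s. R W (s 0) (s 1) (s 2) (\<lambda>i. s (i + 3))) p K"
      and K: "3 \<le> K"
    using chkE[OF assms] by blast
  note p = K decides_bound[OF dec] decides_iff[OF dec]
  \<comment> \<open>Register \<open>K + 2 + c\<close> saves input register \<open>c\<close> for
    \<open>c < K\<close>; the chain starts at \<open>s 1\<close> with counter 0.\<close>
  define init where "init c = (if c < K then Some c else if c = K then None else if c = K + 1 then Some 1
    else if c < 2 * K + 2 then Some (c - (K + 2)) else Some c)" for c
  define load where "load c = (if c = 0 then Some K else if c = 1 then Some (K + 1) else
    if c = 2 then None else if c < K then Some (K + 2 + c) else Some c)" for c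
  define adv where "adv c = (if c = K + 1 then Some 2 else Some c)" for c :: nat
  \<comment> \<open>The guess is copied to \<open>K + 1\<close> and the counter raised before
    \<open>p\<close> runs: \<open>p\<close> may overwrite register 2, but none of the registers from
    \<open>K\<close> on.\<close>
  define body where "body = Seq (upd load) (Seq (Star (Atm (Inc 2))) (Seq (upd adv) (Seq (Atm (Inc K)) p)))"
  define R' where "R' W s z \<longleftrightarrow> R W (s K) (s (K + 1)) z (\<lambda>i. s (K + 5 + i))" for W s z
  have body: "runs W body s t \<longleftrightarrow> (\<exists>z. runs W p ((apply_upd load s)(2 := z, K + 1 := z, K := Suc (s K))) t)"
    for W s t
  proof -
    have l: "apply_upd load s 2 = 0" "apply_upd load s K = s K"
      using p(1) by (auto simp: apply_upd_def load_def)
    have a: "(apply_upd adv u)(K := Suc (apply_upd adv u K)) = u(K + 1 := u 2, K := Suc (u K))" for u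
      by (auto simp: apply_upd_def adv_def)
    show ?thesis
      unfolding body_def runs_Seq_upd runs_Seq_guess runs_Seq_Inc a l using p(1) l by simp
  qed
  have halts_p: "halts W p ((apply_upd load s)(2 := z, K + 1 := z, K := Suc (s K))) \<longleftrightarrow> R' W s z"
    if W: "range W \<subseteq> B" for W s z
  proof -
    let ?u = "\<lambda>c. if c = 0 then s K else if c = 1 then s (K + 1) else if c = 2 then z else s (K + 2 + c)"
    have "halts W p ((apply_upd load s)(2 := z, K + 1 := z, K := Suc (s K))) \<longleftrightarrow> halts W p ?u"
      by (rule halts_cong_regs[OF p(2)]) (use p(1) in \<open>auto simp: apply_upd_def load_def\<close>)
    also have "\<dots> \<longleftrightarrow> R' W s z"
      unfolding p(3)[OF W, symmetric] R'_def by (simp add: algebra_simps)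
    finally show ?thesis .
  qed
  have body_D: "t K = Suc (s K)" "t (K + 2 + c) = s (K + 2 + c)" "R' W s (t (K + 1))"
    if W: "range W \<subseteq> B" and r: "runs W body s t" for W s t c
  proof -
    obtain z where z: "runs W p ((apply_upd load s)(2 := z, K + 1 := z, K := Suc (s K))) t"
      using r body by blast
    show "t K = Suc (s K)"
      using runs_frame[OF p(2) z, of K] by simp
    show "t (K + 2 + c) = s (K + 2 + c)"
      using runs_frame[OF p(2) z, of "K + 2 + c"] p(1) by (simp add: apply_upd_def load_def)
    have "t (K + 1) = z"
      using runs_frame[OF p(2) z, of "K + 1"] by simp
    then show "R' W s (t (K + 1))"
      using z halts_p[OF W, of s z] by (auto simp: halts_def)
  qed
  have body_I: "\<exists>t. runs W body s t \<and> t K = Suc (s K) \<and> t (K + 1) = z \<and>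
      (\<forall>c. t (K + 2 + c) = s (K + 2 + c))" if W: "range W \<subseteq> B" and r: "R' W s z" for W s z
  proof -
    obtain t where t: "runs W p ((apply_upd load s)(2 := z, K + 1 := z, K := Suc (s K))) t"
      using halts_p[OF W] r by (auto simp: halts_def)
    then have "runs W body s t"
      using body by blast
    moreover have "t (K + 1) = z"
      using runs_frame[OF p(2) t, of "K + 1"] by simp
    ultimately show ?thesis
      using body_D[OF W] by blast
  qed
  \<comment> \<open>Registers \<open>K + 2\<close> and \<open>K + 4\<close> hold the saved length
    \<open>s 0\<close> and the saved target \<open>s 2\<close>.\<close>
  define prog where "prog = Seq (upd init) (Seq (Star body) (Seq (Atm (Eqt K (K + 2))) (Atm (Eqt (K + 1) (K + 4)))))"
  show ?thesis
  proof (rule chkI[of "2 * K + 2" prog])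
    have b_upd: "bound (2 * K + 2) (upd init)" "bound (2 * K + 2) (upd load)" "bound (2 * K + 2) (upd adv)"
      using p(1) by (auto simp: init_def load_def adv_def split: if_splits)
    have b_atm: "bound (2 * K + 2) (Star (Atm (Inc 2)))" "bound (2 * K + 2) (Atm (Inc K))"
        "bound (2 * K + 2) (Atm (Eqt K (K + 2)))" "bound (2 * K + 2) (Atm (Eqt (K + 1) (K + 4)))"
      using p(1) by simp_all
    have "bound (2 * K + 2) p"
      by (rule bound_mono[OF p(2)]) simp
    then show "bound (2 * K + 2) prog"
      unfolding prog_def body_def bound.simps(2) bound.simps(4)[of _ "Seq _ _"] using b_upd b_atm by blast
    fix W :: "nat \<Rightarrow> 'b" and s assume W: "range W \<subseteq> B"
    define s0 where "s0 = apply_upd init s"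
    have s0: "s0 K = 0" "s0 (K + 1) = s 1" "c < K \<Longrightarrow> s0 (K + 2 + c) = s c" for c
      using p(1) by (auto simp: s0_def apply_upd_def init_def)
    \<comment> \<open>Parameters beyond the saved ones may differ, but the truth of \<open>R\<close>
      depends on the registers below \<open>K\<close> only.\<close>
    have R_s0: "R W n y z (\<lambda>i. s0 (K + 5 + i)) \<longleftrightarrow> R W n y z (\<lambda>i. s (i + 3))" for n y z
    proof -
      let ?u = "\<lambda>f c. if c = 0 then n else if c = 1 then y else if c = 2 then z else f c"
      have "halts W p (?u (\<lambda>c. s0 (K + 2 + c))) \<longleftrightarrow> halts W p (?u s)"
        by (rule halts_cong_regs[OF p(2)]) (use s0 in auto)
      then show ?thesis
        unfolding p(3)[OF W, symmetric] by (simp add: algebra_simps)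
    qed
    have reach: "(\<exists>t. (runs W body)\<^sup>*\<^sup>* s0 t \<and> t K = k \<and> t (K + 1) = b) \<longleftrightarrow>
        (\<exists>y. y 0 = s 1 \<and> y k = b \<and> (\<forall>n<k. R W n (y n) (y (Suc n)) (\<lambda>i. s (i + 3))))" for k b
    proof
      assume "\<exists>t. (runs W body)\<^sup>*\<^sup>* s0 t \<and> t K = k \<and> t (K + 1) = b"
      then obtain t where "(runs W body)\<^sup>*\<^sup>* s0 t" and tk: "t K = k" "t (K + 1) = b"
        by blast
      from this(1) have "(\<forall>c. t (K + 2 + c) = s0 (K + 2 + c)) \<and> (\<exists>y. y 0 = s 1 \<and> y (t K) = t (K + 1) \<and>
          (\<forall>n<t K. R W n (y n) (y (Suc n)) (\<lambda>i. s (i + 3))))"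
      proof (induction rule: rtranclp_induct)
        case base
        then show ?case
          using s0 by (intro conjI exI[of _ "\<lambda>_. s 1"]) auto
      next
        case (step u v)
        then obtain y where y: "y 0 = s 1" "y (u K) = u (K + 1)"
            "\<And>n. n < u K \<Longrightarrow> R W n (y n) (y (Suc n)) (\<lambda>i. s (i + 3))"
          by blast
        have v: "v K = Suc (u K)" "\<And>c. v (K + 2 + c) = u (K + 2 + c)" "R' W u (v (K + 1))"
          using body_D[OF W step(2)] by auto
        have "u (K + 5 + i) = s0 (K + 5 + i)" for i
          using step.IH[THEN conjunct1, THEN spec, of "3 + i"] by (simp add: algebra_simps)
        then have "R W (u K) (u (K + 1)) (v (K + 1)) (\<lambda>i. s (i + 3))"
          using v(3) unfolding R'_def R_s0[symmetric] by simp
        then have "\<forall>n<v K. R W n ((y(v K := v (K + 1))) n) ((y(v K := v (K + 1))) (Suc n)) (\<lambda>i. s (i + 3))"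
          using y v(1) by (auto simp: less_Suc_eq)
        then show ?case
          using step.IH v y(1) by (intro conjI exI[of _ "y(v K := v (K + 1))"]) auto
      qed
      then show "\<exists>y. y 0 = s 1 \<and> y k = b \<and> (\<forall>n<k. R W n (y n) (y (Suc n)) (\<lambda>i. s (i + 3)))"
        using tk by blast
    next
      assume "\<exists>y. y 0 = s 1 \<and> y k = b \<and> (\<forall>n<k. R W n (y n) (y (Suc n)) (\<lambda>i. s (i + 3)))"
      then obtain y where y: "y 0 = s 1" "y k = b" "\<And>n. n < k \<Longrightarrow> R W n (y n) (y (Suc n)) (\<lambda>i. s (i + 3))"
        by blast
      have "\<exists>t. (runs W body)\<^sup>*\<^sup>* s0 t \<and> t K = m \<and> t (K + 1) = y m \<and>
          (\<forall>c. t (K + 2 + c) = s0 (K + 2 + c))" if "m \<le> k" for m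
        using that
      proof (induction m)
        case 0
        then show ?case
          using s0 y(1) by (intro exI[of _ s0]) simp
      next
        case (Suc m)
        then obtain t where t: "(runs W body)\<^sup>*\<^sup>* s0 t" "t K = m" "t (K + 1) = y m"
            "\<And>c. t (K + 2 + c) = s0 (K + 2 + c)"
          by auto
        have "t (K + 5 + i) = s0 (K + 5 + i)" for i
          using t(4)[of "3 + i"] by (simp add: algebra_simps)
        then have "R' W t (y (Suc m))"
          using y(3)[of m] Suc.prems t unfolding R'_def R_s0[symmetric] by simp
        then obtain u where "runs W body t u" "u K = Suc m" "u (K + 1) = y (Suc m)"
            "\<forall>c. u (K + 2 + c) = s0 (K + 2 + c)"
          using body_I[OF W, of t "y (Suc m)"] t by auto
        then show ?case
          using t(1) by (intro exI[of _ u]) (simp add: rtranclp.rtrancl_into_rtrancl[of _ s0 t])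
      qed
      from this[of k] show "\<exists>t. (runs W body)\<^sup>*\<^sup>* s0 t \<and> t K = k \<and> t (K + 1) = b"
        using y(2) by auto
    qed
    have saved: "t (K + 2) = s 0 \<and> t (K + 4) = s 2" if "(runs W body)\<^sup>*\<^sup>* s0 t" for t
    proof -
      have "\<forall>c. t (K + 2 + c) = s0 (K + 2 + c)"
        using that
      proof (induction rule: rtranclp_induct)
        case (step u v)
        then show ?case
          using body_D(2)[OF W step(2)] by simp
      qed simp
      from this[THEN spec, of 0] this[THEN spec, of 2] show ?thesis
        using s0(3)[of 0] s0(3)[of 2] p(1) by (simp add: numeral_eq_Suc)
    qed
    have "halts W prog s \<longleftrightarrow> (\<exists>t. (runs W body)\<^sup>*\<^sup>* s0 t \<and> t K = t (K + 2) \<and> t (K + 1) = t (K + 4))"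
      unfolding prog_def halts_upd s0_def[symmetric] halts_Seq[of W "Star body"] by (simp add: halts_def relcompp_apply)
    also have "\<dots> \<longleftrightarrow> (\<exists>t. (runs W body)\<^sup>*\<^sup>* s0 t \<and> t K = s 0 \<and> t (K + 1) = s 2)"
      using saved by metis
    finally show "(\<exists>y. y 0 = s 1 \<and> y (s 0) = s 2 \<and>
        (\<forall>n<s 0. R W n (y n) (y (Suc n)) (\<lambda>i. s (i + 3)))) \<longleftrightarrow> halts W prog s"
      unfolding reach by simp
  qed
qed

lemma chk_renameI:
  assumes "chk B P" "\<And>W s. Q W s \<longleftrightarrow> P W (\<lambda>i. s (f i))"
  shows "chk B Q"
  by (rule chk_cong[OF chk_rename[OF assms(1), of f]]) (simp add: assms(2))

section \<open>Checkable functions\<close>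

definition chkf :: "'b set \<Rightarrow> ((nat \<Rightarrow> 'b) \<Rightarrow> regs \<Rightarrow> nat) \<Rightarrow> bool"
  where "chkf B f \<longleftrightarrow> chk B (\<lambda>W s. f W (\<lambda>i. s (Suc i)) = s 0)"

lemma chkf_rename:
  assumes "chkf B f"
  shows "chkf B (\<lambda>W s. f W (\<lambda>i. s (g i)))"
  unfolding chkf_def
  by (rule chk_renameI[OF assms[unfolded chkf_def], of _ "case_nat 0 (\<lambda>i. Suc (g i))"]) simp

lemma chk_graph:
  assumes "chkf B f"
  shows "chk B (\<lambda>W s. f W (\<lambda>i. s (g i)) = s j)"
  by (rule chk_renameI[OF assms[unfolded chkf_def], of _ "case_nat j g"]) simp

text \<open>Checking the graph is enough for substitution, because the value can be guessed and then
  verified.\<close>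

lemma chk_subst:
  assumes "chk B (\<lambda>W s. P W (s 0) (\<lambda>i. s (Suc i)))" "chkf B f"
  shows "chk B (\<lambda>W s. P W (f W s) s)"
proof -
  have "chk B (\<lambda>W s. \<exists>n. f W s = n \<and> P W n s)"
    by (rule chk_ex) (rule chk_conj[OF chk_graph[OF assms(2)] assms(1)])
  then show ?thesis by simp
qed

lemma chkfI:
  assumes "chk B (\<lambda>W s. G W (s 0) (\<lambda>i. s (Suc i)))"
    and "\<And>W s n. range W \<subseteq> B \<Longrightarrow> f W s = n \<longleftrightarrow> G W n s"
  shows "chkf B f"
  unfolding chkf_def by (rule chk_cong[OF assms(1)]) (simp add: assms(2))

lemma chkf_reg: "chkf B (\<lambda>W s. s i)"
  unfolding chkf_def by (rule chk_eq_regs)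

lemma chk_eq: "chkf B f \<Longrightarrow> chkf B g \<Longrightarrow> chk B (\<lambda>W s. f W s = g W s)"
  by (rule chk_subst[where f = g], rule chk_graph)

lemma chk_sym:
  assumes "chkf B f"
  shows "chk B (\<lambda>W s. P (W (f W s)))"
  by (rule chk_subst[OF chk_sym_reg assms])

text \<open>Takes the place of a coding of finite sequences such as Goedel's beta function: the
  sequence \<open>y\<close> is never coded, its elements are guessed one at a time.\<close>

lemma chk_chain:
  assumes "chk B (\<lambda>W s. R W (s 0) (s 1) (s 2) (\<lambda>i. s (i + 3)))" "chkf B k" "chkf B a" "chkf B b"
  shows "chk B (\<lambda>W s. \<exists>y. y 0 = a W s \<and> y (k W s) = b W s \<and> (\<forall>n<k W s. R W n (y n) (y (Suc n)) s))"
proof -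
  have "chk B (\<lambda>W s. \<exists>c d e. k W s = e \<and> a W s = d \<and> b W s = c \<and>
    (\<exists>y. y 0 = d \<and> y e = c \<and> (\<forall>n<e. R W n (y n) (y (Suc n)) s)))"
    using chk_chain_regs[OF assms(1)]
    by (intro chk_ex chk_conj chk_graph assms) (simp add: numeral_eq_Suc)
  then show ?thesis by simp
qed

text \<open>A chain whose links ignore its elements leaves just the condition on the index, required
  below \<open>k W s\<close>.\<close>

lemma chk_all_less:
  assumes "chk B (\<lambda>W s. P W (s 0) (\<lambda>i. s (Suc i)))" "chkf B k"
  shows "chk B (\<lambda>W s. \<forall>n<k W s. P W n s)"
proof -
  have "chk B (\<lambda>W s. P W (s 0) (\<lambda>i. s (i + 3)))"
    by (rule chk_renameI[OF assms(1), of _ "case_nat 0 (\<lambda>i. i + 3)"]) simp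
  from chk_chain[of B "\<lambda>W n y z s. P W n s", OF this assms(2) chkf_reg[of B 0] chkf_reg[of B 0]]
  have "chk B (\<lambda>W s. \<exists>y. y 0 = s 0 \<and> y (k W s) = s 0 \<and> (\<forall>n<k W s. P W n s))" .
  then show ?thesis
    by (rule chk_cong) (auto intro: exI[of _ "\<lambda>_. _"])
qed

text \<open>The intermediate values of the recursion form a chain, and the links determine it
  uniquely.\<close>

lemma chkf_rec_nat:
  assumes "chkf B (\<lambda>W s. g W (s 0) (s 1) (\<lambda>i. s (i + 2)))" "chkf B a" "chkf B k"
  shows "chkf B (\<lambda>W s. rec_nat (a W s) (\<lambda>n y. g W n y s) (k W s))"
proof (rule chkfI)
  have "chk B (\<lambda>W s. g W (s 0) (s 1) (\<lambda>i. s (Suc i + 3)) = s 2)"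
    using chk_graph[OF assms(1), of "\<lambda>c. if c < 2 then c else c + 2" 2] by (simp add: numeral_eq_Suc)
  from chk_chain[where R = "\<lambda>W n y z s. g W n y (\<lambda>i. s (Suc i)) = z",
      OF this chkf_rename[OF assms(3), of Suc] chkf_rename[OF assms(2), of Suc] chkf_reg[of B 0]]
  show "chk B (\<lambda>W s. \<exists>y. y 0 = a W (\<lambda>i. s (Suc i)) \<and> y (k W (\<lambda>i. s (Suc i))) = s 0 \<and>
      (\<forall>n<k W (\<lambda>i. s (Suc i)). g W n (y n) (\<lambda>i. s (Suc i)) = y (Suc n)))" .
  show "rec_nat (a W s) (\<lambda>n y. g W n y s) (k W s) = m \<longleftrightarrow>
      (\<exists>y. y 0 = a W s \<and> y (k W s) = m \<and> (\<forall>n<k W s. g W n (y n) s = y (Suc n)))" for W s m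
  proof
    assume m: "rec_nat (a W s) (\<lambda>n y. g W n y s) (k W s) = m"
    show "\<exists>y. y 0 = a W s \<and> y (k W s) = m \<and> (\<forall>n<k W s. g W n (y n) s = y (Suc n))"
      by (rule exI[of _ "rec_nat (a W s) (\<lambda>n y. g W n y s)"]) (simp add: m)
  next
    assume "\<exists>y. y 0 = a W s \<and> y (k W s) = m \<and> (\<forall>n<k W s. g W n (y n) s = y (Suc n))"
    then obtain y where y: "y 0 = a W s" "y (k W s) = m" "\<forall>n<k W s. g W n (y n) s = y (Suc n)"
      by blast
    have "j \<le> k W s \<Longrightarrow> rec_nat (a W s) (\<lambda>n y. g W n y s) j = y j" for j
      by (induction j) (use y in auto)
    then show "rec_nat (a W s) (\<lambda>n y. g W n y s) (k W s) = m"
      using y(2) by simp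
  qed
qed

section \<open>Arithmetic and pairing\<close>

lemma chkf_0: "chkf B (\<lambda>W s. 0)"
  unfolding chkf_def using chk_rename_option[OF chk_eq_regs[of B 0 1], of "case_nat None (\<lambda>i. Some (i - 1))"]
  by (rule chk_cong) (auto simp: apply_upd_def)

lemma halts_Seq_Inc: "halts W (Seq (Atm (Inc c)) p) s \<longleftrightarrow> halts W p (s(c := Suc (s c)))"
  by (simp only: halts_def runs_Seq_Inc)

lemma chkf_Suc:
  assumes "chkf B f"
  shows "chkf B (\<lambda>W s. Suc (f W s))"
proof -
  have "chk B (\<lambda>W s. Suc (s 0) = s 1)"
    by (rule chkI[of 2 "Seq (Atm (Inc 0)) (Atm (Eqt 0 1))"])
      (simp_all only: halts_Seq_Inc, auto simp: halts_def)
  then have "chkf B (\<lambda>W s. Suc (s 0))"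
    unfolding chkf_def by (rule chk_renameI[where f = "\<lambda>i. if i = 0 then 1 else 0"]) simp
  then have "chk B (\<lambda>W s. Suc (s 0) = s 1)"
    by (rule chk_graph[where g = "\<lambda>i. i"])
  then show ?thesis
    unfolding chkf_def
    using chk_subst[of B "\<lambda>W n s. Suc n = s 0" "\<lambda>W s. f W (\<lambda>i. s (Suc i))"] chkf_rename[OF assms]
    by simp
qed

lemma chkf_const: "chkf B (\<lambda>W s. n)"
  by (induction n) (auto intro: chkf_0 chkf_Suc)

lemma chkf_plus:
  assumes "chkf B f" "chkf B g"
  shows "chkf B (\<lambda>W s. f W s + g W s)"
proof -
  have "chkf B (\<lambda>W s. rec_nat (f W s) (\<lambda>n y. Suc y) (g W s))"
    by (rule chkf_rec_nat[where g = "\<lambda>W n y s. Suc y"]) (intro chkf_Suc chkf_reg assms)+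
  moreover have "rec_nat a (\<lambda>n y. Suc y) b = a + b" for a b
    by (induction b) auto
  ultimately show ?thesis by (simp only:)
qed

lemma chkf_times:
  assumes "chkf B f" "chkf B g"
  shows "chkf B (\<lambda>W s. f W s * g W s)"
proof -
  have "chkf B (\<lambda>W s. rec_nat 0 (\<lambda>n y. y + f W s) (g W s))"
    by (rule chkf_rec_nat[where g = "\<lambda>W n y s. y + f W s"]) (intro chkf_plus chkf_0 chkf_reg assms(2) chkf_rename[OF assms(1), of "\<lambda>i. i + 2"])+
  moreover have "rec_nat 0 (\<lambda>n y. y + a) b = a * b" for a b :: nat
    by (induction b) auto
  ultimately show ?thesis by (simp only:)
qed

lemma chkf_prod_encode:
  assumes "chkf B f" "chkf B g"
  shows "chkf B (\<lambda>W s. prod_encode (f W s, g W s))"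
proof -
  have "chkf B (\<lambda>W s. rec_nat 0 (\<lambda>n y. y + Suc n) (f W s + g W s))"
    by (rule chkf_rec_nat[where g = "\<lambda>W n y s. y + Suc n"]) (intro chkf_plus chkf_Suc chkf_0 chkf_reg assms)+
  moreover have "rec_nat 0 (\<lambda>n y. y + Suc n) k = triangle k" for k
    by (induction k) auto
  ultimately have "chkf B (\<lambda>W s. triangle (f W s + g W s))"
    by (simp only:)
  then have "chkf B (\<lambda>W s. triangle (f W s + g W s) + f W s)"
    by (rule chkf_plus[OF _ assms(1)])
  then show ?thesis
    by (simp only: prod_encode_def prod.case)
qed

text \<open>The inverse of a checkable function is checked by guessing the missing
  component.\<close>

lemma chkf_fst_prod_decode:
  assumes "chkf B f"
  shows "chkf B (\<lambda>W s. fst (prod_decode (f W s)))"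
proof (rule chkfI)
  show "chk B (\<lambda>W s. \<exists>b. prod_encode (s 0, b) = f W (\<lambda>i. s (Suc i)))"
    by (intro chk_ex chk_eq chkf_prod_encode chkf_reg
        chkf_rename[OF assms, of "\<lambda>i. Suc (Suc i)"])
  show "fst (prod_decode (f W s)) = n \<longleftrightarrow> (\<exists>b. prod_encode (n, b) = f W s)" for W s n
    by (metis fst_conv prod.collapse prod_decode_inverse prod_encode_inverse)
qed

lemma chkf_snd_prod_decode:
  assumes "chkf B f"
  shows "chkf B (\<lambda>W s. snd (prod_decode (f W s)))"
proof (rule chkfI)
  show "chk B (\<lambda>W s. \<exists>b. prod_encode (b, s 0) = f W (\<lambda>i. s (Suc i)))"
    by (intro chk_ex chk_eq chkf_prod_encode chkf_reg
        chkf_rename[OF assms, of "\<lambda>i. Suc (Suc i)"])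
  show "snd (prod_decode (f W s)) = n \<longleftrightarrow> (\<exists>b. prod_encode (b, n) = f W s)" for W s n
    by (metis snd_conv prod.collapse prod_decode_inverse prod_encode_inverse)
qed

lemma chk_less:
  assumes "chkf B f" "chkf B g"
  shows "chk B (\<lambda>W s. f W s < g W s)"
proof -
  have "chk B (\<lambda>W s. \<exists>d. f W s + Suc d = g W s)"
    by (intro chk_ex chk_eq chkf_plus chkf_Suc chkf_reg chkf_rename[OF assms(1), of Suc]
        chkf_rename[OF assms(2), of Suc])
  then show ?thesis
    by (rule chk_cong) (simp add: less_iff_Suc_add eq_commute)
qed

lemma chk_not_less:
  assumes "chkf B f" "chkf B g"
  shows "chk B (\<lambda>W s. \<not> f W s < g W s)"
proof -
  have "chk B (\<lambda>W s. g W s < Suc (f W s))"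
    by (intro chk_less chkf_Suc assms)
  then show ?thesis
    by (rule chk_cong) auto
qed

lemma chk_neq: "chkf B f \<Longrightarrow> chkf B g \<Longrightarrow> chk B (\<lambda>W s. f W s \<noteq> g W s)"
  unfolding neq_iff by (intro chk_disj chk_less)

text \<open>The loop sets the input to the current counter, checks it and raises the counter. It can
  be repeated forever exactly when the check succeeds for every \<open>m\<close>; this is the only
  source of an unbounded universal quantifier.\<close>

theorem chk_buchi_recognizable:
  assumes A: "alphabet A" and K: "finite K" and P: "chk (A \<times> Pow K) (\<lambda>W s. P W (s 0))"
  shows "buchi_recognizable A {pic \<in> pictures A. \<exists>Y. (\<forall>i. Y i \<subseteq> K) \<and>
    (\<forall>m. P (\<lambda>i. (the (pic (Suc i, 1)), Y i)) m)}"
proof -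
  obtain p N where dec: "decides (A \<times> Pow K) (\<lambda>W s. P W (s 0)) p N" and N: "1 \<le> N"
    using chkE[OF P] by blast
  \<comment> \<open>Register \<open>N\<close> is the counter, beyond the reach of \<open>p\<close>;
    all registers below it are overwritten, which erases what the previous round left there.\<close>
  define load where "load c = (if c < N then Some N else Some c)" for c
  define loop where "loop = Seq (upd load) (Seq p (Atm (Inc N)))"
  have "bound (Suc N) loop"
    using bound_mono[OF decides_bound[OF dec], of "Suc N"] by (auto simp: loop_def load_def split: if_splits)
  note rec = loop_buchi_recognizable[OF A _ this, of "A \<times> Pow K" fst]
  have loop: "runs W loop s t \<longleftrightarrow> (\<exists>u. runs W p (apply_upd load s) u \<and> t = u(N := Suc (u N)))" for W s t
    unfolding loop_def runs_Seq_upd unfolding runs.simps(2) relcompp_apply by simp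
  have load: "apply_upd load s 0 = s N" "apply_upd load s N = s N" for s
    using N by (simp_all add: apply_upd_def load_def)
  have loop_D: "P W (s N)" "t N = Suc (s N)" if W: "range W \<subseteq> A \<times> Pow K" and run: "runs W loop s t" for W s t
  proof -
    obtain u where u: "runs W p (apply_upd load s) u" "t = u(N := Suc (u N))"
      using run loop by blast
    show "P W (s N)"
      using decides_iff[OF dec W, of "apply_upd load s"] u(1) by (auto simp: halts_def load)
    show "t N = Suc (s N)"
      using runs_frame[OF decides_bound[OF dec] u(1), of N] u(2) by (simp add: load)
  qed
  have loop_I: "\<exists>t. runs W loop s t" if "range W \<subseteq> A \<times> Pow K" "P W (s N)" for W s
    using decides_iff[OF dec that(1), of "apply_upd load s"] that(2)
    unfolding loop by (auto simp: halts_def load)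
  have iff: "(\<exists>Y. (\<forall>i. Y i \<subseteq> K) \<and> (\<forall>m. P (\<lambda>i. (the (pic (Suc i, 1)), Y i)) m)) \<longleftrightarrow>
      (\<exists>W x a s. (\<forall>i. W i \<in> A \<times> Pow K \<and> pic (Suc i, 1) = Some (fst (W i))) \<and>
        s 0 = (\<lambda>_. 0) \<and> loop_run W loop x a s)" (is "?L \<longleftrightarrow> ?R") if pic: "pic \<in> pictures A" for pic
  proof
    assume ?L
    then obtain Y where Y: "\<And>i. Y i \<subseteq> K" and m: "\<And>m. P (\<lambda>i. (the (pic (Suc i, 1)), Y i)) m"
      by blast
    define W where "W i = (the (pic (Suc i, 1)), Y i)" for i
    have "pic (Suc i, 1) \<in> Some ` A" for i
      using pic by (simp add: pictures_def)
    then have W: "W i \<in> A \<times> Pow K \<and> pic (Suc i, 1) = Some (fst (W i))" for i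
      using Y[of i] unfolding W_def by (metis PowI SigmaI fst_conv imageE option.sel)
    have "\<exists>u. \<forall>n. ((n = 0 \<longrightarrow> u n = (\<lambda>_. 0)) \<and> u n N = n) \<and> runs W loop (u n) (u (Suc n))"
    proof (rule dependent_nat_choice)
      show "\<exists>u. ((0::nat) = 0 \<longrightarrow> u = (\<lambda>_. 0)) \<and> u N = 0"
        by (intro exI[of _ "\<lambda>_. 0"]) simp
      show "\<exists>v. ((Suc n = 0 \<longrightarrow> v = (\<lambda>_. 0)) \<and> v N = Suc n) \<and> runs W loop u v"
        if "(n = 0 \<longrightarrow> u = (\<lambda>_. 0)) \<and> u N = n" for u n
      proof -
        have "range W \<subseteq> A \<times> Pow K"
          using W by blast
        moreover have "P W (u N)"
          using m unfolding W_def .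
        ultimately show ?thesis
          using loop_I[of W u] loop_D(2)[of W u] that by auto
      qed
    qed
    then obtain u where u: "\<forall>n. ((n = 0 \<longrightarrow> u n = (\<lambda>_. 0)) \<and> u n N = n) \<and> runs W loop (u n) (u (Suc n))" ..
    obtain x a s where "loop_run W loop x a s" "s 0 = u 0"
      by (rule chain_imp_loop_run[of W loop u]) (use u in auto)
    with W u show ?R
      by (intro exI[of _ W] exI[of _ x] exI[of _ a] exI[of _ s]) auto
  next
    assume ?R
    then obtain W x a s where W: "\<And>i. W i \<in> A \<times> Pow K" "\<And>i. pic (Suc i, 1) = Some (fst (W i))"
      and s: "s 0 = (\<lambda>_. 0)" and run: "loop_run W loop x a s"
      by blast
    obtain u where u: "u 0 = s 0" "\<And>n::nat. runs W loop (u n) (u (Suc n))"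
      by (rule loop_run_imp_chain[OF run]) (rule that)
    have rW: "range W \<subseteq> A \<times> Pow K"
      using W(1) by blast
    have "u n N = n" for n
      by (induction n) (use u(1) s loop_D(2)[OF rW u(2)] in auto)
    then have "P W m" for m
      using loop_D(1)[OF rW u(2), of m] by simp
    moreover have "W = (\<lambda>i. (the (pic (Suc i, 1)), snd (W i)))"
      using W(2) by (simp add: fun_eq_iff prod_eq_iff)
    ultimately have "P (\<lambda>i. (the (pic (Suc i, 1)), snd (W i))) m" for m
      by simp
    moreover have "snd (W i) \<subseteq> K" for i
      using W(1)[of i] by (auto simp: mem_Times_iff)
    ultimately show ?L
      by (intro exI[of _ "\<lambda>i. snd (W i)"]) simp
  qed
  have "finite (A \<times> Pow K)"
    using A K by (simp add: alphabet_def)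
  from rec[OF this zero_less_Suc] show ?thesis
    by (simp only: iff cong: conj_cong)
qed

section \<open>Analytic sets as first rows of recognizable languages\<close>

lemma sat_Ex2s:
  "sat \<sigma> e V (foldr Ex2 Xs \<phi>) \<longleftrightarrow> (\<exists>V'. (\<forall>X. X \<notin> set Xs \<longrightarrow> V' X = V X) \<and> sat \<sigma> e V' \<phi>)"
proof (induction Xs arbitrary: V)
  case Nil
  have "(\<forall>X. V' X = V X) \<longleftrightarrow> V' = V" for V'
    by auto
  then show ?case by simp
next
  case (Cons X Xs)
  show ?case
  proof
    assume "sat \<sigma> e V (foldr Ex2 (X # Xs) \<phi>)"
    then obtain M V' where "\<forall>Y. Y \<notin> set Xs \<longrightarrow> V' Y = (V(X := M)) Y" "sat \<sigma> e V' \<phi>"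
      by (auto simp: Cons.IH)
    then show "\<exists>V'. (\<forall>Y. Y \<notin> set (X # Xs) \<longrightarrow> V' Y = V Y) \<and> sat \<sigma> e V' \<phi>"
      by (intro exI[of _ V']) simp
  next
    assume "\<exists>V'. (\<forall>Y. Y \<notin> set (X # Xs) \<longrightarrow> V' Y = V Y) \<and> sat \<sigma> e V' \<phi>"
    then obtain V' where V': "\<forall>Y. Y \<notin> set (X # Xs) \<longrightarrow> V' Y = V Y" "sat \<sigma> e V' \<phi>"
      by blast
    have "sat \<sigma> e (V(X := V' X)) (foldr Ex2 Xs \<phi>)"
      unfolding Cons.IH using V' by (intro exI[of _ V']) simp
    then show "sat \<sigma> e V (foldr Ex2 (X # Xs) \<phi>)"
      by auto
  qed
qed

lemma existential_prenex: "existential \<phi> \<Longrightarrow> \<exists>Xs \<psi>. \<phi> = foldr Ex2 Xs \<psi> \<and> arithmetical \<psi>"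
proof (induction rule: existential.induct)
  case (1 \<phi>)
  then show ?case
    by (intro exI[of _ "[]"]) simp
next
  case (2 \<phi> X)
  then obtain Xs \<psi> where "\<phi> = foldr Ex2 Xs \<psi>" "arithmetical \<psi>"
    by blast
  then show ?case
    by (intro exI[of _ "X # Xs"] exI[of _ \<psi>]) simp
qed

text \<open>A number codes the assignment whose values are obtained by repeatedly splitting off a pair.\<close>

primrec env :: "nat \<Rightarrow> nat \<Rightarrow> nat" where
  "env m 0 = fst (prod_decode m)"
| "env m (Suc x) = env (snd (prod_decode m)) x"

primrec env_upd :: "nat \<Rightarrow> nat \<Rightarrow> nat \<Rightarrow> nat" where
  "env_upd m 0 n = prod_encode (n, snd (prod_decode m))"
| "env_upd m (Suc x) n = prod_encode (fst (prod_decode m), env_upd (snd (prod_decode m)) x n)"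

lemma env_env_upd: "env (env_upd m x n) = (env m)(x := n)"
proof
  show "env (env_upd m x n) y = ((env m)(x := n)) y" for y
  proof (induction x arbitrary: m y)
    case 0
    then show ?case by (cases y) simp_all
  next
    case (Suc x)
    then show ?case by (cases y) simp_all
  qed
qed

lemma env_0: "env 0 = (\<lambda>_. 0)"
proof
  have "prod_decode 0 = (0, 0)"
    by (simp add: prod_decode_def prod_decode_aux.simps)
  then show "env 0 x = 0" for x
    by (induction x) simp_all
qed

lemma chkf_env: "chkf B f \<Longrightarrow> chkf B (\<lambda>W s. env (f W s) x)"
  by (induction x arbitrary: f) (simp_all add: chkf_fst_prod_decode chkf_snd_prod_decode)

lemma chkf_env_upd: "chkf B f \<Longrightarrow> chkf B g \<Longrightarrow> chkf B (\<lambda>W s. env_upd (f W s) x (g W s))"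
  by (induction x arbitrary: f)
    (simp_all add: chkf_fst_prod_decode chkf_snd_prod_decode chkf_prod_encode)

lemma chk_bex_finite:
  assumes "finite A" "\<And>a. a \<in> A \<Longrightarrow> chk B (P a)"
  shows "chk B (\<lambda>W s. \<exists>a\<in>A. P a W s)"
  using assms
proof (induction A rule: finite_induct)
  case empty
  show ?case by (simp add: chk_const)
next
  case (insert a A)
  have "chk B (\<lambda>W s. P a W s \<or> (\<exists>a\<in>A. P a W s))"
    by (rule chk_disj) (use insert in auto)
  then show ?case by simp
qed

text \<open>A symbol can only be tested by fixed predicates; its letter becomes a number through a
  finite case distinction over \<open>A\<close>.\<close>

lemma chkf_letter:
  assumes "finite A" "chkf (A \<times> C) f"
  shows "chkf (A \<times> C) (\<lambda>W s. fst (W (f W s)))"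
proof (rule chkfI)
  show "chk (A \<times> C) (\<lambda>W s. \<exists>a\<in>A. fst (W (f W (\<lambda>i. s (Suc i)))) = a \<and> a = s 0)"
  proof (rule chk_bex_finite[OF assms(1)])
    show "chk (A \<times> C) (\<lambda>W s. fst (W (f W (\<lambda>i. s (Suc i)))) = a \<and> a = s 0)" for a
      by (intro chk_conj chk_eq chkf_const chkf_reg chkf_rename[OF assms(2)]
          chk_sym[where P = "\<lambda>b. fst b = a"])
  qed
  show "fst (W (f W s)) = n \<longleftrightarrow> (\<exists>a\<in>A. fst (W (f W s)) = a \<and> a = n)"
    if "range W \<subseteq> A \<times> C" for W s n
  proof -
    have "W (f W s) \<in> A \<times> C"
      using that by blast
    then show ?thesis by auto
  qed
qed

lemma chkf_trm_val:
  assumes "finite A" "chkf (A \<times> C) f"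
  shows "chkf (A \<times> C) (\<lambda>W s. trm_val (\<lambda>i. fst (W i)) (env (f W s)) t)"
  by (induction t)
    (simp_all add: chkf_0 chkf_Suc chkf_plus chkf_times chkf_env chkf_letter assms)

lemma chk_iff:
  assumes "chk B P" "chk B (\<lambda>W s. \<not> P W s)" "chk B Q" "chk B (\<lambda>W s. \<not> Q W s)"
  shows "chk B (\<lambda>W s. P W s \<longleftrightarrow> Q W s)"
proof -
  have "chk B (\<lambda>W s. P W s \<and> Q W s \<or> \<not> P W s \<and> \<not> Q W s)"
    by (intro chk_disj chk_conj assms)
  then show ?thesis
    by (rule chk_cong) blast
qed

lemma chk_imp:
  assumes "chk B (\<lambda>W s. \<not> P W s)" "chk B Q"
  shows "chk B (\<lambda>W s. P W s \<longrightarrow> Q W s)"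
  using chk_disj[OF assms] by (rule chk_cong) blast

section \<open>Truth tables as tracks of a colouring\<close>

type_synonym truth_world = "nat \<Rightarrow> nat \<times> (fm + nat) set"

text \<open>The position \<open>m\<close> is the code of an assignment here, whereas in
  \<open>member\<close> it is the number whose membership in a set variable is recorded.\<close>

definition holds :: "truth_world \<Rightarrow> fm \<Rightarrow> nat \<Rightarrow> bool"
  where "holds W \<phi> m \<longleftrightarrow> Inl \<phi> \<in> snd (W m)"

definition member :: "truth_world \<Rightarrow> nat \<Rightarrow> nat \<Rightarrow> bool"
  where "member W X m \<longleftrightarrow> Inr X \<in> snd (W m)"

abbreviation val :: "truth_world \<Rightarrow> nat \<Rightarrow> trm \<Rightarrow> nat"
  where "val W m \<equiv> trm_val (\<lambda>i. fst (W i)) (env m)"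

text \<open>
  The instance \<open>(m, n)\<close> of the conditions saying that the tracks \<^term>\<open>Inl \<psi>\<close> of \<open>W\<close> are the truth
  tables of the formulas \<open>\<psi>\<close>: \<open>m\<close> codes an assignment, \<open>n\<close> is a candidate for a quantified variable.
\<close>

primrec truth_ok :: "truth_world \<Rightarrow> nat \<Rightarrow> nat \<Rightarrow> fm \<Rightarrow> bool" where
  "truth_ok W m n (Eq s t) \<longleftrightarrow> (holds W (Eq s t) m \<longleftrightarrow> val W m s = val W m t)"
| "truth_ok W m n (Less s t) \<longleftrightarrow> (holds W (Less s t) m \<longleftrightarrow> val W m s < val W m t)"
| "truth_ok W m n (Mem t X) \<longleftrightarrow> (holds W (Mem t X) m \<longleftrightarrow> member W X (val W m t))"
| "truth_ok W m n (Neg \<phi>) \<longleftrightarrow> (holds W (Neg \<phi>) m \<longleftrightarrow> \<not> holds W \<phi> m) \<and> truth_ok W m n \<phi>"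
| "truth_ok W m n (Conj \<phi> \<psi>) \<longleftrightarrow> (holds W (Conj \<phi> \<psi>) m \<longleftrightarrow> holds W \<phi> m \<and> holds W \<psi> m) \<and>
    truth_ok W m n \<phi> \<and> truth_ok W m n \<psi>"
| "truth_ok W m n (Ex1 x \<phi>) \<longleftrightarrow> (holds W (Ex1 x \<phi>) m \<longrightarrow> (\<exists>k. holds W \<phi> (env_upd m x k))) \<and>
    (holds W \<phi> (env_upd m x n) \<longrightarrow> holds W (Ex1 x \<phi>) m) \<and> truth_ok W m n \<phi>"
| "truth_ok W m n (Ex2 X \<phi>) \<longleftrightarrow> True"
| "truth_ok W m n (All2 X \<phi>) \<longleftrightarrow> True"

primrec subformulas :: "fm \<Rightarrow> fm set" where
  "subformulas (Eq s t) = {Eq s t}"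
| "subformulas (Less s t) = {Less s t}"
| "subformulas (Mem t X) = {Mem t X}"
| "subformulas (Neg \<phi>) = insert (Neg \<phi>) (subformulas \<phi>)"
| "subformulas (Conj \<phi> \<psi>) = insert (Conj \<phi> \<psi>) (subformulas \<phi> \<union> subformulas \<psi>)"
| "subformulas (Ex1 x \<phi>) = insert (Ex1 x \<phi>) (subformulas \<phi>)"
| "subformulas (Ex2 X \<phi>) = insert (Ex2 X \<phi>) (subformulas \<phi>)"
| "subformulas (All2 X \<phi>) = insert (All2 X \<phi>) (subformulas \<phi>)"

lemma finite_subformulas: "finite (subformulas \<phi>)"
  by (induction \<phi>) simp_all

lemma self_subformula: "\<phi> \<in> subformulas \<phi>"
  by (cases \<phi>) simp_all

abbreviation world_sat :: "truth_world \<Rightarrow> nat \<Rightarrow> fm \<Rightarrow> bool"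
  where "world_sat W m \<equiv> sat (\<lambda>i. fst (W i)) (env m) (\<lambda>X. {i. member W X i})"

text \<open>A single instance tests only one candidate \<open>n\<close> for an existential
  quantifier; all \<open>n\<close> together give the missing implication. Since quantifiers change
  the assignment, the induction needs the conditions at every \<open>m\<close>.\<close>

lemma truth_ok_imp_holds_iff_sat:
  "arithmetical \<phi> \<Longrightarrow> (\<And>m n. truth_ok W m n \<phi>) \<Longrightarrow> holds W \<phi> m \<longleftrightarrow> world_sat W m \<phi>"
proof (induction \<phi> arbitrary: m)
  case (Ex1 x \<phi>)
  have ok: "truth_ok W m n (Ex1 x \<phi>)" for m n
    by (rule Ex1.prems)
  have "holds W \<phi> m \<longleftrightarrow> world_sat W m \<phi>" for m
    by (rule Ex1.IH) (use Ex1.prems(1) ok in auto)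
  moreover have "holds W (Ex1 x \<phi>) m \<longleftrightarrow> (\<exists>k. holds W \<phi> (env_upd m x k))"
    using ok by auto
  ultimately show ?case
    by (simp add: env_env_upd)
qed auto

lemma holds_iff_sat_imp_truth_ok:
  assumes "arithmetical \<phi>" "\<And>\<psi> m. \<psi> \<in> subformulas \<phi> \<Longrightarrow> holds W \<psi> m \<longleftrightarrow> world_sat W m \<psi>"
  shows "truth_ok W m n \<phi>"
  using assms
proof (induction \<phi>)
  case (Ex1 x \<phi>)
  have "holds W \<phi> m \<longleftrightarrow> world_sat W m \<phi>" for m
    using Ex1.prems self_subformula by simp
  moreover have "truth_ok W m n \<phi>"
    using Ex1 by simp
  moreover have "holds W (Ex1 x \<phi>) m \<longleftrightarrow> (\<exists>k. world_sat W (env_upd m x k) \<phi>)"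
    using Ex1.prems by (simp add: env_env_upd)
  ultimately show ?case by auto
qed (use self_subformula in auto)

text \<open>A symbol test accepts any predicate, so entries of the table can be checked in both
  polarities. The biconditionals of \<open>truth_ok\<close> are thereby checkable despite the
  missing closure under negation.\<close>

lemma chk_truth_ok:
  assumes A: "finite A" and f: "chkf (A \<times> C) f" and g: "chkf (A \<times> C) g"
  shows "chk (A \<times> C) (\<lambda>W s. truth_ok W (f W s) (g W s) \<phi>)"
proof -
  have h: "chk (A \<times> C) (\<lambda>W s. holds W \<psi> (h W s))" "chk (A \<times> C) (\<lambda>W s. \<not> holds W \<psi> (h W s))"
    "chk (A \<times> C) (\<lambda>W s. member W X (h W s))" "chk (A \<times> C) (\<lambda>W s. \<not> member W X (h W s))"
    if "chkf (A \<times> C) h" for \<psi> X h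
    unfolding holds_def member_def
    by (rule chk_sym[OF that, where P = "\<lambda>b. Inl \<psi> \<in> snd b"]
        chk_sym[OF that, where P = "\<lambda>b. Inl \<psi> \<notin> snd b"]
        chk_sym[OF that, where P = "\<lambda>b. Inr X \<in> snd b"]
        chk_sym[OF that, where P = "\<lambda>b. Inr X \<notin> snd b"])+
  note val = chkf_trm_val[OF A f]
  show ?thesis
  proof (induction \<phi>)
    case (Eq s t)
    show ?case
      unfolding truth_ok.simps by (intro chk_iff h f chk_eq chk_neq val)
  next
    case (Less s t)
    show ?case
      unfolding truth_ok.simps by (intro chk_iff h f chk_less chk_not_less val)
  next
    case (Mem t X)
    show ?case
      unfolding truth_ok.simps by (intro chk_iff h f val)
  next
    case (Neg \<phi>)
    then show ?case
      unfolding truth_ok.simps by (intro chk_conj chk_iff) (simp_all add: h f)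
  next
    case (Conj \<phi> \<psi>)
    have "chk (A \<times> C) (\<lambda>W s. \<not> holds W \<phi> (f W s) \<or> \<not> holds W \<psi> (f W s))"
      by (intro chk_disj h f)
    then have "chk (A \<times> C) (\<lambda>W s. \<not> (holds W \<phi> (f W s) \<and> holds W \<psi> (f W s)))"
      by (rule chk_cong) blast
    with Conj show ?case
      unfolding truth_ok.simps by (intro chk_conj chk_iff h f)
  next
    case (Ex1 x \<phi>)
    then show ?case
      unfolding truth_ok.simps
      by (intro chk_conj chk_imp chk_ex h f g chkf_env_upd chkf_reg chkf_rename[OF f, of Suc])
  qed (simp_all add: chk_const)
qed

section \<open>Continuous maps between words and pictures\<close>

lemma topspace_picture_space: "topspace (picture_space A) = pictures A"
proof -
  have "p v \<in> hat A" if "p \<in> pictures A" for p v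
    using that unfolding pictures_def hat_def by (cases v; cases "fst v = 0 \<or> snd v = 0") auto
  then show ?thesis
    unfolding picture_space_def by auto
qed

lemma topspace_words: "topspace (words A) = {\<sigma>. range \<sigma> \<subseteq> A}"
  by (auto simp: words_def PiE_iff)

lemma continuous_map_into_words:
  "continuous_map X (words A) f \<longleftrightarrow> (\<forall>i. continuous_map X (discrete_topology A) (\<lambda>x. f x i))"
  by (simp add: words_def continuous_map_componentwise_UNIV)

lemma continuous_map_word_letter: "continuous_map (words A) (discrete_topology A) (\<lambda>\<sigma>. \<sigma> i)"
  unfolding words_def by (rule continuous_map_product_projection) simp

lemma continuous_map_picture_letter:
  "continuous_map (picture_space A) (discrete_topology (hat A)) (\<lambda>p. p v)"
  unfolding picture_space_def
  by (rule continuous_map_from_subtopology, rule continuous_map_product_projection) simp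

text \<open>\<open>g\<close> says which cell carries a given position of the word;
  \<open>Suc\<close> skips the border. \<open>read_picture\<close> inverts
  \<open>fill_picture h\<close> on the left when \<open>h\<close> inverts \<open>g\<close> on the
  left, and on the right when \<open>g\<close> inverts \<open>h\<close> on the left.\<close>

definition read_picture ::
    "(nat \<Rightarrow> nat \<times> nat) \<Rightarrow> (nat \<times> nat \<Rightarrow> nat option) \<Rightarrow> nat \<Rightarrow> nat"
  where "read_picture g p n = the (p (Suc (fst (g n)), Suc (snd (g n))))"

definition fill_picture ::
    "(nat \<times> nat \<Rightarrow> nat) \<Rightarrow> (nat \<Rightarrow> nat) \<Rightarrow> nat \<times> nat \<Rightarrow> nat option"
  where "fill_picture h \<sigma> = (\<lambda>(i, j). if i = 0 \<or> j = 0 then None else Some (\<sigma> (h (i - 1, j - 1))))"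

lemma inner_letter: "p \<in> pictures A \<Longrightarrow> p (Suc i, Suc j) \<in> Some ` A"
  by (simp add: pictures_def)

lemma continuous_map_read_picture: "continuous_map (picture_space A) (words A) (read_picture g)"
  unfolding continuous_map_into_words
proof
  fix n
  define v where "v = (Suc (fst (g n)), Suc (snd (g n)))"
  have r: "read_picture g p n = the (p v)" for p
    by (simp add: read_picture_def v_def)
  have v: "p v \<in> Some ` A" if "p \<in> pictures A" for p
    unfolding v_def using that by (rule inner_letter)
  have "(\<lambda>p. read_picture g p n) \<in> topspace (picture_space A) \<rightarrow> A"
    unfolding r topspace_picture_space using v by force
  moreover have "openin (picture_space A) {p \<in> topspace (picture_space A). read_picture g p n \<in> U}"
    if "U \<subseteq> A" for U
  proof -
    have "{p \<in> topspace (picture_space A). read_picture g p n \<in> U} =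
        {p \<in> topspace (picture_space A). p v \<in> Some ` U}"
      unfolding topspace_picture_space r using v by force
    moreover have "Some ` U \<subseteq> hat A"
      unfolding hat_def using that by blast
    then have "openin (picture_space A) {p \<in> topspace (picture_space A). p v \<in> Some ` U}"
      by (intro openin_continuous_map_preimage[OF continuous_map_picture_letter]) simp
    ultimately show ?thesis by simp
  qed
  ultimately show "continuous_map (picture_space A) (discrete_topology A) (\<lambda>p. read_picture g p n)"
    by (simp add: continuous_map_def)
qed

lemma continuous_map_fill_picture: "continuous_map (words A) (picture_space A) (fill_picture h)"
  unfolding picture_space_def continuous_map_in_subtopology continuous_map_componentwise_UNIV
proof (intro conjI allI)
  fix v :: "nat \<times> nat"
  obtain i j where v: "v = (i, j)" by (cases v)
  show "continuous_map (words A) (discrete_topology (hat A)) (\<lambda>\<sigma>. fill_picture h \<sigma> v)"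
  proof (cases "i = 0 \<or> j = 0")
    case True
    then show ?thesis
      by (simp add: fill_picture_def v hat_def)
  next
    case False
    have "continuous_map (discrete_topology A) (discrete_topology (hat A)) Some"
      by (auto simp: continuous_map_def hat_def)
    from continuous_map_compose[OF continuous_map_word_letter[of A "h (i - 1, j - 1)"] this] False show ?thesis
      by (simp add: fill_picture_def v o_def)
  qed
qed (auto simp: fill_picture_def pictures_def topspace_words image_subset_iff intro!: imageI)

lemma fill_picture_in_pictures: "\<sigma> \<in> topspace (words A) \<Longrightarrow> fill_picture h \<sigma> \<in> pictures A"
  using continuous_map_fill_picture[of A h] by (auto simp: continuous_map_def topspace_picture_space)

lemma read_picture_in_words: "p \<in> pictures A \<Longrightarrow> read_picture g p \<in> topspace (words A)"
  using continuous_map_read_picture[of A g] by (auto simp: continuous_map_def topspace_picture_space)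

lemma read_fill_picture: "(\<And>n. h (g n) = n) \<Longrightarrow> read_picture g (fill_picture h \<sigma>) = \<sigma>"
  by (simp add: read_picture_def fill_picture_def fun_eq_iff)

lemma fill_read_picture:
  assumes "\<And>v. g (h v) = v" "p \<in> pictures A"
  shows "fill_picture h (read_picture g p) = p"
proof
  fix v :: "nat \<times> nat"
  obtain i j where v: "v = (i, j)" by (cases v)
  show "fill_picture h (read_picture g p) v = p v"
  proof (cases "i = 0 \<or> j = 0")
    case True
    then show ?thesis
      using assms(2) by (auto simp: v fill_picture_def pictures_def)
  next
    case False
    then obtain i' j' where ij: "i = Suc i'" "j = Suc j'"
      using not0_implies_Suc by blast
    show ?thesis
      using inner_letter[OF assms(2), of i' j'] by (auto simp: v ij fill_picture_def read_picture_def assms(1))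
  qed
qed

text \<open>Filling and reading are the two reductions. For the first row, \<open>h = fst\<close>
  repeats the word in every row, and the language ignores all rows but the first.\<close>

lemma read_picture_wadge_equiv:
  assumes S: "S \<subseteq> topspace (words A)" and hg: "\<And>n. h (g n) = n"
  shows "wadge_equiv (words A) S (picture_space A) {p \<in> pictures A. read_picture g p \<in> S}"
proof -
  have "S = {\<sigma> \<in> topspace (words A). fill_picture h \<sigma> \<in> {p \<in> pictures A. read_picture g p \<in> S}}"
    using S read_fill_picture[of h g, OF hg] fill_picture_in_pictures by auto
  then have "reduces (words A) S (picture_space A) {p \<in> pictures A. read_picture g p \<in> S}"
    unfolding reduces_def using continuous_map_fill_picture by blast
  moreover have "reduces (picture_space A) {p \<in> pictures A. read_picture g p \<in> S} (words A) S"
    unfolding reduces_def topspace_picture_space using continuous_map_read_picture by blast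
  ultimately show ?thesis
    using S by (auto simp: wadge_equiv_def topspace_picture_space)
qed

lemma fill_picture_wadge_equiv:
  assumes L: "L \<subseteq> pictures A" and gh: "\<And>v. g (h v) = v"
  shows "wadge_equiv (picture_space A) L (words A) {\<sigma> \<in> topspace (words A). fill_picture h \<sigma> \<in> L}"
proof -
  have "L = {p \<in> topspace (picture_space A).
      read_picture g p \<in> {\<sigma> \<in> topspace (words A). fill_picture h \<sigma> \<in> L}}"
    using L fill_read_picture[of g h, OF gh] read_picture_in_words
    by (auto simp: topspace_picture_space)
  then have "reduces (picture_space A) L (words A) {\<sigma> \<in> topspace (words A). fill_picture h \<sigma> \<in> L}"
    unfolding reduces_def using continuous_map_read_picture by blast
  moreover have "reduces (words A) {\<sigma> \<in> topspace (words A). fill_picture h \<sigma> \<in> L} (picture_space A) L"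
    unfolding reduces_def using continuous_map_fill_picture by blast
  ultimately show ?thesis
    using L by (auto simp: wadge_equiv_def topspace_picture_space)
qed

abbreviation first_row :: "(nat \<times> nat \<Rightarrow> nat option) \<Rightarrow> nat \<Rightarrow> nat"
  where "first_row \<equiv> read_picture (\<lambda>i. (i, 0))"

lemmas first_row_def = read_picture_def[of "\<lambda>i. (i, 0)", simplified]

lemmas first_row_wadge_equiv = read_picture_wadge_equiv[where g = "\<lambda>i. (i, 0)" and h = fst, simplified]

theorem Sigma11_first_row_buchi_recognizable:
  assumes A: "alphabet A" and "existential \<phi>"
  shows "buchi_recognizable A {p \<in> pictures A. first_row p \<in> defined_set A \<phi>}"
proof -
  obtain Xs \<psi> where \<phi>: "\<phi> = foldr Ex2 Xs \<psi>" and \<psi>: "arithmetical \<psi>"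
    using existential_prenex[OF assms(2)] by blast
  note iff = sat_Ex2s[where \<phi> = \<psi> and Xs = Xs, folded \<phi>]
  \<comment> \<open>One track for the truth table of each subformula and one for each quantified set
    variable.\<close>
  define K where "K = Inl ` subformulas \<psi> \<union> Inr ` set Xs"
  have K: "finite K"
    by (simp add: K_def finite_subformulas)
  have finA: "finite A"
    using A by (simp add: alphabet_def)
  \<comment> \<open>\<open>m\<close> codes a pair of an assignment and a candidate. The formula
    itself is required at code 0, the zero assignment used in \<open>defined_set\<close>.\<close>
  define P where "P W m \<longleftrightarrow> truth_ok W (fst (prod_decode m)) (snd (prod_decode m)) \<psi> \<and> holds W \<psi> 0" for W m
  have "chk (A \<times> Pow K) (\<lambda>W s. truth_ok W (fst (prod_decode (s 0))) (snd (prod_decode (s 0))) \<psi>)"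
    by (intro chk_truth_ok finA chkf_fst_prod_decode chkf_snd_prod_decode chkf_reg)
  moreover have "chk (A \<times> Pow K) (\<lambda>W s. holds W \<psi> 0)"
    unfolding holds_def by (rule chk_sym[OF chkf_0, where P = "\<lambda>b. Inl \<psi> \<in> snd b"])
  ultimately have "chk (A \<times> Pow K) (\<lambda>W s. P W (s 0))"
    unfolding P_def by (rule chk_conj)
  note rec = chk_buchi_recognizable[OF A K this]
  have L_iff: "first_row p \<in> defined_set A \<phi> \<longleftrightarrow>
      (\<exists>Y. (\<forall>i. Y i \<subseteq> K) \<and> (\<forall>m. P (\<lambda>i. (the (p (Suc i, 1)), Y i)) m))"
    (is "?L \<longleftrightarrow> ?R") if p: "p \<in> pictures A" for p
  proof
    assume ?L
    then obtain V where V: "\<forall>X. X \<notin> set Xs \<longrightarrow> V X = {}" and sat: "sat (first_row p) (\<lambda>_. 0) V \<psi>"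
      using iff unfolding defined_set_def by auto
    define Y where "Y i = {Inl \<theta> | \<theta>. \<theta> \<in> subformulas \<psi> \<and> sat (first_row p) (env i) V \<theta>} \<union>
      {Inr X | X. i \<in> V X}" for i
    have YK: "Y i \<subseteq> K" for i
      using V by (auto simp: Y_def K_def)
    define W where "W i = (the (p (Suc i, 1)), Y i)" for i
    have fstW: "(\<lambda>i. fst (W i)) = first_row p"
      by (simp add: W_def first_row_def fun_eq_iff)
    have memW: "(\<lambda>X. {i. member W X i}) = V"
      by (auto simp: member_def W_def Y_def fun_eq_iff)
    have holdsW: "holds W \<theta> m \<longleftrightarrow> world_sat W m \<theta>" if "\<theta> \<in> subformulas \<psi>" for \<theta> m
      unfolding fstW memW using that by (auto simp: holds_def W_def Y_def)
    have "P W m" for m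
      using holds_iff_sat_imp_truth_ok[OF \<psi> holdsW] holdsW[OF self_subformula, of 0] sat
      unfolding P_def fstW memW env_0 by blast
    then show ?R
      using YK unfolding W_def by blast
  next
    assume ?R
    then obtain Y where YK: "\<And>i. Y i \<subseteq> K" and P: "\<And>m. P (\<lambda>i. (the (p (Suc i, 1)), Y i)) m"
      by blast
    define W where "W i = (the (p (Suc i, 1)), Y i)" for i
    have fstW: "(\<lambda>i. fst (W i)) = first_row p"
      by (simp add: W_def first_row_def fun_eq_iff)
    have PW: "P W m" for m
      unfolding W_def by (rule P)
    have ok: "truth_ok W m n \<psi>" for m n
      using PW[of "prod_encode (m, n)"] by (simp add: P_def)
    have "holds W \<psi> 0"
      using PW[of 0] by (simp add: P_def)
    then have "world_sat W 0 \<psi>"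
      using truth_ok_imp_holds_iff_sat[OF \<psi> ok] by blast
    then have sat: "sat (first_row p) (\<lambda>_. 0) (\<lambda>X. {i. member W X i}) \<psi>"
      by (simp only: fstW env_0)
    \<comment> \<open>Variables outside the prefix have no track and so denote the empty set, the
      default in \<open>defined_set\<close>.\<close>
    have "{i. member W X i} = {}" if "X \<notin> set Xs" for X
    proof -
      have "Inr X \<notin> Y i" for i
        using YK[of i] that by (auto simp: K_def)
      then show ?thesis
        by (simp add: member_def W_def)
    qed
    then have "sat (first_row p) (\<lambda>_. 0) (\<lambda>_. {}) \<phi>"
      unfolding iff using sat by (intro exI[of _ "\<lambda>X. {i. member W X i}"]) simp
    then show ?L
      using read_picture_in_words[OF p] by (simp add: defined_set_def)
  qed
  from rec show ?thesis
    by (simp only: L_iff cong: conj_cong)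
qed

section \<open>Recognizable languages are lightface analytic\<close>

definition Or :: "fm \<Rightarrow> fm \<Rightarrow> fm"
  where "Or \<phi> \<psi> = Neg (Conj (Neg \<phi>) (Neg \<psi>))"

definition All1 :: "nat \<Rightarrow> fm \<Rightarrow> fm"
  where "All1 x \<phi> = Neg (Ex1 x (Neg \<phi>))"

primrec Ors :: "fm list \<Rightarrow> fm" where
  "Ors [] = Neg (Eq Zero Zero)"
| "Ors (\<phi> # \<phi>s) = Or \<phi> (Ors \<phi>s)"

primrec Ands :: "fm list \<Rightarrow> fm" where
  "Ands [] = Eq Zero Zero"
| "Ands (\<phi> # \<phi>s) = Conj \<phi> (Ands \<phi>s)"

primrec num :: "nat \<Rightarrow> trm" where
  "num 0 = Zero"
| "num (Suc n) = Succ (num n)"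

lemma sat_Or [simp]: "sat \<sigma> e V (Or \<phi> \<psi>) \<longleftrightarrow> sat \<sigma> e V \<phi> \<or> sat \<sigma> e V \<psi>"
  by (simp add: Or_def)

lemma sat_All1 [simp]: "sat \<sigma> e V (All1 x \<phi>) \<longleftrightarrow> (\<forall>n. sat \<sigma> (e(x := n)) V \<phi>)"
  by (simp add: All1_def)

lemma sat_Ors [simp]: "sat \<sigma> e V (Ors \<phi>s) \<longleftrightarrow> (\<exists>\<phi>\<in>set \<phi>s. sat \<sigma> e V \<phi>)"
  by (induction \<phi>s) auto

lemma sat_Ands [simp]: "sat \<sigma> e V (Ands \<phi>s) \<longleftrightarrow> (\<forall>\<phi>\<in>set \<phi>s. sat \<sigma> e V \<phi>)"
  by (induction \<phi>s) auto

lemma trm_val_num [simp]: "trm_val \<sigma> e (num n) = n"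
  by (induction n) auto

lemma trm_vars_num [simp]: "trm_vars (num n) = {}"
  by (induction n) auto

lemma free_vars_connectives [simp]:
  "free_number_vars (Or \<phi> \<psi>) = free_number_vars \<phi> \<union> free_number_vars \<psi>"
  "free_number_vars (All1 x \<phi>) = free_number_vars \<phi> - {x}"
  "free_number_vars (Ors \<phi>s) = (\<Union>\<phi>\<in>set \<phi>s. free_number_vars \<phi>)"
  "free_number_vars (Ands \<phi>s) = (\<Union>\<phi>\<in>set \<phi>s. free_number_vars \<phi>)"
  "free_set_vars (Or \<phi> \<psi>) = free_set_vars \<phi> \<union> free_set_vars \<psi>"
  "free_set_vars (All1 x \<phi>) = free_set_vars \<phi>"
  "free_set_vars (Ors \<phi>s) = (\<Union>\<phi>\<in>set \<phi>s. free_set_vars \<phi>)"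
  "free_set_vars (Ands \<phi>s) = (\<Union>\<phi>\<in>set \<phi>s. free_set_vars \<phi>)"
  by (simp_all add: Or_def All1_def) (induction \<phi>s; simp add: Or_def)+

lemma arithmetical_connectives [simp]:
  "arithmetical (Or \<phi> \<psi>) \<longleftrightarrow> arithmetical \<phi> \<and> arithmetical \<psi>"
  "arithmetical (All1 x \<phi>) \<longleftrightarrow> arithmetical \<phi>"
  "arithmetical (Ors \<phi>s) \<longleftrightarrow> (\<forall>\<phi>\<in>set \<phi>s. arithmetical \<phi>)"
  "arithmetical (Ands \<phi>s) \<longleftrightarrow> (\<forall>\<phi>\<in>set \<phi>s. arithmetical \<phi>)"
  by (simp_all add: Or_def All1_def) (induction \<phi>s; simp add: Or_def)+

lemma trm_val_cong: "(\<And>x. x \<in> trm_vars t \<Longrightarrow> e x = e' x) \<Longrightarrow> trm_val \<sigma> e t = trm_val \<sigma> e' t"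
  by (induction t) auto

lemma free_vars_Ex2s [simp]:
  "free_number_vars (foldr Ex2 Xs \<phi>) = free_number_vars \<phi>"
  "free_set_vars (foldr Ex2 Xs \<phi>) = free_set_vars \<phi> - set Xs"
  by (induction Xs) auto

lemma existential_Ex2s: "arithmetical \<phi> \<Longrightarrow> existential (foldr Ex2 Xs \<phi>)"
  by (induction Xs) (auto intro: existential.intros)

text \<open>
  Sets of cells may be coded by any injective pairing that is a term; the letters of a picture need
  the bijection \<^const>\<open>prod_encode\<close>, which is only definable.
\<close>

definition pos :: "nat \<Rightarrow> nat \<Rightarrow> nat"
  where "pos i j = (i + j) * (i + j) + i"

lemma pos_inject: "pos i j = pos i' j' \<longleftrightarrow> i = i' \<and> j = j'"
proof
  have less: "pos i j < pos i' j'" if "i + j < i' + j'" for i j i' j'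
  proof -
    have "pos i j < Suc (i + j) * Suc (i + j)"
      by (simp add: pos_def)
    also have "\<dots> \<le> (i' + j') * (i' + j')"
      using that by (intro mult_le_mono) auto
    also have "\<dots> \<le> pos i' j'"
      by (simp add: pos_def)
    finally show ?thesis .
  qed
  assume eq: "pos i j = pos i' j'"
  then have "i + j = i' + j'"
    using less[of i j i' j'] less[of i' j' i j] by (cases "i + j" "i' + j'" rule: linorder_cases) auto
  with eq show "i = i' \<and> j = j'"
    by (simp add: pos_def)
qed simp

definition Pos :: "trm \<Rightarrow> trm \<Rightarrow> trm"
  where "Pos s t = Plus (Times (Plus s t) (Plus s t)) s"

lemma trm_val_Pos [simp]: "trm_val \<sigma> e (Pos s t) = pos (trm_val \<sigma> e s) (trm_val \<sigma> e t)"
  by (simp add: Pos_def pos_def)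

lemma trm_vars_Pos [simp]: "trm_vars (Pos s t) = trm_vars s \<union> trm_vars t"
  by (auto simp: Pos_def)

text \<open>The equation for variable 4 is the definition of \<open>prod_encode\<close> multiplied
  by 2, which avoids the division in the triangular number. Binding only variables 2, 3 and 4 avoids
  capture, as \<open>s\<close> and \<open>t\<close> will use 0 and 1.\<close>

fun Letter_fm :: "nat option \<Rightarrow> trm \<Rightarrow> trm \<Rightarrow> fm" where
  "Letter_fm None s t = Or (Eq s Zero) (Eq t Zero)"
| "Letter_fm (Some a) s t = Ex1 2 (Ex1 3 (Ex1 4 (Ands
    [Eq s (Succ (Var 2)), Eq t (Succ (Var 3)),
     Eq (Plus (Var 4) (Var 4))
       (Plus (Times (Plus (Var 2) (Var 3)) (Succ (Plus (Var 2) (Var 3)))) (Plus (Var 2) (Var 2))),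
     Eq (Letter (Var 4)) (num a)])))"

lemma prod_encode_eq_iff: "c = prod_encode (x, y) \<longleftrightarrow> c + c = (x + y) * Suc (x + y) + (x + x)"
proof -
  have "2 * triangle k = k * Suc k" for k
    by (induction k) auto
  from this[of "x + y"] show ?thesis
    unfolding prod_encode_def by auto
qed

lemma sat_Letter_fm:
  assumes "trm_vars s \<subseteq> {0, 1}" "trm_vars t \<subseteq> {0, 1}"
  shows "sat \<sigma> e V (Letter_fm l s t) \<longleftrightarrow>
    fill_picture prod_encode \<sigma> (trm_val \<sigma> e s, trm_val \<sigma> e t) = l"
proof (cases l)
  case None
  then show ?thesis
    by (simp add: fill_picture_def)
next
  case (Some a)
  have v: "trm_val \<sigma> (e(2 := x, 3 := y, 4 := c)) s = trm_val \<sigma> e s"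
    "trm_val \<sigma> (e(2 := x, 3 := y, 4 := c)) t = trm_val \<sigma> e t" for x y c
    using assms by (auto intro!: trm_val_cong)
  have "sat \<sigma> e V (Letter_fm l s t) \<longleftrightarrow> (\<exists>x y c. trm_val \<sigma> e s = Suc x \<and> trm_val \<sigma> e t = Suc y \<and>
      c = prod_encode (x, y) \<and> \<sigma> c = a)"
    unfolding Some prod_encode_eq_iff by (simp add: v)
  also have "\<dots> \<longleftrightarrow> fill_picture prod_encode \<sigma> (trm_val \<sigma> e s, trm_val \<sigma> e t) = l"
    unfolding Some fill_picture_def by (cases "trm_val \<sigma> e s"; cases "trm_val \<sigma> e t") auto
  finally show ?thesis .
qed

text \<open>A state is a number, so it also serves as the name of the set variable for the cells in
  that state.\<close>

definition Cell_fm :: "cell \<Rightarrow> trm \<Rightarrow> trm \<Rightarrow> fm"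
  where "Cell_fm c s t = Conj (Letter_fm (fst c) s t) (Mem (Pos s t) (snd c))"

definition Tile_fm :: "tile \<Rightarrow> fm"
  where "Tile_fm = (\<lambda>(c01, c11, c00, c10). Ands
    [Cell_fm c01 (Var 0) (Succ (Var 1)), Cell_fm c11 (Succ (Var 0)) (Succ (Var 1)),
     Cell_fm c00 (Var 0) (Var 1), Cell_fm c10 (Succ (Var 0)) (Var 1)])"

definition State_fm :: "nat list \<Rightarrow> fm"
  where "State_fm qs = Ors (map (\<lambda>q. Conj (Mem (Pos (Var 0) (Var 1)) q)
    (Ands (map (\<lambda>r. Neg (Mem (Pos (Var 0) (Var 1)) r)) (filter (\<lambda>r. r \<noteq> q) qs)))) qs)"

definition Matrix_fm :: "nat list \<Rightarrow> tile list \<Rightarrow> nat list \<Rightarrow> fm"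
  where "Matrix_fm qs ts fs = Conj
    (All1 0 (All1 1 (Conj (State_fm qs) (Ors (map Tile_fm ts)))))
    (All1 2 (Ex1 0 (Ex1 1 (Conj (Less (Var 2) (Plus (Var 0) (Var 1)))
      (Ors (map (Mem (Pos (Var 0) (Var 1))) fs))))))"

definition cell_ok :: "(nat \<Rightarrow> nat) \<Rightarrow> (nat \<Rightarrow> nat set) \<Rightarrow> cell \<Rightarrow> nat \<Rightarrow> nat \<Rightarrow> bool"
  where "cell_ok \<sigma> V c i j \<longleftrightarrow> fill_picture prod_encode \<sigma> (i, j) = fst c \<and> pos i j \<in> V (snd c)"

lemma sat_Cell_fm:
  assumes "trm_vars s \<subseteq> {0, 1}" "trm_vars t \<subseteq> {0, 1}"
  shows "sat \<sigma> e V (Cell_fm c s t) \<longleftrightarrow> cell_ok \<sigma> V c (trm_val \<sigma> e s) (trm_val \<sigma> e t)"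
  by (simp add: Cell_fm_def cell_ok_def sat_Letter_fm[OF assms])

lemma sat_Tile_fm:
  "sat \<sigma> e V (Tile_fm (c01, c11, c00, c10)) \<longleftrightarrow> cell_ok \<sigma> V c01 (e 0) (Suc (e 1)) \<and>
    cell_ok \<sigma> V c11 (Suc (e 0)) (Suc (e 1)) \<and> cell_ok \<sigma> V c00 (e 0) (e 1) \<and> cell_ok \<sigma> V c10 (Suc (e 0)) (e 1)"
  by (simp add: Tile_fm_def sat_Cell_fm)

lemma sat_Tile_fms:
  "sat \<sigma> e V (Ors (map Tile_fm ts)) \<longleftrightarrow>
    (\<exists>(c01, c11, c00, c10)\<in>set ts. cell_ok \<sigma> V c01 (e 0) (Suc (e 1)) \<and> cell_ok \<sigma> V c11 (Suc (e 0)) (Suc (e 1)) \<and>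
      cell_ok \<sigma> V c00 (e 0) (e 1) \<and> cell_ok \<sigma> V c10 (Suc (e 0)) (e 1))"
  by (auto simp: sat_Tile_fm split_beta intro!: bexI)

lemma sat_State_fm:
  "sat \<sigma> e V (State_fm qs) \<longleftrightarrow>
    (\<exists>q\<in>set qs. pos (e 0) (e 1) \<in> V q \<and> (\<forall>r\<in>set qs. r \<noteq> q \<longrightarrow> pos (e 0) (e 1) \<notin> V r))"
  by (auto simp: State_fm_def)

lemma sat_Mems: "sat \<sigma> e V (Ors (map (Mem t) fs)) \<longleftrightarrow> (\<exists>q\<in>set fs. trm_val \<sigma> e t \<in> V q)"
  by simp

lemma sat_Matrix_fm:
  "sat \<sigma> e V (Matrix_fm qs ts fs) \<longleftrightarrow>
    (\<forall>i j. (\<exists>q\<in>set qs. pos i j \<in> V q \<and> (\<forall>r\<in>set qs. r \<noteq> q \<longrightarrow> pos i j \<notin> V r)) \<and>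
      (\<exists>(c01, c11, c00, c10)\<in>set ts. cell_ok \<sigma> V c01 i (Suc j) \<and> cell_ok \<sigma> V c11 (Suc i) (Suc j) \<and>
        cell_ok \<sigma> V c00 i j \<and> cell_ok \<sigma> V c10 (Suc i) j)) \<and>
    (\<forall>n. \<exists>i j. n < i + j \<and> (\<exists>q\<in>set fs. pos i j \<in> V q))"
  unfolding Matrix_fm_def by (simp del: sat_Ors add: sat_Tile_fms sat_State_fm sat_Mems)

text \<open>Makes the Buchi condition first order: any bound on \<open>i + j\<close> leaves only
  finitely many cells.\<close>

lemma infinite_grid_iff: "infinite (S :: (nat \<times> nat) set) \<longleftrightarrow> (\<forall>n. \<exists>i j. n < i + j \<and> (i, j) \<in> S)"
proof
  assume inf: "infinite S"
  show "\<forall>n. \<exists>i j. n < i + j \<and> (i, j) \<in> S"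
  proof (rule ccontr)
    assume "\<not> ?thesis"
    then obtain n where "\<forall>i j. (i, j) \<in> S \<longrightarrow> i + j \<le> n"
      by (meson not_less)
    then have "S \<subseteq> {..n} \<times> {..n}"
      by fastforce
    with inf show False
      using finite_subset by blast
  qed
next
  assume unb: "\<forall>n. \<exists>i j. n < i + j \<and> (i, j) \<in> S"
  show "infinite S"
  proof
    assume "finite S"
    then have "finite ((\<lambda>(i, j). i + j) ` S)"
      by simp
    then obtain n where "\<forall>k\<in>(\<lambda>(i, j). i + j) ` S. k \<le> n"
      by (meson finite_nat_set_iff_bounded_le)
    then have "\<forall>i j. (i, j) \<in> S \<longrightarrow> i + j \<le> n"
      by auto
    moreover obtain i j where "n < i + j" "(i, j) \<in> S"
      using unb by blast
    ultimately show False
      using not_less by blast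
  qed
qed

lemma sentence_Matrix_fm:
  assumes "set fs \<subseteq> set qs" "\<And>c01 c11 c00 c10. (c01, c11, c00, c10) \<in> set ts \<Longrightarrow>
    snd c01 \<in> set qs \<and> snd c11 \<in> set qs \<and> snd c00 \<in> set qs \<and> snd c10 \<in> set qs"
  shows "sentence (foldr Ex2 qs (Matrix_fm qs ts fs))"
proof -
  have l: "free_number_vars (Letter_fm l s t) \<subseteq> {0, 1}" "free_set_vars (Letter_fm l s t) = {}"
    if "trm_vars s \<subseteq> {0, 1}" "trm_vars t \<subseteq> {0, 1}" for l s t
    using that by (cases l; auto)+
  have tile: "free_number_vars (Tile_fm tile) \<subseteq> {0, 1}" for tile
    unfolding Tile_fm_def Cell_fm_def using l(1) by (auto simp: split_beta)
  have tile_sets: "free_set_vars (Tile_fm tile) \<subseteq> set qs" if "tile \<in> set ts" for tile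
    using assms(2)[of "fst tile" "fst (snd tile)" "fst (snd (snd tile))" "snd (snd (snd tile))"] that
    unfolding Tile_fm_def Cell_fm_def by (auto simp: split_beta l(2))
  have state: "free_number_vars (State_fm qs) \<subseteq> {0, 1}" "free_set_vars (State_fm qs) \<subseteq> set qs"
    by (auto simp: State_fm_def)
  have "free_number_vars (Matrix_fm qs ts fs) \<subseteq> {0, 1, 2} - {0} - {1} - {2}"
    unfolding Matrix_fm_def by (auto dest: subsetD[OF tile] subsetD[OF state(1)])
  moreover have "free_set_vars (Matrix_fm qs ts fs) \<subseteq> set qs"
    unfolding Matrix_fm_def
    by (auto dest: subsetD[OF tile_sets] subsetD[OF state(2)] subsetD[OF assms(1)])
  ultimately show ?thesis
    by (auto simp: sentence_def)
qed

lemma arithmetical_Matrix_fm: "arithmetical (Matrix_fm qs ts fs)"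
proof -
  have "arithmetical (Letter_fm l s t)" for l s t
    by (cases l) auto
  then show ?thesis
    by (auto simp: Matrix_fm_def State_fm_def Tile_fm_def Cell_fm_def split_beta)
qed

theorem buchi_recognizable_Sigma11:
  assumes "buchi_recognizable A L"
  shows "\<exists>\<phi>. sentence \<phi> \<and> existential \<phi> \<and>
    defined_set A \<phi> = {\<sigma> \<in> topspace (words A). fill_picture prod_encode \<sigma> \<in> L}"
proof -
  obtain T F where T: "is_tiling_system T" "letters T = A" "F \<subseteq> states T" and L: "L = buchi_language T F"
    using assms by (auto simp: buchi_recognizable_def)
  have fin: "finite (states T)" and tiles_sub: "tiles T \<subseteq> (hat A \<times> states T) \<times> (hat A \<times> states T) \<times>
      (hat A \<times> states T) \<times> (hat A \<times> states T)" and "finite A"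
    using T(1,2) by (simp_all add: is_tiling_system_def alphabet_def Let_def)
  have "finite (hat A)"
    using \<open>finite A\<close> by (simp add: hat_def)
  with fin have "finite (tiles T)"
    by (intro finite_subset[OF tiles_sub] finite_cartesian_product)
  then obtain ts where ts: "set ts = tiles T"
    using finite_list by blast
  obtain qs where qs: "set qs = states T"
    using fin finite_list by blast
  obtain fs where fs: "set fs = F"
    using fin T(3) finite_list finite_subset by metis
  define \<phi> where "\<phi> = foldr Ex2 qs (Matrix_fm qs ts fs)"
  have "sentence \<phi>"
    unfolding \<phi>_def using tiles_sub T(3) by (intro sentence_Matrix_fm) (auto simp: fs qs ts)
  moreover have "existential \<phi>"
    unfolding \<phi>_def by (intro existential_Ex2s arithmetical_Matrix_fm)
  moreover have "sat \<sigma> (\<lambda>_. 0) (\<lambda>_. {}) \<phi> \<longleftrightarrow> fill_picture prod_encode \<sigma> \<in> L"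
    if \<sigma>: "\<sigma> \<in> topspace (words A)" for \<sigma>
  proof -
    let ?p = "fill_picture prod_encode \<sigma>"
    have p: "?p \<in> pictures A"
      by (rule fill_picture_in_pictures[OF \<sigma>])
    show ?thesis
    proof
      assume "sat \<sigma> (\<lambda>_. 0) (\<lambda>_. {}) \<phi>"
      then obtain V where V: "sat \<sigma> (\<lambda>_. 0) V (Matrix_fm qs ts fs)"
        unfolding \<phi>_def sat_Ex2s by blast
      note V = V[unfolded sat_Matrix_fm]
      have "\<exists>q. q \<in> states T \<and> (\<forall>r\<in>states T. pos i j \<in> V r \<longleftrightarrow> r = q)" for i j
        using V[THEN conjunct1, rule_format, of i j] unfolding qs by blast
      then have "\<forall>v. \<exists>q. q \<in> states T \<and> (\<forall>r\<in>states T. pos (fst v) (snd v) \<in> V r \<longleftrightarrow> r = q)"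
        by blast
      then obtain \<rho> where \<rho>: "\<And>v. \<rho> v \<in> states T"
          "\<And>v r. r \<in> states T \<Longrightarrow> pos (fst v) (snd v) \<in> V r \<longleftrightarrow> r = \<rho> v"
        by metis
      have cell: "c = (?p (i, j), \<rho> (i, j))" if "cell_ok \<sigma> V c i j" "snd c \<in> states T" for c i j
        using that \<rho>(2)[of "snd c" "(i, j)"] unfolding cell_ok_def by (metis fst_conv prod.collapse snd_conv)
      have "is_run T ?p \<rho>"
        unfolding is_run_def
      proof (intro conjI allI)
        fix i j
        obtain c01 c11 c00 c10 where t: "(c01, c11, c00, c10) \<in> tiles T"
          and c: "cell_ok \<sigma> V c01 i (Suc j)" "cell_ok \<sigma> V c11 (Suc i) (Suc j)"
            "cell_ok \<sigma> V c00 i j" "cell_ok \<sigma> V c10 (Suc i) j"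
          using V[THEN conjunct1, rule_format, of i j] unfolding ts by blast
        have "snd c01 \<in> states T" "snd c11 \<in> states T" "snd c00 \<in> states T" "snd c10 \<in> states T"
          using t tiles_sub by auto
        then show "((?p (i, j + 1), \<rho> (i, j + 1)), (?p (i + 1, j + 1), \<rho> (i + 1, j + 1)),
            (?p (i, j), \<rho> (i, j)), (?p (i + 1, j), \<rho> (i + 1, j))) \<in> tiles T"
          using t cell[OF c(1)] cell[OF c(2)] cell[OF c(3)] cell[OF c(4)] by simp
      qed (use \<rho>(1) in auto)
      moreover have "infinite {v. \<rho> v \<in> F}"
        unfolding infinite_grid_iff
      proof
        fix n
        obtain i j q where "n < i + j" "q \<in> F" "pos i j \<in> V q"
          using V[THEN conjunct2, rule_format, of n] unfolding fs by blast
        then have "\<rho> (i, j) \<in> F"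
          using \<rho>(2)[of q "(i, j)"] T(3) by auto
        with \<open>n < i + j\<close> show "\<exists>i j. n < i + j \<and> (i, j) \<in> {v. \<rho> v \<in> F}"
          by blast
      qed
      ultimately show "?p \<in> L"
        using p T(2) by (auto simp: L buchi_language_def)
    next
      assume "?p \<in> L"
      then obtain \<rho> where run: "is_run T ?p \<rho>" and inf: "infinite {v. \<rho> v \<in> F}"
        by (auto simp: L buchi_language_def)
      \<comment> \<open>Numbers that are not states get the empty set, so \<open>V\<close> differs
        from the default only on the quantified variables.\<close>
      define V where "V q = (if q \<in> states T then {pos i j | i j. \<rho> (i, j) = q} else {})" for q
      have \<rho>T: "\<rho> v \<in> states T" for v
        using run by (auto simp: is_run_def)
      have posV: "pos i j \<in> V q \<longleftrightarrow> q = \<rho> (i, j)" for i j q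
        using \<rho>T[of "(i, j)"] by (auto simp: V_def pos_inject)
      have cell: "cell_ok \<sigma> V (?p (i, j), \<rho> (i, j)) i j" for i j
        by (simp add: cell_ok_def posV)
      have "sat \<sigma> (\<lambda>_. 0) V (Matrix_fm qs ts fs)"
        unfolding sat_Matrix_fm
      proof (intro conjI allI)
        fix i j
        show "\<exists>q\<in>set qs. pos i j \<in> V q \<and> (\<forall>r\<in>set qs. r \<noteq> q \<longrightarrow> pos i j \<notin> V r)"
          using \<rho>T by (auto simp: posV qs)
        have "((?p (i, j + 1), \<rho> (i, j + 1)), (?p (i + 1, j + 1), \<rho> (i + 1, j + 1)),
            (?p (i, j), \<rho> (i, j)), (?p (i + 1, j), \<rho> (i + 1, j))) \<in> set ts"
          using run unfolding is_run_def ts by blast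
        then show "\<exists>(c01, c11, c00, c10)\<in>set ts. cell_ok \<sigma> V c01 i (Suc j) \<and>
            cell_ok \<sigma> V c11 (Suc i) (Suc j) \<and> cell_ok \<sigma> V c00 i j \<and> cell_ok \<sigma> V c10 (Suc i) j"
          by (rule bexI[rotated]) (simp add: cell)
      next
        fix n
        obtain i j where "n < i + j" "\<rho> (i, j) \<in> F"
          using inf unfolding infinite_grid_iff by blast
        then show "\<exists>i j. n < i + j \<and> (\<exists>q\<in>set fs. pos i j \<in> V q)"
          by (intro exI[of _ i] exI[of _ j]) (simp add: posV fs)
      qed
      moreover have "V X = {}" if "X \<notin> set qs" for X
        using that by (simp add: V_def qs)
      ultimately show "sat \<sigma> (\<lambda>_. 0) (\<lambda>_. {}) \<phi>"
        unfolding \<phi>_def sat_Ex2s by blast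
    qed
  qed
  ultimately show ?thesis
    by (auto simp: defined_set_def)
qed

theorem equal_borel_hierarchies_buchi_Sigma11: "equal_borel_hierarchies buchi_class Sigma11_class"
proof (rule equal_borel_hierarchiesI)
  fix X and L :: "(nat \<times> nat \<Rightarrow> nat option) set"
  assume "(X, L) \<in> buchi_class"
  then obtain A where A: "alphabet A" "X = picture_space A" "buchi_recognizable A L"
    by (auto simp: buchi_class_def)
  then have "L \<subseteq> pictures A"
    by (auto simp: buchi_recognizable_def buchi_language_def)
  then have "wadge_equiv X L (words A) {\<sigma> \<in> topspace (words A). fill_picture prod_encode \<sigma> \<in> L}"
    unfolding A(2) by (rule fill_picture_wadge_equiv) (rule prod_encode_inverse)
  moreover obtain \<phi> where "sentence \<phi>" "existential \<phi>"
      "defined_set A \<phi> = {\<sigma> \<in> topspace (words A). fill_picture prod_encode \<sigma> \<in> L}"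
    using buchi_recognizable_Sigma11[OF A(3)] by blast
  ultimately show "\<exists>(Y, S)\<in>Sigma11_class. wadge_equiv X L Y S"
    using A(1) by (intro bexI[of _ "(words A, defined_set A \<phi>)"]) (auto simp: Sigma11_class_def)
next
  fix X and S :: "(nat \<Rightarrow> nat) set"
  assume "(X, S) \<in> Sigma11_class"
  then obtain A \<phi> where A: "alphabet A" "X = words A" and \<phi>: "existential \<phi>" "S = defined_set A \<phi>"
    by (auto simp: Sigma11_class_def)
  let ?L = "{p \<in> pictures A. first_row p \<in> S}"
  have "(picture_space A, ?L) \<in> buchi_class"
    using A(1) Sigma11_first_row_buchi_recognizable[OF A(1) \<phi>(1)] unfolding buchi_class_def \<phi>(2) by blast
  moreover have "wadge_equiv X S (picture_space A) ?L"
    unfolding A(2) by (rule first_row_wadge_equiv) (auto simp: \<phi>(2) defined_set_def)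
  ultimately show "\<exists>(Y, L)\<in>buchi_class. wadge_equiv X S Y L"
    by blast
qed

section \<open>Complete sets of words\<close>

lemma omega1_zero_le: "(0 :: omega1) \<le> \<alpha>"
  unfolding zero_omega1_def by (rule Least_le) simp

lemma omega1_one_gt_zero: "(0 :: omega1) < 1"
proof -
  have "\<exists>\<alpha> :: omega1. 0 < \<alpha>"
  proof (rule ccontr)
    assume "\<nexists>\<alpha> :: omega1. 0 < \<alpha>"
    then have "(UNIV :: omega1 set) \<subseteq> {0}"
      by (metis omega1_zero_le order_le_less singleton_iff subsetI)
    then have "countable (UNIV :: omega1 set)"
      by (rule countable_subset) simp
    then show False
      using uncountable_UNIV_omega1 by contradiction
  qed
  then show ?thesis
    unfolding one_omega1_def by (rule LeastI_ex)
qed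

lemma omega1_less_one: "\<alpha> < (1 :: omega1) \<longleftrightarrow> \<alpha> = 0"
proof
  assume "\<alpha> < 1"
  then have "\<not> 0 < \<alpha>"
    unfolding one_omega1_def by (rule not_less_Least)
  then show "\<alpha> = 0"
    using omega1_zero_le[of \<alpha>] by auto
qed (simp add: omega1_one_gt_zero)

lemma omega1_one_le: "(1 :: omega1) \<le> \<alpha> \<longleftrightarrow> 0 < \<alpha>"
  using omega1_less_one[of \<alpha>] omega1_zero_le[of \<alpha>] by (auto simp: not_less[symmetric])

section \<open>Clopen sets of words\<close>

definition clopenin :: "'a topology \<Rightarrow> 'a set \<Rightarrow> bool"
  where "clopenin X S \<longleftrightarrow> openin X S \<and> closedin X S"

lemma clopenin_letter: "clopenin (words A) {\<sigma> \<in> topspace (words A). \<sigma> i \<in> U}"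
proof -
  have eq: "{\<sigma> \<in> topspace (words A). \<sigma> i \<in> U} = {\<sigma> \<in> topspace (words A). \<sigma> i \<in> U \<inter> A}"
    by (auto simp: topspace_words)
  show ?thesis
    unfolding clopenin_def eq
    by (intro conjI openin_continuous_map_preimage[OF continuous_map_word_letter]
        closedin_continuous_map_preimage[OF continuous_map_word_letter]) (auto simp: closedin_def)
qed

definition cylinder :: "nat set \<Rightarrow> nat list \<Rightarrow> (nat \<Rightarrow> nat) set"
  where "cylinder A xs = {\<sigma> \<in> topspace (words A). \<forall>i<length xs. \<sigma> i = xs ! i}"

lemma clopenin_cylinder: "clopenin (words A) (cylinder A xs)"
proof (induction xs rule: rev_induct)
  case Nil
  then show ?case by (simp add: cylinder_def clopenin_def)
next
  case (snoc x xs)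
  have "cylinder A (xs @ [x]) = cylinder A xs \<inter> {\<sigma> \<in> topspace (words A). \<sigma> (length xs) \<in> {x}}"
    by (auto simp: cylinder_def nth_append less_Suc_eq)
  then show ?case
    using snoc clopenin_letter[of A "length xs" "{x}"]
    unfolding clopenin_def by (simp only: openin_Int closedin_Int simp_thms)
qed

text \<open>Cylinders form a base and there are only countably many finite words. Enumerating all of
  them, with the empty set for those whose cylinder is not contained in \<open>E\<close>, avoids a
  choice.\<close>

lemma open_words_eq_Union_clopen:
  assumes "openin (words A) E"
  shows "\<exists>C. (\<forall>n::nat. clopenin (words A) (C n)) \<and> E = (\<Union>n. C n)"
proof -
  have "\<exists>xs. \<sigma> \<in> cylinder A xs \<and> cylinder A xs \<subseteq> E" if \<sigma>: "\<sigma> \<in> E" for \<sigma>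
  proof -
    obtain U where U: "finite {i. U i \<noteq> A}" "\<sigma> \<in> Pi\<^sub>E UNIV U" "Pi\<^sub>E UNIV U \<subseteq> E"
      using assms \<sigma> unfolding words_def openin_product_topology_alt by auto
    obtain n where n: "\<And>i. i \<in> {i. U i \<noteq> A} \<Longrightarrow> i < n"
      using U(1) by (meson finite_nat_set_iff_bounded)
    have "\<sigma> \<in> topspace (words A)"
      using assms \<sigma> openin_subset by blast
    then have "\<sigma> \<in> cylinder A (map \<sigma> [0..<n])"
      by (simp add: cylinder_def)
    moreover have "\<tau> \<in> Pi\<^sub>E UNIV U" if \<tau>: "\<tau> \<in> cylinder A (map \<sigma> [0..<n])" for \<tau>
    proof -
      have "\<tau> i \<in> U i" for i
      proof (cases "i < n")
        case True
        then have "\<tau> i = \<sigma> i"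
          using \<tau> by (simp add: cylinder_def)
        then show ?thesis
          using U(2) by (simp add: PiE_iff)
      next
        case False
        then have "U i = A"
          using n by auto
        then show ?thesis
          using \<tau> by (auto simp: cylinder_def topspace_words)
      qed
      then show ?thesis by (simp add: PiE_iff)
    qed
    ultimately show ?thesis
      using U(3) by blast
  qed
  define C where "C n = (let xs = from_nat n in if cylinder A xs \<subseteq> E then cylinder A xs else {})" for n
  have "clopenin (words A) (C n)" for n
    using clopenin_cylinder by (auto simp: C_def Let_def clopenin_def)
  moreover have "E = (\<Union>n. C n)"
  proof
    show "E \<subseteq> (\<Union>n. C n)"
    proof
      fix \<sigma> assume "\<sigma> \<in> E"
      then obtain xs where "\<sigma> \<in> cylinder A xs" "cylinder A xs \<subseteq> E"
        using \<open>\<And>\<sigma>. \<sigma> \<in> E \<Longrightarrow> \<exists>xs. \<sigma> \<in> cylinder A xs \<and> cylinder A xs \<subseteq> E\<close> by blast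
      then have "\<sigma> \<in> C (to_nat xs)"
        by (simp add: C_def)
      then show "\<sigma> \<in> (\<Union>n. C n)" by blast
    qed
    show "(\<Union>n. C n) \<subseteq> E"
      by (auto simp: C_def Let_def split: if_splits)
  qed
  ultimately show ?thesis
    by (intro exI[of _ C]) simp
qed

lemma Pi0_clopen: "clopenin X S \<Longrightarrow> Pi0 X 1 S"
  using Pi0_compl[OF Sigma0_open, of X "topspace X - S"] openin_subset[of X S]
  by (simp add: clopenin_def double_diff closedin_def)

section \<open>Iterated complements and unions yield complete sets\<close>

definition subword :: "nat \<Rightarrow> (nat \<Rightarrow> nat) \<Rightarrow> nat \<Rightarrow> nat"
  where "subword k \<sigma> i = \<sigma> (prod_encode (k, i))"

lemma continuous_map_subword: "continuous_map (words A) (words A) (subword k)"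
  unfolding continuous_map_into_words subword_def using continuous_map_word_letter by blast

text \<open>
  The sets \<open>hset \<beta>\<close> are obtained by iterating complements and countable unions; the ordinals
  below \<open>\<beta>\<close> enter through the indices in \<open>D\<close>, of rank \<open>rk\<close>, by which the subwords are labelled.
\<close>

function hset :: "nat set \<Rightarrow> (nat \<Rightarrow> omega1) \<Rightarrow> omega1 \<Rightarrow> (nat \<Rightarrow> nat) set" where
  "hset D rk \<beta> = {\<sigma>. if \<beta> = 0 then \<sigma> 0 = 0
    else \<exists>n b. if b \<in> D \<and> rk b < \<beta> then subword (prod_encode (n, b)) \<sigma> \<notin> hset D rk (rk b) else False}"
  by auto
termination
proof (relation "inv_image {(\<alpha>, \<beta>). \<alpha> < \<beta>} (\<lambda>(D, rk, \<beta>). \<beta> :: omega1)")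
  show "wf (inv_image {(\<alpha>, \<beta>). \<alpha> < \<beta>} (\<lambda>(D :: nat set, rk :: nat \<Rightarrow> omega1, \<beta> :: omega1). \<beta>))"
    using wf by blast
qed auto

declare hset.simps [simp del]

lemma hset_0: "\<sigma> \<in> hset D rk 0 \<longleftrightarrow> \<sigma> 0 = 0"
  by (simp add: hset.simps[of D rk 0])

lemma hset_pos: "0 < \<beta> \<Longrightarrow> \<sigma> \<in> hset D rk \<beta> \<longleftrightarrow>
    (\<exists>n b. b \<in> D \<and> rk b < \<beta> \<and> subword (prod_encode (n, b)) \<sigma> \<notin> hset D rk (rk b))"
  by (subst hset.simps) auto

lemma Sigma0_hset:
  assumes "0 < \<beta>"
  shows "Sigma0 (words A) \<beta> {\<sigma> \<in> topspace (words A). \<sigma> \<in> hset D rk \<beta>}"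
  using assms
proof (induction \<beta> rule: less_induct)
  case (less \<beta>)
  have zero: "clopenin (words A) {\<sigma> \<in> topspace (words A). subword k \<sigma> \<notin> hset D rk 0}" for k
    using clopenin_letter[of A "prod_encode (k, 0)" "- {0}"] by (simp add: hset_0 subword_def)
  define P where "P m = (if snd (prod_decode m) \<in> D \<and> rk (snd (prod_decode m)) < \<beta>
    then {\<sigma> \<in> topspace (words A). subword m \<sigma> \<notin> hset D rk (rk (snd (prod_decode m)))} else {})" for m
  have eq: "{\<sigma> \<in> topspace (words A). \<sigma> \<in> hset D rk \<beta>} = (\<Union>m. P m)"
  proof (intro set_eqI iffI)
    fix \<sigma> assume \<sigma>: "\<sigma> \<in> {\<sigma> \<in> topspace (words A). \<sigma> \<in> hset D rk \<beta>}"
    then obtain n b where "b \<in> D" "rk b < \<beta>" "subword (prod_encode (n, b)) \<sigma> \<notin> hset D rk (rk b)"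
      using hset_pos[OF less.prems] by blast
    then have "\<sigma> \<in> P (prod_encode (n, b))"
      using \<sigma> by (simp add: P_def)
    then show "\<sigma> \<in> (\<Union>m. P m)" by blast
  next
    fix \<sigma> assume "\<sigma> \<in> (\<Union>m. P m)"
    then obtain m where "\<sigma> \<in> P m" by blast
    moreover have "prod_encode (fst (prod_decode m), snd (prod_decode m)) = m"
      by simp
    ultimately show "\<sigma> \<in> {\<sigma> \<in> topspace (words A). \<sigma> \<in> hset D rk \<beta>}"
      unfolding mem_Collect_eq hset_pos[OF less.prems] P_def
      by (metis (mono_tags, lifting) empty_iff mem_Collect_eq)
  qed
  show ?case
  proof (cases "\<beta> = 1")
    case True
    then have "openin (words A) (P m)" for m
      using zero[of m] by (auto simp: P_def omega1_less_one clopenin_def)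
    then have "Sigma0 (words A) 1 (\<Union>m. P m)"
      by (intro Sigma0_open) auto
    then show ?thesis
      unfolding eq by (simp only: True)
  next
    case False
    \<comment> \<open>Sets of rank 0 and the empty set are clopen; since no Borel class has index 0,
      they enter the union with index 1.\<close>
    define \<gamma> where "\<gamma> m = (if snd (prod_decode m) \<in> D \<and> rk (snd (prod_decode m)) < \<beta> \<and>
      0 < rk (snd (prod_decode m)) then rk (snd (prod_decode m)) else 1)" for m
    have "1 < \<beta>"
      using False less.prems omega1_one_le[of \<beta>] by auto
    moreover have "\<gamma> m < \<beta> \<and> Pi0 (words A) (\<gamma> m) (P m)" for m
    proof (cases "snd (prod_decode m) \<in> D \<and> rk (snd (prod_decode m)) < \<beta>")
      case True
      let ?r = "rk (snd (prod_decode m))"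
      show ?thesis
      proof (cases "?r = 0")
        case r: True
        then have "\<gamma> m = 1"
          by (simp add: \<gamma>_def)
        then show ?thesis
          using True r zero[of m] \<open>1 < \<beta>\<close> by (simp add: P_def Pi0_clopen)
      next
        case False
        then have r: "0 < ?r"
          using omega1_zero_le[of ?r] by auto
        then have "Sigma0 (words A) ?r {\<sigma> \<in> topspace (words A). \<sigma> \<in> hset D rk ?r}"
          using less.IH True by blast
        from Pi0_compl[OF Sigma0_Pi0_preimage(1)[OF continuous_map_subword[of A m] this]]
        have "Pi0 (words A) ?r (topspace (words A) -
          {\<sigma> \<in> topspace (words A). subword m \<sigma> \<in> {\<sigma> \<in> topspace (words A). \<sigma> \<in> hset D rk ?r}})" .
        moreover have "subword m \<sigma> \<in> topspace (words A)" if "\<sigma> \<in> topspace (words A)" for \<sigma>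
          using continuous_map_subword[of A m] that by (auto simp: continuous_map_def)
        then have "topspace (words A) -
          {\<sigma> \<in> topspace (words A). subword m \<sigma> \<in> {\<sigma> \<in> topspace (words A). \<sigma> \<in> hset D rk ?r}} = P m"
          using True by (auto simp: P_def)
        ultimately show ?thesis
          using True r by (simp add: \<gamma>_def)
      qed
    next
      case False
      then have "P m = {}" "\<gamma> m = 1"
        by (auto simp: P_def \<gamma>_def)
      then show ?thesis
        using \<open>1 < \<beta>\<close> by (simp add: Pi0_clopen clopenin_def)
    qed
    ultimately show ?thesis
      unfolding eq by (rule Sigma0_Union)
  qed
qed

text \<open>Each term of a countable union is placed in one subword, under a label of the right
  rank, by the reduction that the induction provides for its complement. All other subwords are
  filled so as to contribute nothing.\<close>

lemma reduces_to_hset: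
  assumes D: "bij_betw rk D {..<\<alpha>}" and "0 < \<beta>" "\<beta> \<le> \<alpha>" and E: "Sigma0 (words A) \<beta> E"
  shows "\<exists>f. continuous_map (words A) (words {0, 1}) f \<and>
    E = {\<sigma> \<in> topspace (words A). f \<sigma> \<in> hset D rk \<beta>}"
  using assms(2-4)
proof (induction \<beta> arbitrary: E rule: less_induct)
  case (less \<beta>)
  have onto: "\<exists>b\<in>D. rk b = \<gamma>" if "\<gamma> < \<alpha>" for \<gamma>
  proof -
    have "\<gamma> \<in> rk ` D"
      using D that by (simp add: bij_betw_def)
    then show ?thesis by blast
  qed
  have subword_mix: "subword k (\<lambda>m. g (fst (prod_decode m)) (snd (prod_decode m))) = g k" for k g
    by (simp add: subword_def fun_eq_iff)
  obtain b0 where b0: "b0 \<in> D" "rk b0 = 0"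
    using onto[of 0] order.strict_trans2[OF less.prems(1,2)] by blast
  show ?case
  proof (cases "\<beta> = 1")
    case True
    then have "openin (words A) E"
      using less.prems(3) by (auto elim: Sigma0.cases)
    then have "\<exists>C. (\<forall>n::nat. clopenin (words A) (C n)) \<and> E = (\<Union>n. C n)"
      by (rule open_words_eq_Union_clopen)
    then obtain C where "(\<forall>n::nat. clopenin (words A) (C n)) \<and> E = (\<Union>n. C n)" ..
    then have C: "\<And>n. clopenin (words A) (C n)" "E = (\<Union>n. C n)"
      by simp_all
    \<comment> \<open>The subword \<open>(n, b0)\<close> is constant 1, thus outside
      \<open>hset D rk 0\<close>, exactly when \<sigma> lies in \<open>C n\<close>. All other
      subwords are constant 0 and contribute nothing.\<close>
    define g :: "(nat \<Rightarrow> nat) \<Rightarrow> nat \<Rightarrow> nat \<Rightarrow> nat" where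
      "g \<sigma> k i = (if snd (prod_decode k) = b0 \<and> \<sigma> \<in> C (fst (prod_decode k)) then 1 else 0)" for \<sigma> k i
    define f where "f \<sigma> m = g \<sigma> (fst (prod_decode m)) (snd (prod_decode m))" for \<sigma> m
    have "continuous_map (words A) (discrete_topology {0, 1}) (\<lambda>\<sigma>. g \<sigma> k i)" for k i
    proof -
      let ?S = "{\<sigma> \<in> topspace (words A). g \<sigma> k i = 1}"
      have S: "clopenin (words A) ?S"
      proof (cases "snd (prod_decode k) = b0")
        case True
        then have "?S = C (fst (prod_decode k))"
          using openin_subset[of "words A" "C (fst (prod_decode k))"] C(1)[of "fst (prod_decode k)"]
          by (auto simp: g_def clopenin_def)
        then show ?thesis
          using C(1)[of "fst (prod_decode k)"] by simp
      qed (simp add: g_def clopenin_def)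
      have "openin (words A) {\<sigma> \<in> topspace (words A). g \<sigma> k i \<in> U}" if "U \<subseteq> {0, 1}" for U
      proof -
        have "{\<sigma> \<in> topspace (words A). g \<sigma> k i \<in> U} =
          (if 1 \<in> U then ?S else {}) \<union> (if 0 \<in> U then topspace (words A) - ?S else {})"
          by (auto simp: g_def)
        then show ?thesis
          using S by (auto simp: clopenin_def closedin_def)
      qed
      then show ?thesis
        by (simp add: continuous_map_def) (simp add: g_def)
    qed
    then have "continuous_map (words A) (words {0, 1}) f"
      unfolding continuous_map_into_words f_def by blast
    moreover have "f \<sigma> \<in> hset D rk \<beta> \<longleftrightarrow> \<sigma> \<in> E" for \<sigma>
    proof -
      have "subword k (f \<sigma>) = g \<sigma> k" for k
        unfolding f_def by (rule subword_mix)
      then have zero: "subword (prod_encode (n, b)) (f \<sigma>) \<notin> hset D rk 0 \<longleftrightarrow> b = b0 \<and> \<sigma> \<in> C n" for n b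
        by (simp add: hset_0 g_def)
      have "f \<sigma> \<in> hset D rk \<beta> \<longleftrightarrow>
          (\<exists>n b. b \<in> D \<and> rk b = 0 \<and> subword (prod_encode (n, b)) (f \<sigma>) \<notin> hset D rk (rk b))"
        unfolding True hset_pos[OF omega1_one_gt_zero] omega1_less_one ..
      also have "\<dots> \<longleftrightarrow> (\<exists>n b. b \<in> D \<and> rk b = 0 \<and> b = b0 \<and> \<sigma> \<in> C n)"
        using zero by (metis (no_types))
      also have "\<dots> \<longleftrightarrow> (\<exists>n. \<sigma> \<in> C n)"
        using b0 by blast
      also have "\<dots> \<longleftrightarrow> \<sigma> \<in> E"
        unfolding C(2) by simp
      finally show ?thesis .
    qed
    moreover have "E \<subseteq> topspace (words A)"
      using less.prems(3) Sigma0_Pi0_subset_topspace(1) by blast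
    ultimately show ?thesis
      by (intro exI[of _ f]) auto
  next
    case False
    then obtain \<gamma> P where P: "E = (\<Union>n::nat. P n)" "\<And>n. \<gamma> n < \<beta>" "\<And>n. Pi0 (words A) (\<gamma> n) (P n)"
      using less.prems(3) by (auto elim!: Sigma0.cases)
    have \<gamma>: "0 < \<gamma> n" "\<gamma> n \<le> \<alpha>" "\<gamma> n < \<alpha>" for n
      using Sigma0_Pi0_ge_1(2)[OF P(3)] omega1_one_le P(2)[of n] less.prems(2) by auto
    have P_sub: "P n \<subseteq> topspace (words A)" for n
      using Sigma0_Pi0_subset_topspace(2)[OF P(3)] .
    then have "Sigma0 (words A) (\<gamma> n) (topspace (words A) - P n)" for n
      using P(3)[of n] by (simp add: Pi0_iff_Sigma0_compl)
    then have "\<forall>n. \<exists>f. continuous_map (words A) (words {0, 1}) f \<and>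
        topspace (words A) - P n = {\<sigma> \<in> topspace (words A). f \<sigma> \<in> hset D rk (\<gamma> n)}"
      using less.IH[OF P(2) \<gamma>(1,2)] by blast
    from choice[OF this] obtain g where "\<forall>n. continuous_map (words A) (words {0, 1}) (g n) \<and>
        topspace (words A) - P n = {\<sigma> \<in> topspace (words A). g n \<sigma> \<in> hset D rk (\<gamma> n)}" ..
    then have g: "\<And>n. continuous_map (words A) (words {0, 1}) (g n)"
      "\<And>n. topspace (words A) - P n = {\<sigma> \<in> topspace (words A). g n \<sigma> \<in> hset D rk (\<gamma> n)}"
      by simp_all
    have "\<forall>n. \<exists>d. d \<in> D \<and> rk d = \<gamma> n"
      using onto \<gamma>(3) by blast
    from choice[OF this] obtain d where "\<forall>n. d n \<in> D \<and> rk (d n) = \<gamma> n" ..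
    then have d: "\<And>n. d n \<in> D" "\<And>n. rk (d n) = \<gamma> n"
      by simp_all
    \<comment> \<open>The neutral filling: a constant word inside the set of rank
      \<open>rk b\<close>. For positive rank the constant 1 works, because its subword at label
      \<open>b0\<close> is again constant 1 and so outside the set of rank 0.\<close>
    define c :: "nat \<Rightarrow> nat" where "c b = (if rk b = 0 then 0 else 1)" for b
    have c: "(\<lambda>_. c b) \<in> hset D rk (rk b)" for b
    proof (cases "rk b = 0")
      case False
      then have "0 < rk b"
        using omega1_zero_le[of "rk b"] by auto
      then show ?thesis
        unfolding hset_pos[OF \<open>0 < rk b\<close>] using b0 False
        by (intro exI[of _ 0] exI[of _ b0]) (simp add: hset_0 c_def subword_def)
    qed (simp add: hset_0 c_def)
    define h where "h \<sigma> k = (if snd (prod_decode k) = d (fst (prod_decode k)) then g (fst (prod_decode k)) \<sigma>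
      else (\<lambda>_. c (snd (prod_decode k))))" for \<sigma> k
    define f where "f \<sigma> m = h \<sigma> (fst (prod_decode m)) (snd (prod_decode m))" for \<sigma> m
    have "continuous_map (words A) (discrete_topology {0, 1}) (\<lambda>\<sigma>. h \<sigma> k i)" for k i
    proof (cases "snd (prod_decode k) = d (fst (prod_decode k))")
      case True
      then show ?thesis
        using g(1)[of "fst (prod_decode k)"] unfolding continuous_map_into_words h_def by simp
    next
      case False
      then show ?thesis
        by (simp add: h_def c_def)
    qed
    then have "continuous_map (words A) (words {0, 1}) f"
      unfolding continuous_map_into_words f_def by blast
    moreover have "f \<sigma> \<in> hset D rk \<beta> \<longleftrightarrow> \<sigma> \<in> E" if \<sigma>: "\<sigma> \<in> topspace (words A)" for \<sigma>
    proof -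
      have sw: "subword k (f \<sigma>) = h \<sigma> k" for k
        unfolding f_def by (rule subword_mix)
      have "f \<sigma> \<in> hset D rk \<beta> \<longleftrightarrow> (\<exists>n b. b \<in> D \<and> rk b < \<beta> \<and> h \<sigma> (prod_encode (n, b)) \<notin> hset D rk (rk b))"
        unfolding hset_pos[OF less.prems(1)] sw ..
      also have "\<dots> \<longleftrightarrow> (\<exists>n. g n \<sigma> \<notin> hset D rk (\<gamma> n))"
      proof
        assume "\<exists>n b. b \<in> D \<and> rk b < \<beta> \<and> h \<sigma> (prod_encode (n, b)) \<notin> hset D rk (rk b)"
        then obtain n b where nb: "h \<sigma> (prod_encode (n, b)) \<notin> hset D rk (rk b)"
          by blast
        then have "b = d n"
          using c[of b] by (auto simp: h_def split: if_splits)
        then show "\<exists>n. g n \<sigma> \<notin> hset D rk (\<gamma> n)"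
          using nb d(2)[of n] by (auto simp: h_def)
      next
        assume "\<exists>n. g n \<sigma> \<notin> hset D rk (\<gamma> n)"
        then obtain n where "g n \<sigma> \<notin> hset D rk (\<gamma> n)" by blast
        then have "h \<sigma> (prod_encode (n, d n)) \<notin> hset D rk (rk (d n))"
          by (simp add: h_def d(2))
        then show "\<exists>n b. b \<in> D \<and> rk b < \<beta> \<and> h \<sigma> (prod_encode (n, b)) \<notin> hset D rk (rk b)"
          using d P(2) by metis
      qed
      also have "\<dots> \<longleftrightarrow> \<sigma> \<in> E"
        using g(2) \<sigma> unfolding P(1) by blast
      finally show ?thesis .
    qed
    moreover have "E \<subseteq> topspace (words A)"
      using P_sub unfolding P(1) by blast
    ultimately show ?thesis
      by (intro exI[of _ f]) auto
  qed
qed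

theorem Sigma0_complete_hset:
  assumes D: "bij_betw rk D {..<\<alpha>}" and \<alpha>: "0 < \<alpha>"
  shows "Sigma0_complete (words {0, 1}) \<alpha> {\<sigma> \<in> topspace (words {0, 1}). \<sigma> \<in> hset D rk \<alpha>}"
  unfolding Sigma0_complete_def complete_for_alt
proof (intro conjI allI impI)
  let ?S = "{\<sigma> \<in> topspace (words {0, 1}). \<sigma> \<in> hset D rk \<alpha>}"
  show "?S \<subseteq> topspace (words {0, 1})"
    by blast
  fix A E assume "alphabet A \<and> E \<subseteq> topspace (words A)"
  show "Sigma0 (words A) \<alpha> E \<longleftrightarrow> reduces (words A) E (words {0, 1}) ?S"
  proof
    assume "Sigma0 (words A) \<alpha> E"
    then obtain f where f: "continuous_map (words A) (words {0, 1}) f"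
        "E = {\<sigma> \<in> topspace (words A). f \<sigma> \<in> hset D rk \<alpha>}"
      using reduces_to_hset[OF D \<alpha> order.refl] by blast
    then have "E = {\<sigma> \<in> topspace (words A). f \<sigma> \<in> ?S}"
      by (auto simp: continuous_map_def)
    with f(1) show "reduces (words A) E (words {0, 1}) ?S"
      unfolding reduces_def by blast
  next
    assume "reduces (words A) E (words {0, 1}) ?S"
    then show "Sigma0 (words A) \<alpha> E"
      using Sigma0_hset[OF \<alpha>] by (rule reduces_Sigma0)
  qed
qed

section \<open>Recursive relations are checkable\<close>

lemma computes_Zer_iff: "computes Zer xs z \<longleftrightarrow> z = 0"
  by (auto elim: computes_ZerE intro: computes.intros)

lemma computes_Scc_iff: "computes Scc xs z \<longleftrightarrow> (\<exists>x. xs = [x] \<and> z = Suc x)"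
  by (auto elim: computes_SccE intro: computes.intros)

lemma computes_Proj_iff: "computes (Proj i) xs z \<longleftrightarrow> i < length xs \<and> z = xs ! i"
  by (auto elim: computes_ProjE intro: computes.intros)

lemma computes_Comp_iff:
  "computes (Comp f gs) xs z \<longleftrightarrow> (\<exists>ys. list_all2 (\<lambda>g. computes g xs) gs ys \<and> computes f ys z)"
  by (auto elim: computes_CompE intro: computes.intros)

lemma computes_Min_iff:
  "computes (Min f) xs n \<longleftrightarrow> computes f (n # xs) 0 \<and> (\<forall>m<n. \<exists>y. computes f (m # xs) (Suc y))"
  by (auto elim: computes_MinE intro: computes.intros)

lemma not_computes_PrimRec_Nil: "\<not> computes (PrimRec f g) [] z"
  by (auto elim: computes_PrimRecE)

text \<open>Brings primitive recursion into the shape of a chain of intermediate values, as wanted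
  by \<open>chk_chain\<close>.\<close>

lemma computes_PrimRec_iff:
  "computes (PrimRec f g) (n # xs) z \<longleftrightarrow>
    (\<exists>y. computes f xs (y 0) \<and> y n = z \<and> (\<forall>m<n. computes g (m # y m # xs) (y (Suc m))))"
proof
  show "computes (PrimRec f g) (n # xs) z \<Longrightarrow>
    \<exists>y. computes f xs (y 0) \<and> y n = z \<and> (\<forall>m<n. computes g (m # y m # xs) (y (Suc m)))"
  proof (induction n arbitrary: z)
    case 0
    then have "computes f xs z"
      by (auto elim: computes_PrimRecE)
    then show ?case
      by (intro exI[of _ "\<lambda>_. z"]) simp
  next
    case (Suc n)
    then obtain u where u: "computes (PrimRec f g) (n # xs) u" "computes g (n # u # xs) z"
      by (auto elim: computes_PrimRecE)
    then obtain y where y: "computes f xs (y 0)" "y n = u" "\<forall>m<n. computes g (m # y m # xs) (y (Suc m))"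
      using Suc.IH by blast
    then show ?case
      using u(2) by (intro exI[of _ "y(Suc n := z)"]) (auto simp: less_Suc_eq)
  qed
next
  assume "\<exists>y. computes f xs (y 0) \<and> y n = z \<and> (\<forall>m<n. computes g (m # y m # xs) (y (Suc m)))"
  then obtain y where y: "computes f xs (y 0)" "y n = z" "\<And>m. m < n \<Longrightarrow> computes g (m # y m # xs) (y (Suc m))"
    by blast
  have "m \<le> n \<Longrightarrow> computes (PrimRec f g) (m # xs) (y m)" for m
  proof (induction m)
    case 0
    show ?case using y(1) by (rule computes.intros)
  next
    case (Suc m)
    have "computes (PrimRec f g) (m # xs) (y m)"
      using Suc by simp
    moreover have "computes g (m # y m # xs) (y (Suc m))"
      using Suc.prems by (intro y(3)) simp
    ultimately show ?case by (rule computes.intros)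
  qed
  then show "computes (PrimRec f g) (n # xs) z"
    using y(2) by blast
qed

text \<open>The arguments of a recursive function are kept as a list of checkable terms rather than
  fixed registers, so that its length is known and subterms can be substituted in the induction on
  \<open>recf\<close>.\<close>

definition term_values :: "((nat \<Rightarrow> 'b) \<Rightarrow> regs \<Rightarrow> nat) list \<Rightarrow> (nat \<Rightarrow> 'b) \<Rightarrow> regs \<Rightarrow> nat list"
  where "term_values ts W s = map (\<lambda>t. t W s) ts"

abbreviation rename :: "(nat \<Rightarrow> nat) \<Rightarrow> ((nat \<Rightarrow> 'b) \<Rightarrow> regs \<Rightarrow> nat) \<Rightarrow> (nat \<Rightarrow> 'b) \<Rightarrow> regs \<Rightarrow> nat"
  where "rename g t \<equiv> (\<lambda>W s. t W (\<lambda>i. s (g i)))"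

lemma term_values_simps [simp]:
  "term_values [] W s = []" "term_values (t # ts) W s = t W s # term_values ts W s"
  "term_values (ts @ us) W s = term_values ts W s @ term_values us W s"
  "term_values (map (rename g) ts) W s = term_values ts W (\<lambda>i. s (g i))"
  by (simp_all add: term_values_def)

lemma list_all_chkf_rename: "list_all (chkf B) ts \<Longrightarrow> list_all (chkf B) (map (rename g) ts)"
  by (induction ts) (auto intro: chkf_rename)

lemma chk_computes:
  assumes "list_all (chkf B) ts" "chkf B z"
  shows "chk B (\<lambda>W s. computes f (term_values ts W s) (z W s))"
  using assms
proof (induction f arbitrary: ts z)
  case Zer
  show ?case
    unfolding computes_Zer_iff by (intro chk_eq Zer chkf_0)
next
  case Scc
  show ?case
  proof (cases "\<exists>t. ts = [t]")
    case True
    then obtain t where t: "ts = [t]" by blast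
    have "chk B (\<lambda>W s. z W s = Suc (t W s))"
      using Scc by (intro chk_eq chkf_Suc) (simp_all add: t)
    then show ?thesis
      by (simp add: computes_Scc_iff t)
  next
    case False
    have "\<not> computes Scc (term_values ts W s) (z W s)" for W s
      using False by (auto simp: computes_Scc_iff term_values_def)
    then show ?thesis
      by (simp add: chk_const)
  qed
next
  case (Proj i)
  show ?case
  proof (cases "i < length ts")
    case True
    then have "chkf B (ts ! i)"
      using Proj(1) by (simp add: list_all_length)
    then have "chk B (\<lambda>W s. z W s = (ts ! i) W s)"
      by (intro chk_eq Proj(2))
    then show ?thesis
      using True by (simp add: computes_Proj_iff term_values_def)
  next
    case False
    then show ?thesis
      by (simp add: computes_Proj_iff term_values_def chk_const)
  qed
next
  case (Comp f gs)
  have f: "chk B (\<lambda>W s. computes f (term_values ts W s) (z W s))" if "list_all (chkf B) ts" "chkf B z" for ts z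
    using Comp.IH(1) that by blast
  have g: "chk B (\<lambda>W s. computes g (term_values ts W s) (z W s))"
    if "g \<in> set gs" "list_all (chkf B) ts" "chkf B z" for g ts z
    using Comp.IH(2) that by blast
  \<comment> \<open>Intermediate results are guessed one at a time: \<open>hs\<close> are the
    functions still to be evaluated, \<open>us\<close> the terms for the results already
    found.\<close>
  have "chk B (\<lambda>W s. \<exists>ys. list_all2 (\<lambda>g. computes g (term_values ts W s)) hs ys \<and>
      computes f (term_values us W s @ ys) (z W s))"
    if "set hs \<subseteq> set gs" "list_all (chkf B) ts" "list_all (chkf B) us" "chkf B z" for hs ts us z
    using that
  proof (induction hs arbitrary: ts us z)
    case Nil
    then show ?case
      using f[of us z] by simp
  next
    case (Cons h hs)
    let ?ts = "map (rename Suc) ts" and ?us = "map (rename Suc) us @ [\<lambda>W s. s 0]"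
    have ts: "list_all (chkf B) ?ts" and us: "list_all (chkf B) ?us"
      using Cons.prems by (simp_all add: list_all_chkf_rename chkf_reg)
    have "chk B (\<lambda>W s. computes h (term_values ?ts W s) (s 0))"
      using g[of h ?ts "\<lambda>W s. s 0"] Cons.prems(1) ts chkf_reg[of B 0] by simp
    moreover have "chk B (\<lambda>W s. \<exists>ys. list_all2 (\<lambda>g. computes g (term_values ?ts W s)) hs ys \<and>
        computes f (term_values ?us W s @ ys) (rename Suc z W s))"
      using Cons.IH[of ?ts ?us "rename Suc z"] Cons.prems(1) ts us chkf_rename[OF Cons.prems(4), of Suc] by simp
    ultimately have "chk B (\<lambda>W s. computes h (term_values ?ts W s) (s 0) \<and>
        (\<exists>ys. list_all2 (\<lambda>g. computes g (term_values ?ts W s)) hs ys \<and>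
        computes f (term_values ?us W s @ ys) (rename Suc z W s)))"
      by (rule chk_conj)
    then have "chk B (\<lambda>W s. computes h (term_values ts W (\<lambda>i. s (Suc i))) (s 0) \<and>
        (\<exists>ys. list_all2 (\<lambda>g. computes g (term_values ts W (\<lambda>i. s (Suc i)))) hs ys \<and>
        computes f (term_values us W (\<lambda>i. s (Suc i)) @ s 0 # ys) (z W (\<lambda>i. s (Suc i)))))"
      by simp
    then have "chk B (\<lambda>W s. \<exists>y. computes h (term_values ts W s) y \<and>
        (\<exists>ys. list_all2 (\<lambda>g. computes g (term_values ts W s)) hs ys \<and>
        computes f (term_values us W s @ y # ys) (z W s)))"
      by (rule chk_ex)
    then show ?case
      by (rule chk_cong) (auto simp: list_all2_Cons1)
  qed
  from this[of gs ts "[]" z] show ?case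
    using Comp.prems by (simp add: computes_Comp_iff)
next
  case (PrimRec f g)
  show ?case
  proof (cases ts)
    case Nil
    then show ?thesis
      by (simp add: not_computes_PrimRec_Nil chk_const)
  next
    case (Cons t us)
    have t: "chkf B t" and us: "list_all (chkf B) us"
      using PrimRec.prems(1) by (simp_all add: Cons)
    \<comment> \<open>Registers 0 to 2 are index, element and next element of the chain, and
      register 3 is the guessed initial value; the parameters start at register 4.\<close>
    have "chk B (\<lambda>W s. computes g (term_values ((\<lambda>W s. s 0) # (\<lambda>W s. s 1) # map (rename (\<lambda>i. Suc i + 3)) us) W s) (s 2))"
      using us by (intro PrimRec.IH(2)) (simp_all add: chkf_reg list_all_chkf_rename)
    then have "chk B (\<lambda>W s. computes g (s 0 # s 1 # term_values us W (\<lambda>i. s (Suc i + 3))) (s 2))"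
      by simp
    from chk_chain[where R = "\<lambda>W n y z s. computes g (n # y # term_values us W (\<lambda>i. s (Suc i))) z",
        OF this chkf_rename[OF t, of Suc] chkf_reg[of B 0] chkf_rename[OF PrimRec.prems(2), of Suc]]
    have chain: "chk B (\<lambda>W s. \<exists>y. y 0 = s 0 \<and> y (t W (\<lambda>i. s (Suc i))) = z W (\<lambda>i. s (Suc i)) \<and>
        (\<forall>n<t W (\<lambda>i. s (Suc i)). computes g (n # y n # term_values us W (\<lambda>i. s (Suc i))) (y (Suc n))))" .
    have "chk B (\<lambda>W s. computes f (term_values (map (rename Suc) us) W s) (s 0))"
      using us by (intro PrimRec.IH(1)) (simp_all add: chkf_reg list_all_chkf_rename)
    then have "chk B (\<lambda>W s. computes f (term_values us W (\<lambda>i. s (Suc i))) (s 0))"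
      by simp
    from chk_conj[OF this chain]
    have "chk B (\<lambda>W s. \<exists>y0. computes f (term_values us W s) y0 \<and>
        (\<exists>y. y 0 = y0 \<and> y (t W s) = z W s \<and>
        (\<forall>n<t W s. computes g (n # y n # term_values us W s) (y (Suc n)))))"
      by (rule chk_ex)
    then show ?thesis
      by (rule chk_cong) (auto simp: Cons computes_PrimRec_iff)
  qed
next
  case (Min f)
  have "chk B (\<lambda>W s. computes f (term_values (z # ts) W s) ((\<lambda>W s. 0) W s))"
    using Min by (intro Min.IH) (simp_all add: chkf_0)
  then have 1: "chk B (\<lambda>W s. computes f (z W s # term_values ts W s) 0)"
    by simp
  \<comment> \<open>Register 0 is the guessed \<open>y\<close>, register 1 the candidate
    \<open>m\<close>.\<close>
  have "chk B (\<lambda>W s. computes f (term_values ((\<lambda>W s. s 1) # map (rename (\<lambda>i. Suc (Suc i))) ts) W s) ((\<lambda>W s. Suc (s 0)) W s))"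
    using Min.prems by (intro Min.IH) (simp_all add: chkf_reg chkf_Suc list_all_chkf_rename)
  then have "chk B (\<lambda>W s. computes f (s (Suc 0) # term_values ts W (\<lambda>i. s (Suc (Suc i)))) (Suc (s 0)))"
    by simp
  then have "chk B (\<lambda>W s. \<exists>y. computes f (s 0 # term_values ts W (\<lambda>i. s (Suc i))) (Suc y))"
    by (rule chk_ex)
  then have "chk B (\<lambda>W s. \<forall>m<z W s. \<exists>y. computes f (m # term_values ts W s) (Suc y))"
    by (rule chk_all_less) (rule Min.prems)
  from chk_conj[OF 1 this] show ?case
    by (simp add: computes_Min_iff)
qed

text \<open>The characteristic function is total and single valued, so non-membership is checked by
  computing the value 0. Here the relation must be recursive and not merely enumerable.\<close>

lemma chk_recursive_rel:
  assumes "recursive_rel R" "chkf B f" "chkf B g"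
  shows "chk B (\<lambda>W s. (f W s, g W s) \<in> R)" "chk B (\<lambda>W s. (f W s, g W s) \<notin> R)"
proof -
  obtain r where "\<forall>x y. computes r [x, y] (if (x, y) \<in> R then 1 else 0)"
    using assms(1) unfolding recursive_rel_def ..
  then have r: "computes r [x, y] (if (x, y) \<in> R then 1 else 0)" for x y
    by blast
  have eq: "computes r [x, y] z \<longleftrightarrow> z = (if (x, y) \<in> R then 1 else 0)" for x y z
    using computes_functional[OF r[of x y], of z] r[of x y] by blast
  have "chk B (\<lambda>W s. computes r (term_values [f, g] W s) ((\<lambda>W s. c) W s))" for c
    using assms by (intro chk_computes) (simp_all add: chkf_const)
  note chk_r = this[unfolded term_values_simps]
  have "computes r [x, y] 1 \<longleftrightarrow> (x, y) \<in> R" for x y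
    by (simp add: eq)
  then show "chk B (\<lambda>W s. (f W s, g W s) \<in> R)"
    using chk_r[of 1] by (simp only:)
  have "computes r [x, y] 0 \<longleftrightarrow> (x, y) \<notin> R" for x y
    by (simp add: eq)
  then show "chk B (\<lambda>W s. (f W s, g W s) \<notin> R)"
    using chk_r[of 0] by (simp only:)
qed

section \<open>The complete sets are recognizable\<close>

lemma recursive_ordinal_rank:
  assumes "recursive_ordinal \<alpha>"
  obtains R rk where "recursive_rel R" "bij_betw rk (Field R) {..<\<alpha>}"
    "\<And>x y. (x, y) \<in> R \<longleftrightarrow> x \<in> Field R \<and> y \<in> Field R \<and> rk x \<le> rk y"
proof -
  obtain R where R: "recursive_rel R" "(R, segment \<alpha>) \<in> ordIso"
    using assms by (auto simp: recursive_ordinal_def)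
  then obtain rk where "iso R (segment \<alpha>) rk"
    by (auto simp: ordIso_def)
  moreover have F: "Field (segment \<alpha>) = {..<\<alpha>}"
    by (auto simp: segment_def Field_def)
  ultimately have bij: "bij_betw rk (Field R) {..<\<alpha>}"
    and ord: "\<And>x y. x \<in> Field R \<Longrightarrow> y \<in> Field R \<Longrightarrow> (x, y) \<in> R \<longleftrightarrow> (rk x, rk y) \<in> segment \<alpha>"
    by (auto simp: iso_iff2)
  have lt: "rk x < \<alpha>" if "x \<in> Field R" for x
    using bij that by (auto simp: bij_betw_def)
  have iff: "(x, y) \<in> R \<longleftrightarrow> x \<in> Field R \<and> y \<in> Field R \<and> rk x \<le> rk y" for x y
  proof
    assume "(x, y) \<in> R"
    moreover from this have "x \<in> Field R" "y \<in> Field R"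
      by (auto simp: Field_def)
    ultimately show "x \<in> Field R \<and> y \<in> Field R \<and> rk x \<le> rk y"
      using ord[of x y] by (auto simp: segment_def)
  next
    assume "x \<in> Field R \<and> y \<in> Field R \<and> rk x \<le> rk y"
    then show "(x, y) \<in> R"
      using ord[of x y] lt by (auto simp: segment_def)
  qed
  show ?thesis
    by (rule that[OF R(1) bij iff])
qed

text \<open>A number codes a finite sequence of indices, and thereby an iterated subword.\<close>

function iter_subword :: "(nat \<Rightarrow> nat) \<Rightarrow> nat \<Rightarrow> nat \<Rightarrow> nat" where
  "iter_subword \<sigma> 0 = \<sigma>"
| "iter_subword \<sigma> (Suc c) = subword (snd (prod_decode c)) (iter_subword \<sigma> (fst (prod_decode c)))"
  by pat_completeness auto
termination
proof (relation "Wellfounded.measure snd")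
  fix c
  have "fst (prod_decode c) \<le> c"
    by (metis le_prod_encode_1 prod.collapse prod_decode_inverse)
  then show "((\<sigma>, fst (prod_decode c)), (\<sigma>, Suc c)) \<in> Wellfounded.measure snd" for \<sigma> :: "nat \<Rightarrow> nat"
    by simp
qed simp

type_synonym hset_world = "nat \<Rightarrow> nat \<times> bool set"

text \<open>
  The two tracks of the colouring hold the letters of all iterated subwords, and the truth value of
  membership of the iterated subword \<open>s\<close> in the set of rank \<^term>\<open>rk a\<close>.
\<close>

definition W_mem :: "hset_world \<Rightarrow> nat \<Rightarrow> nat \<Rightarrow> bool"
  where "W_mem W s i \<longleftrightarrow> True \<in> snd (W (prod_encode (s, i)))"

definition X_mem :: "hset_world \<Rightarrow> nat \<Rightarrow> nat \<Rightarrow> bool"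
  where "X_mem W a s \<longleftrightarrow> False \<in> snd (W (prod_encode (a, s)))"

abbreviation child :: "nat \<Rightarrow> nat \<Rightarrow> nat \<Rightarrow> nat"
  where "child s n b \<equiv> Suc (prod_encode (s, prod_encode (n, b)))"

definition hset_ok :: "nat rel \<Rightarrow> nat \<Rightarrow> hset_world \<Rightarrow> nat \<Rightarrow> nat \<Rightarrow> nat \<Rightarrow> nat \<Rightarrow> nat \<Rightarrow> bool"
  where "hset_ok R a0 W a s n b i \<longleftrightarrow>
    (W_mem W 0 i \<longleftrightarrow> fst (W i) = 1) \<and>
    (W_mem W (child s n b) i \<longleftrightarrow> W_mem W s (prod_encode (prod_encode (n, b), i))) \<and>
    (X_mem W a0 s \<longleftrightarrow> \<not> W_mem W s 0) \<and>
    (a = a0 \<or> (a, a) \<notin> R \<or> \<not> X_mem W a s \<or>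
      (\<exists>n b. (b, a) \<in> R \<and> b \<noteq> a \<and> \<not> X_mem W b (child s n b))) \<and>
    (a = a0 \<or> (b, a) \<notin> R \<or> b = a \<or> X_mem W b (child s n b) \<or> X_mem W a s)"

lemma chk_X_mem:
  assumes "chkf B f" "chkf B g"
  shows "chk B (\<lambda>W s. X_mem W (f W s) (g W s))" "chk B (\<lambda>W s. \<not> X_mem W (f W s) (g W s))"
  unfolding X_mem_def
  by (rule chk_sym[OF chkf_prod_encode[OF assms], where P = "\<lambda>b. False \<in> snd b"]
      chk_sym[OF chkf_prod_encode[OF assms], where P = "\<lambda>b. False \<notin> snd b"])+

lemma chk_W_mem:
  assumes "chkf B f" "chkf B g"
  shows "chk B (\<lambda>W s. W_mem W (f W s) (g W s))" "chk B (\<lambda>W s. \<not> W_mem W (f W s) (g W s))"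
  unfolding W_mem_def
  by (rule chk_sym[OF chkf_prod_encode[OF assms], where P = "\<lambda>b. True \<in> snd b"]
      chk_sym[OF chkf_prod_encode[OF assms], where P = "\<lambda>b. True \<notin> snd b"])+

lemma chk_hset_ok:
  assumes R: "recursive_rel R"
    and f: "chkf B fa" "chkf B fs" "chkf B fn" "chkf B fb" "chkf B fi"
  shows "chk B (\<lambda>W s. hset_ok R a0 W (fa W s) (fs W s) (fn W s) (fb W s) (fi W s))"
proof -
  have l: "chk B (\<lambda>W s. fst (W (fi W s)) = 1)" "chk B (\<lambda>W s. fst (W (fi W s)) \<noteq> 1)"
    by (rule chk_sym[OF f(5), where P = "\<lambda>b. fst b = 1"] chk_sym[OF f(5), where P = "\<lambda>b. fst b \<noteq> 1"])+
  have nn: "chk B (\<lambda>W s. \<not> \<not> W_mem W (f W s) (g W s))" if "chkf B f" "chkf B g" for f g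
    using chk_W_mem(1)[OF that] by simp
  note f2 = chkf_rename[OF f(1), of "\<lambda>i. Suc (Suc i)"] chkf_rename[OF f(2), of "\<lambda>i. Suc (Suc i)"]
  note c = chkf_Suc chkf_prod_encode chkf_const chkf_reg f f2
  show ?thesis
    unfolding hset_ok_def
    by (intro chk_conj chk_disj chk_iff chk_ex chk_eq chk_neq chk_recursive_rel[OF R]
        chk_W_mem chk_X_mem l nn c)
qed

text \<open>Local correctness forces the table, because its equations are well founded: a child has
  a larger code than its parent, so letters are settled by induction on the code, and memberships by
  induction on the rank.\<close>

lemma hset_ok_imp_correct:
  assumes D: "bij_betw rk (Field R) {..<\<alpha>}"
    and R: "\<And>x y. (x, y) \<in> R \<longleftrightarrow> x \<in> Field R \<and> y \<in> Field R \<and> rk x \<le> rk y"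
    and a0: "a0 \<in> Field R" "rk a0 = 0"
    and ok: "\<And>a s n b i. hset_ok R a0 W a s n b i"
    and \<sigma>: "\<And>i. fst (W i) \<in> {0, 1}" and a: "a \<in> Field R"
  shows "X_mem W a s \<longleftrightarrow> iter_subword (\<lambda>i. fst (W i)) s \<in> hset (Field R) rk (rk a)"
proof -
  let ?w = "iter_subword (\<lambda>i. fst (W i))"
  have inj: "x = y" if "x \<in> Field R" "y \<in> Field R" "rk x = rk y" for x y
    using D that by (auto simp: bij_betw_def inj_on_def)
  have R_less: "(b, a) \<in> R \<and> b \<noteq> a \<longleftrightarrow> b \<in> Field R \<and> rk b < rk a" if "a \<in> Field R" for a b
    using R[of b a] inj[of a b] that by (auto simp: less_le)
  have W: "W_mem W s i \<longleftrightarrow> ?w s i \<noteq> 0" for s i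
  proof (induction s arbitrary: i rule: less_induct)
    case (less s)
    show ?case
    proof (cases s)
      case 0
      then show ?thesis
        using ok[of 0 0 0 0 i] \<sigma>[of i] by (auto simp: hset_ok_def)
    next
      case (Suc c)
      obtain s' n b where c: "c = prod_encode (s', prod_encode (n, b))"
        by (metis prod.collapse prod_decode_inverse)
      then have "s' < s"
        using le_prod_encode_1[of s' "prod_encode (n, b)"] Suc by simp
      have "W_mem W s i \<longleftrightarrow> W_mem W s' (prod_encode (prod_encode (n, b), i))"
        using ok[of 0 s' n b i] by (simp add: hset_ok_def c Suc)
      also have "\<dots> \<longleftrightarrow> ?w s i \<noteq> 0"
        using less[OF \<open>s' < s\<close>] by (simp add: Suc c subword_def)
      finally show ?thesis .
    qed
  qed
  have child: "?w (child s n b) = subword (prod_encode (n, b)) (?w s)" for s n b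
    by simp
  show ?thesis
    using a
  proof (induction "rk a" arbitrary: a s rule: less_induct)
    case less
    show ?case
    proof (cases "a = a0")
      case True
      then show ?thesis
        using ok[of 0 s 0 0 0] W[of s 0] a0(2) by (simp add: hset_ok_def hset_0)
    next
      case False
      then have pos: "0 < rk a"
        using inj[OF less.prems a0(1)] a0(2) omega1_zero_le[of "rk a"] by (auto simp: order_le_less)
      have "(a, a) \<in> R"
        using R less.prems by simp
      have "X_mem W a s \<longleftrightarrow> (\<exists>n b. b \<in> Field R \<and> rk b < rk a \<and> \<not> X_mem W b (child s n b))"
      proof
        assume "X_mem W a s"
        then show "\<exists>n b. b \<in> Field R \<and> rk b < rk a \<and> \<not> X_mem W b (child s n b)"
          using ok[of a s 0 0 0] False \<open>(a, a) \<in> R\<close> R_less[OF less.prems] unfolding hset_ok_def by blast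
      next
        assume "\<exists>n b. b \<in> Field R \<and> rk b < rk a \<and> \<not> X_mem W b (child s n b)"
        then obtain n b where nb: "b \<in> Field R \<and> rk b < rk a" "\<not> X_mem W b (child s n b)"
          by blast
        then have "(b, a) \<in> R \<and> b \<noteq> a"
          using R_less[OF less.prems] by blast
        then show "X_mem W a s"
          using ok[of a s n b 0] False nb(2) unfolding hset_ok_def by blast
      qed
      also have "\<dots> \<longleftrightarrow> (\<exists>n b. b \<in> Field R \<and> rk b < rk a \<and>
          subword (prod_encode (n, b)) (?w s) \<notin> hset (Field R) rk (rk b))"
        using less.hyps unfolding child[symmetric] by metis
      also have "\<dots> \<longleftrightarrow> ?w s \<in> hset (Field R) rk (rk a)"
        unfolding hset_pos[OF pos] ..
      finally show ?thesis .
    qed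
  qed
qed

lemma hset_world_exists:
  assumes D: "bij_betw rk (Field R) {..<\<alpha>}"
    and R: "\<And>x y. (x, y) \<in> R \<longleftrightarrow> x \<in> Field R \<and> y \<in> Field R \<and> rk x \<le> rk y"
    and a0: "a0 \<in> Field R" "rk a0 = 0" and \<sigma>: "\<And>i. \<sigma> i \<in> {0, 1}"
  shows "\<exists>Y. \<forall>a s n b i. hset_ok R a0 (\<lambda>i. (\<sigma> i, Y i)) a s n b i \<and>
    (X_mem (\<lambda>i. (\<sigma> i, Y i)) a s \<longleftrightarrow> iter_subword \<sigma> s \<in> hset (Field R) rk (rk a))"
proof -
  define Y where "Y m = {x. if x then iter_subword \<sigma> (fst (prod_decode m)) (snd (prod_decode m)) \<noteq> 0
    else iter_subword \<sigma> (snd (prod_decode m)) \<in> hset (Field R) rk (rk (fst (prod_decode m)))}" for m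
  define W where "W = (\<lambda>i. (\<sigma> i, Y i))"
  have W_mem: "W_mem W s i \<longleftrightarrow> iter_subword \<sigma> s i \<noteq> 0" for s i
    by (simp add: W_mem_def W_def Y_def)
  have X_mem: "X_mem W a s \<longleftrightarrow> iter_subword \<sigma> s \<in> hset (Field R) rk (rk a)" for a s
    by (simp add: X_mem_def W_def Y_def)
  have sub: "iter_subword \<sigma> (child s n b) = subword (prod_encode (n, b)) (iter_subword \<sigma> s)" for s n b
    by simp
  have less: "(b, a) \<in> R \<and> b \<noteq> a \<longleftrightarrow> b \<in> Field R \<and> rk b < rk a" if "a \<in> Field R" for a b
    using R[of b a] D that by (auto simp: less_le bij_betw_def inj_on_def)
  have pos: "0 < rk a" if "a \<in> Field R" "a \<noteq> a0" for a
    using less[OF that(1), of a0] R[of a0 a] a0 that omega1_zero_le[of "rk a"] by auto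
  have ok: "hset_ok R a0 W a s n b i" for a s n b i
    unfolding hset_ok_def
  proof (intro conjI)
    show "W_mem W 0 i \<longleftrightarrow> fst (W i) = 1"
      using \<sigma>[of i] unfolding W_mem by (auto simp: W_def)
    show "W_mem W (child s n b) i \<longleftrightarrow> W_mem W s (prod_encode (prod_encode (n, b), i))"
      unfolding W_mem sub by (simp add: subword_def)
    show "X_mem W a0 s \<longleftrightarrow> \<not> W_mem W s 0"
      by (simp add: X_mem W_mem a0 hset_0)
    show "a = a0 \<or> (a, a) \<notin> R \<or> \<not> X_mem W a s \<or>
        (\<exists>n b. (b, a) \<in> R \<and> b \<noteq> a \<and> \<not> X_mem W b (child s n b))"
    proof (cases "a = a0 \<or> (a, a) \<notin> R \<or> \<not> X_mem W a s")
      case False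
      then have aF: "a \<in> Field R"
        using R by blast
      obtain n b where "b \<in> Field R \<and> rk b < rk a"
          "subword (prod_encode (n, b)) (iter_subword \<sigma> s) \<notin> hset (Field R) rk (rk b)"
        using False hset_pos[OF pos[OF aF], of "iter_subword \<sigma> s"] unfolding X_mem by blast
      then have "(b, a) \<in> R \<and> b \<noteq> a" "\<not> X_mem W b (child s n b)"
        unfolding less[OF aF] X_mem sub by blast+
      then show ?thesis by blast
    qed blast
    show "a = a0 \<or> (b, a) \<notin> R \<or> b = a \<or> X_mem W b (child s n b) \<or> X_mem W a s"
    proof (cases "a = a0 \<or> (b, a) \<notin> R \<or> b = a \<or> X_mem W b (child s n b)")
      case False
      then have aF: "a \<in> Field R"
        using R by blast
      have "b \<in> Field R \<and> rk b < rk a"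
        using False unfolding less[OF aF, symmetric] by blast
      moreover have "subword (prod_encode (n, b)) (iter_subword \<sigma> s) \<notin> hset (Field R) rk (rk b)"
        using False unfolding X_mem sub by blast
      ultimately have "X_mem W a s"
        unfolding X_mem using False hset_pos[OF pos[OF aF]] by blast
      then show ?thesis by blast
    qed blast
  qed
  show ?thesis
    by (rule exI[of _ Y]) (use ok X_mem in \<open>simp add: W_def\<close>)
qed

text \<open>Some correct colouring exists and all correct ones give the same answer. Thus the set
  and its complement are both existential in the colouring, the usual argument for \<Delta>11
  sets.\<close>

theorem hset_buchi_recognizable:
  assumes rec: "recursive_rel R" and D: "bij_betw rk (Field R) {..<\<alpha>}"
    and R: "\<And>x y. (x, y) \<in> R \<longleftrightarrow> x \<in> Field R \<and> y \<in> Field R \<and> rk x \<le> rk y"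
    and \<alpha>: "0 < \<alpha>"
  shows "buchi_recognizable {0, 1} {p \<in> pictures {0, 1}. first_row p \<in> hset (Field R) rk \<alpha>}" (is ?pos)
    and "buchi_recognizable {0, 1} {p \<in> pictures {0, 1}. first_row p \<notin> hset (Field R) rk \<alpha>}" (is ?neg)
proof -
  have "0 \<in> rk ` Field R"
    using D \<alpha> by (simp add: bij_betw_def)
  then obtain a0 where a0: "a0 \<in> Field R" "rk a0 = 0"
    by auto
  have lt: "rk x < \<alpha>" if "x \<in> Field R" for x
    using D that by (auto simp: bij_betw_def)
  have Rdiag: "(b, b) \<in> R \<longleftrightarrow> b \<in> Field R \<and> rk b < \<alpha>" for b
    using R[of b b] lt by auto
  have A: "alphabet {0, 1}"
    by (simp add: alphabet_def)
  \<comment> \<open>No label has rank \<alpha> itself, so the outermost union has no entry in the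
    table and is evaluated from the entries of its terms, the children of the whole word with code
    0.\<close>
  define top where "top W n b \<longleftrightarrow> (b, b) \<in> R \<and> \<not> X_mem W b (child 0 n b)" for W n b
  define correct where "correct W \<longleftrightarrow> (\<forall>a s n b i. hset_ok R a0 W a s n b i)" for W
  have top: "(\<exists>n b. top (\<lambda>i. (\<sigma> i, Y i)) n b) \<longleftrightarrow> \<sigma> \<in> hset (Field R) rk \<alpha>"
    if \<sigma>: "\<And>i. \<sigma> i \<in> {0, 1}" and c: "correct (\<lambda>i. (\<sigma> i, Y i))" for \<sigma> Y
  proof -
    have "X_mem (\<lambda>i. (\<sigma> i, Y i)) b (child 0 n b) \<longleftrightarrow>
        subword (prod_encode (n, b)) \<sigma> \<in> hset (Field R) rk (rk b)" if "b \<in> Field R" for n b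
    proof -
      have "hset_ok R a0 (\<lambda>i. (\<sigma> i, Y i)) a s n b i" for a s n b i
        using c by (simp add: correct_def)
      from hset_ok_imp_correct[OF D R a0 this _ that, of "child 0 n b"] \<sigma> show ?thesis
        by simp
    qed
    then show ?thesis
      unfolding top_def hset_pos[OF \<alpha>] Rdiag by blast
  qed
  have ex: "\<exists>Y. correct (\<lambda>i. (\<sigma> i, Y i))" if \<sigma>: "\<And>i. \<sigma> i \<in> {0, 1}" for \<sigma>
  proof -
    from hset_world_exists[where \<sigma> = \<sigma>, OF D R a0 \<sigma>] obtain Y where
      "\<forall>a s n b i. hset_ok R a0 (\<lambda>i. (\<sigma> i, Y i)) a s n b i \<and>
        (X_mem (\<lambda>i. (\<sigma> i, Y i)) a s \<longleftrightarrow> iter_subword \<sigma> s \<in> hset (Field R) rk (rk a))" ..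
    then show ?thesis
      by (intro exI[of _ Y]) (simp add: correct_def)
  qed
  have letters: "first_row p i \<in> {0, 1}" if "p \<in> pictures {0, 1}" for p i
    using read_picture_in_words[OF that, of "\<lambda>i. (i, 0)"] by (auto simp: topspace_words)
  have top_row: "(\<exists>n b. top (\<lambda>i. (first_row p i, Y i)) n b) \<longleftrightarrow> first_row p \<in> hset (Field R) rk \<alpha>"
    if "p \<in> pictures {0, 1}" "correct (\<lambda>i. (first_row p i, Y i))" for p Y
    by (rule top[of "first_row p", OF letters[OF that(1)] that(2)])
  have ex_row: "\<exists>Y. correct (\<lambda>i. (first_row p i, Y i))" if "p \<in> pictures {0, 1}" for p
    by (rule ex[of "first_row p", OF letters[OF that]])
  \<comment> \<open>A round has a single number as its input; it codes the five parameters of an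
    instance.\<close>
  define decoded where "decoded Q W m \<longleftrightarrow> (Q :: hset_world \<Rightarrow> nat \<Rightarrow> nat \<Rightarrow> nat \<Rightarrow> nat \<Rightarrow> nat \<Rightarrow> bool) W
      (fst (prod_decode m)) (fst (prod_decode (snd (prod_decode m))))
      (fst (prod_decode (snd (prod_decode (snd (prod_decode m))))))
      (fst (prod_decode (snd (prod_decode (snd (prod_decode (snd (prod_decode m))))))))
      (snd (prod_decode (snd (prod_decode (snd (prod_decode (snd (prod_decode m))))))))" for Q W m
  have decoded: "(\<forall>m. decoded Q W m) \<longleftrightarrow> (\<forall>a s n b i. Q W a s n b i)" for Q W
  proof
    assume *: "\<forall>m. decoded Q W m"
    show "\<forall>a s n b i. Q W a s n b i"
    proof (intro allI)
      fix a s n b i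
      show "Q W a s n b i"
        using *[rule_format, of "prod_encode (a, prod_encode (s, prod_encode (n, prod_encode (b, i))))"]
        by (simp add: decoded_def)
    qed
  qed (simp add: decoded_def)
  have rec_at: "buchi_recognizable {0, 1} {p \<in> pictures {0, 1}.
      \<exists>Y. \<forall>a s n b i. Q (\<lambda>i. (first_row p i, Y i)) a s n b i}"
    if "chk ({0, 1} \<times> Pow UNIV) (\<lambda>W s. decoded Q W (s 0))" for Q
    using chk_buchi_recognizable[OF A finite[of UNIV] that]
    unfolding decoded first_row_def[symmetric] One_nat_def by simp
  note c = chkf_Suc chkf_prod_encode chkf_0 chkf_reg chkf_fst_prod_decode chkf_snd_prod_decode
  \<comment> \<open>The witness for \<open>top\<close> is guessed anew in every round.\<close>
  have "chk ({0, 1} \<times> Pow UNIV) (\<lambda>W s. decoded (\<lambda>W a s n b i. hset_ok R a0 W a s n b i \<and> (\<exists>n b. top W n b)) W (s 0))"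
    unfolding decoded_def top_def by (intro chk_conj chk_ex chk_hset_ok chk_recursive_rel[OF rec] chk_X_mem rec c)
  from rec_at[OF this] have "buchi_recognizable {0, 1} {p \<in> pictures {0, 1}.
      \<exists>Y. correct (\<lambda>i. (first_row p i, Y i)) \<and> (\<exists>n b. top (\<lambda>i. (first_row p i, Y i)) n b)}"
    by (simp add: correct_def)
  moreover have "(\<exists>Y. correct (\<lambda>i. (first_row p i, Y i)) \<and> (\<exists>n b. top (\<lambda>i. (first_row p i, Y i)) n b)) \<longleftrightarrow>
      first_row p \<in> hset (Field R) rk \<alpha>" if p: "p \<in> pictures {0, 1}" for p
  proof -
    obtain Y where "correct (\<lambda>i. (first_row p i, Y i))"
      using ex_row[OF p] ..
    then show ?thesis
      using top_row[OF p] by (auto simp only: intro!: exI[of _ Y])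
  qed
  ultimately show ?pos
    by (simp only: cong: conj_cong)
  have "chk ({0, 1} \<times> Pow UNIV) (\<lambda>W s. (b W s, b W s) \<notin> R \<or> X_mem W (b W s) (child 0 (n W s) (b W s)))"
    if "chkf ({0, 1} \<times> Pow UNIV) n" "chkf ({0, 1} \<times> Pow UNIV) b" for n b
    by (intro chk_disj chk_recursive_rel[OF rec] chk_X_mem c that)
  then have not_top: "chk ({0, 1} \<times> Pow UNIV) (\<lambda>W s. \<not> top W (n W s) (b W s))"
    if "chkf ({0, 1} \<times> Pow UNIV) n" "chkf ({0, 1} \<times> Pow UNIV) b" for n b
    unfolding top_def using that by simp
  \<comment> \<open>Here \<open>n\<close> and \<open>b\<close> are those of the instance; over all
    rounds they run through all pairs, which yields the universal statement.\<close>
  have "chk ({0, 1} \<times> Pow UNIV) (\<lambda>W s. decoded (\<lambda>W a s n b i. hset_ok R a0 W a s n b i \<and> \<not> top W n b) W (s 0))"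
    unfolding decoded_def by (intro chk_conj chk_hset_ok not_top rec c)
  from rec_at[OF this] have "buchi_recognizable {0, 1} {p \<in> pictures {0, 1}.
      \<exists>Y. correct (\<lambda>i. (first_row p i, Y i)) \<and> \<not> (\<exists>n b. top (\<lambda>i. (first_row p i, Y i)) n b)}"
    by (simp add: correct_def all_conj_distrib)
  moreover have "(\<exists>Y. correct (\<lambda>i. (first_row p i, Y i)) \<and> \<not> (\<exists>n b. top (\<lambda>i. (first_row p i, Y i)) n b)) \<longleftrightarrow>
      first_row p \<notin> hset (Field R) rk \<alpha>" if p: "p \<in> pictures {0, 1}" for p
  proof -
    obtain Y where "correct (\<lambda>i. (first_row p i, Y i))"
      using ex_row[OF p] ..
    then show ?thesis
      using top_row[OF p] by (auto simp only: intro!: exI[of _ Y])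
  qed
  ultimately show ?neg
    by (simp only: cong: conj_cong)
qed

lemma buchi_class_complete:
  assumes "recursive_ordinal \<alpha>" "0 < \<alpha>"
  shows "\<exists>(X, L)\<in>buchi_class. Sigma0_complete X \<alpha> L" "\<exists>(X, L)\<in>buchi_class. Pi0_complete X \<alpha> L"
proof -
  obtain R rk where R: "recursive_rel R" "bij_betw rk (Field R) {..<\<alpha>}"
    "\<And>x y. (x, y) \<in> R \<longleftrightarrow> x \<in> Field R \<and> y \<in> Field R \<and> rk x \<le> rk y"
    by (rule recursive_ordinal_rank[OF assms(1)]) (rule that)
  let ?S = "{\<sigma> \<in> topspace (words {0, 1}). \<sigma> \<in> hset (Field R) rk \<alpha>}"
  let ?L = "{p \<in> pictures {0, 1}. first_row p \<in> ?S}"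
  let ?L' = "topspace (picture_space {0, 1}) - ?L"
  have "?L = {p \<in> pictures {0, 1}. first_row p \<in> hset (Field R) rk \<alpha>}"
      "?L' = {p \<in> pictures {0, 1}. first_row p \<notin> hset (Field R) rk \<alpha>}"
    using read_picture_in_words by (auto simp: topspace_picture_space)
  then have "buchi_recognizable {0, 1} ?L" "buchi_recognizable {0, 1} ?L'"
    using hset_buchi_recognizable[OF R assms(2)] by simp_all
  moreover have "alphabet {0, 1}"
    by (simp add: alphabet_def)
  ultimately have in_class: "(picture_space {0, 1}, ?L) \<in> buchi_class" "(picture_space {0, 1}, ?L') \<in> buchi_class"
    unfolding buchi_class_def by blast+
  have "wadge_equiv (words {0, 1}) ?S (picture_space {0, 1}) ?L"
    by (rule first_row_wadge_equiv) blast
  then have L: "Sigma0_complete (picture_space {0, 1}) \<alpha> ?L"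
    using Sigma0_complete_hset[OF R(2) assms(2)] unfolding Sigma0_complete_def
    by (rule wadge_equiv_complete_for)
  with in_class(1) show "\<exists>(X, L)\<in>buchi_class. Sigma0_complete X \<alpha> L"
    by blast
  from in_class(2) Pi0_complete_compl[OF L] show "\<exists>(X, L)\<in>buchi_class. Pi0_complete X \<alpha> L"
    by blast
qed

theorem mainTheorem2:
  shows "equal_borel_hierarchies buchi_class Sigma11_class \<and>
    gamma12 = Sup {\<alpha>. \<exists>(X, L)\<in>buchi_class. borel_rank X L \<alpha>} \<and>
    (\<forall>\<alpha>. 0 < \<alpha> \<and> \<alpha> < omega1_CK \<longrightarrow>
      (\<exists>(X, L)\<in>buchi_class. Sigma0_complete X \<alpha> L) \<and>
      (\<exists>(X, L)\<in>buchi_class. Pi0_complete X \<alpha> L))"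
proof (intro conjI allI impI)
  show "equal_borel_hierarchies buchi_class Sigma11_class"
    by (rule equal_borel_hierarchies_buchi_Sigma11)
  \<comment> \<open>Equal sets of ranks give equal suprema; duality leads from the analytic sets of
    (a) to the coanalytic sets defining \<open>gamma12\<close>.\<close>
  then have "borel_ranks buchi_class = borel_ranks Pi11_class"
    by (simp add: equal_borel_hierarchies_borel_ranks borel_ranks_Pi11_eq_Sigma11)
  then show "gamma12 = Sup {\<alpha>. \<exists>(X, L)\<in>buchi_class. borel_rank X L \<alpha>}"
    unfolding gamma12_def by (simp add: borel_ranks_def)
next
  fix \<alpha> assume "0 < \<alpha> \<and> \<alpha> < omega1_CK"
  then have "recursive_ordinal \<alpha>" "0 < \<alpha>"
    using not_less_Least unfolding omega1_CK_def by blast+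
  then show "\<exists>(X, L)\<in>buchi_class. Sigma0_complete X \<alpha> L" "\<exists>(X, L)\<in>buchi_class. Pi0_complete X \<alpha> L"
    by (rule buchi_class_complete)+
qed

end
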